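(* Let $\mathbb{K}$ be a field, let $G$ be a connected bipartite graph with vertex set $V(G)=\{v_1,\ldots,v_r\}$, $r=|V(G)|$. Assume that $\mathrm{reg}(I(G))>3$ and let $t=2s\geq 6$ be the minimal length of an induced cycle of length $\geq 6$ in the bipartite complement $G^{bc}$. Then: (1) $\beta_{i,j}(I(G))=0$ for all $i<t-4$ and $j>i+3$; (2) $\beta_{t-4,t}(I(G))=|\{\text{induced } t\text{-cycles in } G^{bc}\}|$; (3) $\beta_{t-4,j}(I(G))=0$ for all $j>t$; (4) for any $\mathbf{m}=(m_1,\ldots,m_r)\in\mathbb{N}^r$ such that $|\mathbf{m}|=m_1+\cdots+m_r=t$, one has $\beta_{t-4,\mathbf{m}}(I(G))=1$ if $\mathbf{m}\in\{0,1\}^{r}$ and $G^{bc}[W]\simeq C_t$, where $W:=\{v_i\in V(G): m_i=1\}$; otherwise, $\beta_{t-4,\mathbf{m}}(I(G))=0$.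
   Context: All graphs are finite and simple. For a graph $G$, $R$ is the polynomial ring over $\mathbb{K}$ whose variables are the vertices $v_1,\ldots,v_r$ of $G$, and the edge ideal $I(G)\subset R$ is generated by the monomials $uv$ with $\{u,v\}\in E(G)$. For a homogeneous ideal $I\subset R$, the graded Betti number $\beta_{i,j}(I)$ is the number of copies of $R(-j)$ in homological degree $i$ in the minimal graded free resolution of $I$ (of the ideal $I$, not of $R/I$; so $\beta_{0,j}(I)$ counts minimal generators of $I$ of degree $j$), and $\mathrm{reg}(I)=\max\{j-i:\beta_{i,j}(I)\neq 0\}$. For a monomial ideal, the multigraded Betti number $\beta_{i,\mathbf{m}}(I)$, $\mathbf{m}\in\mathbb{N}^r$, is defined in the same way from the minimal $\mathbb{N}^r$-multigraded free resolution of $I$. If $G$ is bipartite with bipartition $V(G)=X\sqcup Y$ (unique since $G$ is connected), its bipartite complement $G^{bc}$ is the bipartite graph on $X\sqcup Y$ with edges $\{x,y\}$, $x\in X$, $y\in Y$, $\{x,y\}\notin E(G)$. $H[W]$ denotes the induced subgraph of a graph $H$ on $W\subset V(H)$. The $t$-cycle $C_t$ ($t\geq 4$) is the connected graph on $t$ vertices all of degree two; $t$ is its length. An induced $t$-cycle of a graph is an induced subgraph isomorphic to $C_t$. *)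

theory Defs
  imports Complex_Main "HOL-Library.Poly_Mapping"
begin

section \<open>Graphs\<close>

text \<open>A finite simple graph is given by its vertex set and its set of edges, an edge being a
  two-element set of vertices. The ambient graph \<open>G\<close> has the whole of a finite type as vertex
  set; smaller vertex sets occur only for its induced subgraphs.\<close>

definition simple_graph :: "'v set \<Rightarrow> 'v set set \<Rightarrow> bool" where
  "simple_graph V E \<longleftrightarrow> finite V \<and> (\<forall>e\<in>E. e \<subseteq> V \<and> card e = 2)"

definition connected_graph :: "'v set \<Rightarrow> 'v set set \<Rightarrow> bool" where
  "connected_graph V E \<longleftrightarrow> V \<noteq> {} \<and> (\<forall>u\<in>V. \<forall>v\<in>V. (\<lambda>x y. {x, y} \<in> E)\<^sup>*\<^sup>* u v)"

definition bipartition :: "'v set \<Rightarrow> 'v set set \<Rightarrow> 'v set \<Rightarrow> 'v set \<Rightarrow> bool" where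
  "bipartition V E X Y \<longleftrightarrow>
     X \<union> Y = V \<and> X \<inter> Y = {} \<and> (\<forall>e\<in>E. \<exists>x\<in>X. \<exists>y\<in>Y. e = {x, y})"

definition bip_complement :: "'v set set \<Rightarrow> 'v set \<Rightarrow> 'v set \<Rightarrow> 'v set set" where
  "bip_complement E X Y = {{x, y} | x y. x \<in> X \<and> y \<in> Y \<and> {x, y} \<notin> E}"

definition induced_edges :: "'v set set \<Rightarrow> 'v set \<Rightarrow> 'v set set" where
  "induced_edges E W = {e \<in> E. e \<subseteq> W}"

definition vertex_degree :: "'v set set \<Rightarrow> 'v \<Rightarrow> nat" where
  "vertex_degree E v = card {e \<in> E. v \<in> e}"

definition is_cycle :: "nat \<Rightarrow> 'v set \<Rightarrow> 'v set set \<Rightarrow> bool" where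
  "is_cycle t V E \<longleftrightarrow> 4 \<le> t \<and> simple_graph V E \<and> card V = t \<and> connected_graph V E \<and>
     (\<forall>v\<in>V. vertex_degree E v = 2)"

text \<open>An induced cycle is identified with its vertex set.\<close>

definition induced_cycles :: "'v set set \<Rightarrow> nat \<Rightarrow> 'v set set" where
  "induced_cycles E t = {W. is_cycle t W (induced_edges E W)}"


section \<open>Edge ideals\<close>

text \<open>Polynomials over \<open>'k\<close> in the variables \<open>'v\<close>; a monomial is its exponent vector.\<close>

type_synonym ('v, 'k) mpoly = "('v \<Rightarrow>\<^sub>0 nat) \<Rightarrow>\<^sub>0 'k"

definition variable :: "'v \<Rightarrow> ('v, 'k::field) mpoly" where
  "variable v = Poly_Mapping.single (Poly_Mapping.single v 1) 1"

definition edge_ideal :: "'v set set \<Rightarrow> ('v, 'k::field) mpoly set" where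
  "edge_ideal E = module.span (*) {variable u * variable v | u v. {u, v} \<in> E}"


section \<open>Minimal graded free resolutions and Betti numbers\<close>

text \<open>The polynomial ring \<open>R\<close> is graded by a map \<open>\<gamma>\<close> from monomials to a commutative monoid:
  the total degree for the standard grading, the identity for the multigrading.\<close>

definition total_degree :: "('v::finite \<Rightarrow>\<^sub>0 nat) \<Rightarrow> nat" where
  "total_degree m = (\<Sum>v\<in>UNIV. Poly_Mapping.lookup m v)"

text \<open>Data of a complex \<open>\<dots> \<rightarrow> F 2 \<rightarrow> F 1 \<rightarrow> F 0 \<rightarrow> R\<close> of finitely generated graded free modules:
  \<open>F i\<close> has a basis indexed by the numbers \<open>k < rk i\<close>, the \<open>k\<close>-th basis element having degree
  \<open>shift i k\<close>, so that \<open>F i\<close> is the direct sum of the \<open>R(-shift i k)\<close>.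
  The \<open>k\<close>-th basis element of \<open>F 0\<close> is sent to the polynomial \<open>aug k\<close>, and \<open>mat i k l\<close> is
  the \<open>k\<close>-th coordinate of the image in \<open>F i\<close> of the \<open>l\<close>-th basis element of \<open>F (i + 1)\<close>.
  The type parameter \<open>'p\<close> is the type of polynomials.\<close>

record ('p, 'g) free_complex =
  rk :: "nat \<Rightarrow> nat"
  shift :: "nat \<Rightarrow> nat \<Rightarrow> 'g"
  aug :: "nat \<Rightarrow> 'p"
  mat :: "nat \<Rightarrow> nat \<Rightarrow> nat \<Rightarrow> 'p"

definition free_module :: "(('v, 'k::field) mpoly, 'g) free_complex \<Rightarrow> nat \<Rightarrow> (nat \<Rightarrow> ('v, 'k) mpoly) set" where
  "free_module F i = {x. \<forall>k\<ge>rk F i. x k = 0}"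

definition aug_map :: "(('v, 'k::field) mpoly, 'g) free_complex \<Rightarrow> (nat \<Rightarrow> ('v, 'k) mpoly) \<Rightarrow> ('v, 'k) mpoly" where
  "aug_map F x = (\<Sum>k<rk F 0. x k * aug F k)"

definition diff_map ::
  "(('v, 'k::field) mpoly, 'g) free_complex \<Rightarrow> nat \<Rightarrow> (nat \<Rightarrow> ('v, 'k) mpoly) \<Rightarrow> (nat \<Rightarrow> ('v, 'k) mpoly)" where
  "diff_map F i x = (\<lambda>k. if k < rk F i then \<Sum>l<rk F (Suc i). x l * mat F i k l else 0)"

definition graded_complex ::
  "(('v \<Rightarrow>\<^sub>0 nat) \<Rightarrow> 'g::comm_monoid_add) \<Rightarrow> (('v, 'k::field) mpoly, 'g) free_complex \<Rightarrow> bool" where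
  "graded_complex \<gamma> F \<longleftrightarrow>
     (\<forall>k<rk F 0. \<forall>m\<in>Poly_Mapping.keys (aug F k). \<gamma> m = shift F 0 k) \<and>
     (\<forall>i. \<forall>k<rk F i. \<forall>l<rk F (Suc i). \<forall>m\<in>Poly_Mapping.keys (mat F i k l).
        \<gamma> m + shift F i k = shift F (Suc i) l)"

definition resolves :: "(('v, 'k::field) mpoly, 'g) free_complex \<Rightarrow> ('v, 'k) mpoly set \<Rightarrow> bool" where
  "resolves F I \<longleftrightarrow>
     aug_map F ` free_module F 0 = I \<and>
     {x \<in> free_module F 0. aug_map F x = 0} = diff_map F 0 ` free_module F 1 \<and>
     (\<forall>i. {x \<in> free_module F (Suc i). diff_map F i x = (\<lambda>_. 0)} =
          diff_map F (Suc i) ` free_module F (Suc (Suc i)))"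

text \<open>Minimality: the image of \<open>F (i + 1)\<close> lies in \<open>\<mm> (F i)\<close>, where \<open>\<mm>\<close> is the ideal generated by
  the variables, i.e. the set of polynomials without constant term.\<close>

definition minimal_complex :: "(('v, 'k::field) mpoly, 'g) free_complex \<Rightarrow> bool" where
  "minimal_complex F \<longleftrightarrow>
     (\<forall>i. \<forall>k<rk F i. \<forall>l<rk F (Suc i). Poly_Mapping.lookup (mat F i k l) 0 = 0)"

definition minimal_graded_free_resolution ::
  "(('v \<Rightarrow>\<^sub>0 nat) \<Rightarrow> 'g::comm_monoid_add) \<Rightarrow> ('v, 'k::field) mpoly set \<Rightarrow>
    (('v, 'k) mpoly, 'g) free_complex \<Rightarrow> bool" where
  "minimal_graded_free_resolution \<gamma> I F \<longleftrightarrow>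
     graded_complex \<gamma> F \<and> resolves F I \<and> minimal_complex F"

text \<open>The choice below is meaningful when \<open>I\<close> is homogeneous for the grading \<open>\<gamma>\<close>: a minimal graded
  free resolution then exists and is unique up to isomorphism.\<close>

definition betti ::
  "(('v \<Rightarrow>\<^sub>0 nat) \<Rightarrow> 'g::comm_monoid_add) \<Rightarrow> ('v, 'k::field) mpoly set \<Rightarrow> nat \<Rightarrow> 'g \<Rightarrow> nat" where
  "betti \<gamma> I i g =
     (let F = (SOME F. minimal_graded_free_resolution \<gamma> I F)
      in card {k. k < rk F i \<and> shift F i k = g})"

definition graded_betti :: "('v::finite, 'k::field) mpoly set \<Rightarrow> nat \<Rightarrow> nat \<Rightarrow> nat" where
  "graded_betti I i j = betti total_degree I i j"

definition multigraded_betti :: "('v::finite, 'k::field) mpoly set \<Rightarrow> nat \<Rightarrow> ('v \<Rightarrow>\<^sub>0 nat) \<Rightarrow> nat" where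
  "multigraded_betti I i m = betti (\<lambda>m. m) I i m"

text \<open>The value at the zero ideal, where the maximum is over the empty set, is unspecified.\<close>

definition regularity :: "('v::finite, 'k::field) mpoly set \<Rightarrow> int" where
  "regularity I = Max {int j - int i | i j. graded_betti I i j \<noteq> 0}"

end

theory Submission
  imports Defs "HOL-Library.Function_Algebras"
begin

text \<open>
  Write \<open>I\<close> for the edge ideal of \<open>G\<close> and \<open>B\<close> for the bipartite complement. Over a minimal graded
  free resolution the number of generators of \<open>F\<^sub>i\<close> of degree \<open>g\<close> is the dimension of the Koszul
  homology \<open>H\<^sub>i(I)\<close> in degree \<open>g\<close>, by dimension shifting along the syzygy modules
  (\<open>betti_koszul\<close>). Koszul homology depends on \<open>I\<close> only, so any minimal resolution may be used to
  count. A minimal multigraded resolution exists (\<open>minimal_multigraded_resolution_exists\<close>) and is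
  also one for the total degree; hence a graded Betti number is the sum of the multigraded ones of
  that total degree (\<open>graded_betti_eq_card\<close>).

  A degree that is not squarefree contributes nothing (\<open>koszul_nonsquarefree\<close>). In the squarefree
  degree with support \<open>W\<close>, the homology \<open>H\<^sub>i(I)\<close> is the reduced cohomology of the complex of
  independent subsets of \<open>W\<close>, at sets with \<open>n = |W| - i - 1\<close> elements (\<open>koszul_squarefree\<close>, a form
  of Hochster's formula). Independent sets of \<open>G\<close> are the bicliques of \<open>B\<close>: their elements on
  the two sides are completely joined in \<open>B\<close>. The proof is a study of these complexes by the exact
  sequence that relates a complex with the deletion and the link of a vertex \<open>x\<close>; here the deletion
  belongs to \<open>W - {x}\<close>, and the link to \<open>W\<close> without \<open>x\<close> and its neighbours in \<open>G\<close>.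

  At \<open>n = 2\<close> the cohomology consists of the functions that are constant on the components of \<open>B[W]\<close>
  with at least one edge, modulo constants (\<open>cocycle_normal_form\<close>). So at \<open>n = 3\<close> it vanishes, by induction, as soon as such
  a function on the link of \<open>x\<close> extends to the deletion. If it does not extend, then two neighbours
  of \<open>x\<close> in \<open>B\<close> with different values are joined by a path of \<open>B[W - {x}]\<close>, and a shortest
  path of this kind closes up with \<open>x\<close> to an induced cycle of length at least 6
  (\<open>equal_on_component\<close>). Thus cohomology at \<open>n = 3\<close> with \<open>|W| \<le> t\<close> forces \<open>W\<close> to be an induced
  \<open>t\<close>-cycle. At \<open>n > 3\<close>, either \<open>x\<close> is isolated in \<open>G[W]\<close> and the complex is a cone, or the link
  has at least two vertices fewer than \<open>W\<close>; by induction the cohomology vanishes whenever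
  \<open>|W| \<le> t + n - 3\<close>, the only exception being the \<open>t\<close>-cycles at \<open>n = 3\<close> (\<open>acyclic_small\<close>). With
  \<open>n = |W| - i - 1\<close> this bound reads \<open>i \<le> t - 4\<close>.

  For a \<open>t\<close>-cycle, deleting \<open>x\<close> leaves a connected graph, while the link of \<open>x\<close> consists of two
  components with edges. At \<open>n = 2\<close> the cohomology of the link is therefore one-dimensional, and that
  of the deletion is zero at \<open>n = 2\<close> and \<open>n = 3\<close>; this yields dimension one for the cycle at \<open>n = 3\<close>
  (\<open>qdim_cycle\<close>).
\<close>

section \<open>Vector spaces modulo subspaces\<close>

definition lin_subspace :: "('k::field \<Rightarrow> 'a::ab_group_add \<Rightarrow> 'a) \<Rightarrow> 'a set \<Rightarrow> bool" where
  "lin_subspace sc B \<longleftrightarrow> 0 \<in> B \<and> (\<forall>x\<in>B. \<forall>y\<in>B. x - y \<in> B) \<and> (\<forall>c. \<forall>x\<in>B. sc c x \<in> B)"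

text \<open>The family \<open>b\<close> consists of representatives of a basis of \<open>Z\<close> modulo \<open>B\<close>. Working with
  representatives, homology spaces can be compared without forming quotients.\<close>

definition qbasis ::
  "('k::field \<Rightarrow> 'a::ab_group_add \<Rightarrow> 'a) \<Rightarrow> 'a set \<Rightarrow> 'a set \<Rightarrow> nat set \<Rightarrow> (nat \<Rightarrow> 'a) \<Rightarrow> bool" where
  "qbasis sc Z B J b \<longleftrightarrow> finite J \<and> (\<forall>j\<in>J. b j \<in> Z) \<and>
     (\<forall>z\<in>Z. \<exists>c. z - (\<Sum>j\<in>J. sc (c j) (b j)) \<in> B) \<and>
     (\<forall>c. (\<Sum>j\<in>J. sc (c j) (b j)) \<in> B \<longrightarrow> (\<forall>j\<in>J. c j = 0))"

definition qdim :: "('k::field \<Rightarrow> 'a::ab_group_add \<Rightarrow> 'a) \<Rightarrow> 'a set \<Rightarrow> 'a set \<Rightarrow> nat \<Rightarrow> bool" where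
  "qdim sc Z B d \<longleftrightarrow> (\<exists>J b. qbasis sc Z B J b \<and> card J = d)"

lemma lin_subspace_0: "lin_subspace sc B \<Longrightarrow> 0 \<in> B"
  and lin_subspace_diff: "lin_subspace sc B \<Longrightarrow> x \<in> B \<Longrightarrow> y \<in> B \<Longrightarrow> x - y \<in> B"
  and lin_subspace_scale: "lin_subspace sc B \<Longrightarrow> x \<in> B \<Longrightarrow> sc c x \<in> B"
  by (auto simp: lin_subspace_def)

lemma lin_subspace_add:
  assumes "lin_subspace sc B" "x \<in> B" "y \<in> B" shows "x + y \<in> B"
proof -
  have "x - (0 - y) \<in> B" using assms by (meson lin_subspace_diff lin_subspace_0)
  thus ?thesis by simp
qed

lemma lin_subspace_sum:
  assumes "lin_subspace sc B" "\<And>j. j \<in> J \<Longrightarrow> f j \<in> B" shows "sum f J \<in> B"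
  using assms(2)
  by (induction J rule: infinite_finite_induct)
     (auto intro: lin_subspace_add[OF assms(1)] simp: lin_subspace_0[OF assms(1)])

text \<open>Gaussian elimination: the equation with the nonzero coefficient eliminates one unknown.\<close>

lemma underdetermined_system:
  fixes A :: "'i \<Rightarrow> 'j \<Rightarrow> 'k::field"
  assumes "finite I" "finite J" "card I < card J"
  shows "\<exists>c. (\<exists>j\<in>J. c j \<noteq> 0) \<and> (\<forall>i\<in>I. (\<Sum>j\<in>J. A i j * c j) = 0)"
  using assms
proof (induction I arbitrary: J A rule: finite_induct)
  case empty
  then obtain j where "j \<in> J" by fastforce
  thus ?case by (intro exI[of _ "\<lambda>_. 1"]) auto
next
  case (insert i I)
  show ?case
  proof (cases "\<forall>j\<in>J. A i j = 0")
    case True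
    have "card I < card J" using insert by simp
    from insert.IH[OF insert.prems(1) this, of A] obtain c where
      "\<exists>j\<in>J. c j \<noteq> 0" "\<forall>i\<in>I. (\<Sum>j\<in>J. A i j * c j) = 0" by blast
    with True show ?thesis by (intro exI[of _ c]) auto
  next
    case False
    then obtain p where p: "p \<in> J" "A i p \<noteq> 0" by blast
    define J' where "J' = J - {p}"
    have J: "J = insert p J'" "p \<notin> J'" "finite J'" using p insert.prems by (auto simp: J'_def)
    have "card I < card J'" using insert J by simp
    from insert.IH[OF J(3) this, of "\<lambda>k j. A k j - A k p / A i p * A i j"] obtain c where
      c: "\<exists>j\<in>J'. c j \<noteq> 0"
         "\<forall>k\<in>I. (\<Sum>j\<in>J'. (A k j - A k p / A i p * A i j) * c j) = 0" by blast
    define s where "s = (\<Sum>j\<in>J'. A i j * c j)"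
    define c' where "c' = c(p := - s / A i p)"
    have sumc: "(\<Sum>j\<in>J. A k j * c' j) = A k p * (- s / A i p) + (\<Sum>j\<in>J'. A k j * c j)" for k
    proof -
      have "(\<Sum>j\<in>J'. A k j * c' j) = (\<Sum>j\<in>J'. A k j * c j)"
        using J by (intro sum.cong) (auto simp: c'_def)
      thus ?thesis using J by (simp add: c'_def)
    qed
    have 1: "(\<Sum>j\<in>J. A i j * c' j) = 0" unfolding sumc using p by (simp add: s_def)
    have 2: "(\<Sum>j\<in>J. A k j * c' j) = 0" if "k \<in> I" for k
    proof -
      have "0 = (\<Sum>j\<in>J'. (A k j - A k p / A i p * A i j) * c j)" using c(2) that by simp
      also have "\<dots> = (\<Sum>j\<in>J'. A k j * c j) - A k p / A i p * s"
        by (simp add: s_def sum_distrib_left sum_subtractf algebra_simps)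
      finally show ?thesis unfolding sumc by simp
    qed
    show ?thesis using c(1) 1 2 J by (intro exI[of _ c']) (auto simp: c'_def)
  qed
qed

text \<open>Expressing a larger family by a smaller one gives more unknowns than equations, hence a
  nontrivial combination of the larger family that lies in \<open>B\<close>.\<close>

lemma qbasis_card_le:
  fixes sc :: "'k::field \<Rightarrow> 'a::ab_group_add \<Rightarrow> 'a"
  assumes vs: "vector_space sc" and B: "lin_subspace sc B"
    and b: "qbasis sc Z B J b" and b': "qbasis sc Z B J' b'"
  shows "card J' \<le> card J"
proof (rule ccontr)
  interpret vector_space sc by (fact vs)
  assume "\<not> ?thesis"
  hence less: "card J < card J'" by simp
  have fin: "finite J" "finite J'" using b b' by (auto simp: qbasis_def)
  have "\<forall>j\<in>J'. \<exists>c. b' j - (\<Sum>i\<in>J. sc (c i) (b i)) \<in> B" using b b' by (auto simp: qbasis_def)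
  then obtain A where A: "\<And>j. j \<in> J' \<Longrightarrow> b' j - (\<Sum>i\<in>J. sc (A j i) (b i)) \<in> B" by metis
  from underdetermined_system[OF fin less, of "\<lambda>i j. A j i"] obtain c where
    c: "\<exists>j\<in>J'. c j \<noteq> 0" "\<And>i. i \<in> J \<Longrightarrow> (\<Sum>j\<in>J'. A j i * c j) = 0" by blast
  have "(\<Sum>j\<in>J'. sc (c j) (b' j - (\<Sum>i\<in>J. sc (A j i) (b i)))) \<in> B"
    using A by (intro lin_subspace_sum[OF B] lin_subspace_scale[OF B]) auto
  also have "(\<Sum>j\<in>J'. sc (c j) (b' j - (\<Sum>i\<in>J. sc (A j i) (b i)))) =
      (\<Sum>j\<in>J'. sc (c j) (b' j)) - (\<Sum>j\<in>J'. \<Sum>i\<in>J. sc (A j i * c j) (b i))"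
    by (simp add: scale_right_diff_distrib scale_sum_right sum_subtractf mult.commute)
  also have "(\<Sum>j\<in>J'. \<Sum>i\<in>J. sc (A j i * c j) (b i)) = (\<Sum>i\<in>J. sc (\<Sum>j\<in>J'. A j i * c j) (b i))"
    by (subst sum.swap) (simp add: scale_sum_left)
  also have "\<dots> = 0" using c(2) by simp
  finally have "(\<Sum>j\<in>J'. sc (c j) (b' j)) \<in> B" by simp
  with b' have "\<forall>j\<in>J'. c j = 0" by (auto simp: qbasis_def)
  with c(1) show False by blast
qed

lemma qdim_unique:
  assumes "vector_space sc" "lin_subspace sc B" "qdim sc Z B d" "qdim sc Z B d'"
  shows "d = d'"
  using assms unfolding qdim_def by (metis qbasis_card_le order_antisym)

text \<open>A linear relation that is total on both sides and identifies membership in the two subspaces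
  induces an isomorphism of the quotients; connecting homomorphisms arise in this form.\<close>

lemma qdim_transfer:
  fixes sc :: "'k::field \<Rightarrow> 'a::ab_group_add \<Rightarrow> 'a" and sc' :: "'k \<Rightarrow> 'b::ab_group_add \<Rightarrow> 'b"
  assumes dim: "qdim sc Z B d"
    and zero: "\<rho> 0 0"
    and diff: "\<And>x x' y y'. \<rho> x x' \<Longrightarrow> \<rho> y y' \<Longrightarrow> \<rho> (x - y) (x' - y')"
    and scale: "\<And>c x x'. \<rho> x x' \<Longrightarrow> \<rho> (sc c x) (sc' c x')"
    and left: "\<And>x. x \<in> Z \<Longrightarrow> \<exists>x'\<in>Z'. \<rho> x x'"
    and right: "\<And>x'. x' \<in> Z' \<Longrightarrow> \<exists>x\<in>Z. \<rho> x x'"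
    and B: "\<And>x x'. \<rho> x x' \<Longrightarrow> x \<in> B \<longleftrightarrow> x' \<in> B'"
  shows "qdim sc' Z' B' d"
proof -
  from dim obtain J b where b: "qbasis sc Z B J b" and J: "card J = d" by (auto simp: qdim_def)
  have fin: "finite J" using b by (simp add: qbasis_def)
  have "\<forall>j\<in>J. \<exists>x'\<in>Z'. \<rho> (b j) x'" using b left by (auto simp: qbasis_def)
  then obtain b' where b': "\<And>j. j \<in> J \<Longrightarrow> b' j \<in> Z'" "\<And>j. j \<in> J \<Longrightarrow> \<rho> (b j) (b' j)" by metis
  have add: "\<rho> (x + y) (x' + y')" if "\<rho> x x'" "\<rho> y y'" for x x' y y'
    using diff[OF that(1) diff[OF zero that(2)]] by simp
  have sum: "\<rho> (\<Sum>j\<in>J'. sc (c j) (b j)) (\<Sum>j\<in>J'. sc' (c j) (b' j))" if "J' \<subseteq> J" for c J'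
    using finite_subset[OF that fin] that
    by (induction J' rule: finite_induct) (auto simp: zero intro!: add scale b')
  have "qbasis sc' Z' B' J b'"
    unfolding qbasis_def
  proof (intro conjI ballI allI impI)
    fix z' assume "z' \<in> Z'"
    then obtain z where z: "z \<in> Z" "\<rho> z z'" using right by blast
    then obtain c where "z - (\<Sum>j\<in>J. sc (c j) (b j)) \<in> B" using b by (auto simp: qbasis_def)
    hence "z' - (\<Sum>j\<in>J. sc' (c j) (b' j)) \<in> B'"
      using B[OF diff[OF z(2) sum[OF order_refl, of c]]] by simp
    thus "\<exists>c. z' - (\<Sum>j\<in>J. sc' (c j) (b' j)) \<in> B'" by blast
  next
    fix c j assume "(\<Sum>j\<in>J. sc' (c j) (b' j)) \<in> B'" "j \<in> J"
    hence "(\<Sum>j\<in>J. sc (c j) (b j)) \<in> B" using B[OF sum[OF order_refl, of c]] by simp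
    thus "c j = 0" using b \<open>j \<in> J\<close> by (auto simp: qbasis_def)
  qed (use fin b' in auto)
  with J show ?thesis by (auto simp: qdim_def)
qed

lemma qdim_0: "Z \<subseteq> B \<Longrightarrow> qdim sc Z B 0"
  unfolding qdim_def qbasis_def by (intro exI[of _ "{}"]) auto

lemma sum_fun_apply: "sum f I x = (\<Sum>i\<in>I. f i x)"
  by (induction I rule: infinite_finite_induct) auto

section \<open>Signed sums over the elements of a set\<close>

locale vertex_order =
  fixes idx :: "'v::finite \<Rightarrow> nat"
  assumes inj_idx: "inj idx"
begin

text \<open>The parity of the position of \<open>v\<close> in \<open>T\<close>, listed in the order of \<open>idx\<close>.\<close>

definition psgn :: "'v \<Rightarrow> 'v set \<Rightarrow> 'r::comm_ring_1" where
  "psgn v T = (-1) ^ card {u \<in> T. idx u < idx v}"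

text \<open>For unit weights this is the simplicial coboundary. For the variables as weights it is the
  Koszul differential, the basis element \<open>e\<^sub>S\<close> being indexed by the complement \<open>T\<close> of \<open>S\<close>, so that
  removing an element from \<open>S\<close> adds it to \<open>T\<close>. In this way both uses share the computations with
  signs.\<close>

definition kdiff :: "('v \<Rightarrow> 'r::comm_ring_1) \<Rightarrow> ('v set \<Rightarrow> 'r) \<Rightarrow> 'v set \<Rightarrow> 'r" where
  "kdiff w c T = (\<Sum>v\<in>T. psgn v T * w v * c (T - {v}))"

lemma psgn_square [simp]: "psgn v T * psgn v T = (1 :: 'r::comm_ring_1)"
  by (simp add: psgn_def flip: power_mult_distrib)

lemma psgn_square_left [simp]: "psgn v T * (psgn v T * z) = (z :: 'r::comm_ring_1)"
  by (simp flip: mult.assoc)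

lemma psgn_singleton [simp]: "psgn v {v} = 1"
proof -
  have "{u \<in> {v}. idx u < idx v} = {}" by auto
  thus ?thesis unfolding psgn_def by (metis card.empty power_0)
qed

lemma psgn_nonzero [simp]: "psgn v T \<noteq> (0 :: 'r::comm_ring_1)"
  using psgn_square[of v T, where 'r='r] by (metis mult_zero_left zero_neq_one)

lemma psgn_mult_cancel: "psgn v T * x = psgn v T * y \<longleftrightarrow> x = (y :: 'r::comm_ring_1)"
  by (metis psgn_square_left)

lemma psgn_mult_eq_0 [simp]: "psgn v T * x = 0 \<longleftrightarrow> x = (0 :: 'r::comm_ring_1)"
  using psgn_mult_cancel[of v T x 0] by simp

lemma psgn_anticommute_less:
  assumes "u \<in> T" "v \<in> T" "idx u < idx v"
  shows "psgn u T * psgn v (T - {u}) = - (psgn v T * psgn u (T - {v}) :: 'r::comm_ring_1)"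
proof -
  have 1: "{w \<in> T - {v}. idx w < idx u} = {w \<in> T. idx w < idx u}" using assms by auto
  have 2: "{w \<in> T. idx w < idx v} = insert u {w \<in> T - {u}. idx w < idx v}" using assms by auto
  have "psgn u (T - {v}) = (psgn u T :: 'r)" by (simp only: psgn_def 1)
  moreover have "psgn v T = - (psgn v (T - {u}) :: 'r)" unfolding psgn_def 2 by simp
  ultimately show ?thesis by (simp add: mult.commute)
qed

lemma psgn_anticommute:
  assumes "u \<in> T" "v \<in> T" "u \<noteq> v"
  shows "psgn u T * psgn v (T - {u}) = - (psgn v T * psgn u (T - {v}) :: 'r::comm_ring_1)"
proof -
  have "idx u \<noteq> idx v" using inj_idx assms by (auto dest: injD)
  then consider "idx u < idx v" | "idx v < idx u" by linarith
  thus ?thesis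
  proof cases
    case 2
    from psgn_anticommute_less[OF assms(2,1) 2, where 'r='r] show ?thesis by simp
  qed (use psgn_anticommute_less assms in auto)
qed

text \<open>The two orders of removing \<open>u\<close> and \<open>v\<close> contribute opposite terms. These are paired explicitly,
  because antisymmetry alone does not make a sum vanish in characteristic two.\<close>

lemma kdiff_kdiff [simp]: "kdiff w (kdiff w c) T = (0 :: 'r::comm_ring_1)"
proof -
  define g where "g u v = psgn u T * w u * (psgn v (T - {u}) * w v * c (T - {u} - {v}))" for u v
  have g: "g v u = - g u v" if "u \<in> T" "v \<in> T" "u \<noteq> v" for u v
  proof -
    have "g v u = (psgn v T * psgn u (T - {v})) * (w u * w v * c (T - {u,v}))"
      by (simp add: g_def mult_ac Diff_insert[symmetric] insert_commute)
    moreover have "g u v = (psgn u T * psgn v (T - {u})) * (w u * w v * c (T - {u,v}))"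
      by (simp add: g_def mult_ac Diff_insert[symmetric] insert_commute)
    ultimately show ?thesis using psgn_anticommute[OF that, where 'r='r] by simp
  qed
  define P where "P = {(u,v) \<in> T \<times> T. idx u < idx v}"
  define Q where "Q = {(u,v) \<in> T \<times> T. idx v < idx u}"
  have "kdiff w (kdiff w c) T = (\<Sum>u\<in>T. \<Sum>v\<in>T - {u}. g u v)"
    by (simp add: kdiff_def g_def sum_distrib_left)
  also have "\<dots> = (\<Sum>(u,v)\<in>Sigma T (\<lambda>u. T - {u}). g u v)"
    by (simp add: sum.Sigma)
  also have "Sigma T (\<lambda>u. T - {u}) = P \<union> Q"
    using inj_idx by (auto simp: P_def Q_def dest: injD)
      (metis inj_eq inj_idx linorder_neqE_nat)
  also have "(\<Sum>(u,v)\<in>P \<union> Q. g u v) = (\<Sum>(u,v)\<in>P. g u v) + (\<Sum>(u,v)\<in>Q. g u v)"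
    by (intro sum.union_disjoint) (auto simp: P_def Q_def intro: finite_subset[of _ UNIV])
  also have "(\<Sum>(u,v)\<in>Q. g u v) = (\<Sum>(u,v)\<in>P. g v u)"
    by (intro sum.reindex_bij_witness[of _ prod.swap prod.swap]) (auto simp: P_def Q_def)
  also have "\<dots> = - (\<Sum>(u,v)\<in>P. g u v)"
    unfolding sum_negf[symmetric] by (intro sum.cong) (auto simp: P_def intro: g)
  finally show ?thesis by simp
qed

lemma kdiff_diff: "kdiff w (\<lambda>T. c T - d T) T = kdiff w c T - kdiff w d T"
  by (simp add: kdiff_def sum_subtractf right_diff_distrib)

lemma kdiff_add: "kdiff w (\<lambda>T. c T + d T) T = kdiff w c T + kdiff w d T"
  by (simp add: kdiff_def sum.distrib ring_distribs)

lemma kdiff_scale: "kdiff w (\<lambda>T. a * c T) T = a * kdiff w c T"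
  by (simp add: kdiff_def sum_distrib_left mult_ac)

lemma kdiff_sum: "kdiff w (\<lambda>T. \<Sum>l\<in>L. f l T) T = (\<Sum>l\<in>L. kdiff w (f l) T)"
  by (simp add: kdiff_def sum_distrib_left) (subst sum.swap, simp)

lemma kdiff_cong:
  "(\<And>v. v \<in> T \<Longrightarrow> c (T - {v}) = d (T - {v})) \<Longrightarrow> kdiff w c T = kdiff w d T"
  by (auto simp: kdiff_def intro: sum.cong)

end

section \<open>Polynomials\<close>

abbreviation coeff :: "('a \<Rightarrow>\<^sub>0 'b::zero) \<Rightarrow> 'a \<Rightarrow> 'b" where
  "coeff \<equiv> Poly_Mapping.lookup"

abbreviation keys :: "('a \<Rightarrow>\<^sub>0 'b::zero) \<Rightarrow> 'a set" where
  "keys \<equiv> Poly_Mapping.keys"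

abbreviation single :: "'a \<Rightarrow> 'b \<Rightarrow> 'a \<Rightarrow>\<^sub>0 'b::zero" where
  "single \<equiv> Poly_Mapping.single"

abbreviation var_exp :: "'v \<Rightarrow> 'v \<Rightarrow>\<^sub>0 nat" where
  "var_exp v \<equiv> single v 1"

definition part :: "('a \<Rightarrow> bool) \<Rightarrow> ('a \<Rightarrow>\<^sub>0 'b::zero) \<Rightarrow> 'a \<Rightarrow>\<^sub>0 'b" where
  "part P p = Poly_Mapping.mapp (\<lambda>a x. if P a then x else 0) p"

lemma coeff_part: "coeff (part P p) a = (if P a then coeff p a else 0)"
  by (auto simp: part_def lookup_mapp when_def in_keys_iff)

lemma keys_part: "keys (part P p) = {a \<in> keys p. P a}"
  by (auto simp: in_keys_iff coeff_part split: if_splits)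

lemma part_id: "(\<And>a. a \<in> keys p \<Longrightarrow> P a) \<Longrightarrow> part P p = p"
  by (rule poly_mapping_eqI) (auto simp: coeff_part in_keys_iff)

lemma part_sum: "part P (\<Sum>l\<in>L. f l) = (\<Sum>l\<in>L. part P (f l))"
  by (rule poly_mapping_eqI) (simp add: coeff_part lookup_sum)

lemma keys_mult_cases:
  assumes "a \<in> keys (p * q)"
  obtains b c where "b \<in> keys p" "c \<in> keys q" "a = b + c"
  using assms keys_mult[of p q] by blast

lemma keys_sum_cases:
  assumes "a \<in> keys (sum f L)"
  obtains l where "l \<in> L" "a \<in> keys (f l)"
  using assms keys_sum[of f L] by blast

text \<open>Multiplication by \<open>q\<close> sends the terms of \<open>p\<close> selected by \<open>Q\<close> to terms selected by \<open>P\<close>, and the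
  others to others. For a homogeneous \<open>q\<close> this says that multiplication commutes with taking
  homogeneous components.\<close>

lemma part_mult:
  fixes p q :: "'a::comm_monoid_add \<Rightarrow>\<^sub>0 'b::comm_ring_1"
  assumes "\<And>a b. b \<in> keys q \<Longrightarrow> P (a + b) \<longleftrightarrow> Q a"
  shows "part P (p * q) = part Q p * q"
proof (rule poly_mapping_eqI)
  fix m
  define p1 p2 where "p1 = part Q p" and "p2 = part (\<lambda>a. \<not> Q a) p"
  have p: "p = p1 + p2"
    by (rule poly_mapping_eqI) (simp add: p1_def p2_def coeff_part lookup_add)
  have 1: "P m" if "m \<in> keys (p1 * q)"
    using that by (elim keys_mult_cases) (auto simp: p1_def keys_part assms)
  have 2: "\<not> P m" if "m \<in> keys (p2 * q)"
    using that by (elim keys_mult_cases) (auto simp: p2_def keys_part assms)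
  show "coeff (part P (p * q)) m = coeff (part Q p * q) m"
    unfolding p1_def[symmetric] using 1 2
    by (auto simp: coeff_part p distrib_right lookup_add in_keys_iff)
qed

lemma poly_mapping_sum_single: "p = (\<Sum>a\<in>keys p. single a (coeff p a))"
  by (rule poly_mapping_eqI)
     (auto simp: lookup_sum lookup_single when_def sum.delta' in_keys_iff)

lemma coeff_single_mult:
  fixes p :: "'a::cancel_comm_monoid_add \<Rightarrow>\<^sub>0 'b::comm_ring_1"
  shows "coeff (single a c * p) (a + b) = c * coeff p b"
proof -
  have "single a c * p = (\<Sum>d\<in>keys p. single (a + d) (c * coeff p d))"
    by (subst (1) poly_mapping_sum_single[of p]) (simp add: sum_distrib_left mult_single)
  also have "coeff \<dots> (a + b) = (\<Sum>d\<in>keys p. if d = b then c * coeff p d else 0)"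
    by (auto simp: lookup_sum lookup_single when_def intro!: sum.cong)
  also have "\<dots> = c * coeff p b"
    by (auto simp: sum.delta' in_keys_iff)
  finally show ?thesis .
qed

lemma coeff_const_mult [simp]:
  fixes p :: "'a::cancel_comm_monoid_add \<Rightarrow>\<^sub>0 'b::comm_ring_1"
  shows "coeff (single 0 c * p) b = c * coeff p b"
  using coeff_single_mult[of 0 c p b] by simp

lemma exp_minus_add:
  fixes a :: "'v \<Rightarrow>\<^sub>0 nat"
  shows "coeff a v \<noteq> 0 \<Longrightarrow> a - var_exp v + var_exp v = a"
  by (rule poly_mapping_eqI) (auto simp: lookup_add lookup_minus lookup_single when_def)

lemma coeff_variable_mult:
  fixes p :: "('v, 'k::field) mpoly"
  shows "coeff (variable v * p) a = (if coeff a v = 0 then 0 else coeff p (a - var_exp v))"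
proof (cases "coeff a v = 0")
  case True
  have "a \<notin> keys (variable v * p)"
    using True by (auto elim!: keys_mult_cases simp: variable_def lookup_add)
  with True show ?thesis by (simp add: in_keys_iff)
next
  case False
  have "coeff (variable v * p) (var_exp v + (a - var_exp v)) = coeff p (a - var_exp v)"
    unfolding variable_def by (subst coeff_single_mult) simp
  thus ?thesis using False exp_minus_add[OF False] by (simp add: add.commute)
qed

lemma coeff_mult_0:
  fixes p q :: "('v, 'k::field) mpoly"
  assumes "coeff p 0 = 0 \<or> coeff q 0 = 0"
  shows "coeff (p * q) 0 = 0"
proof (rule ccontr)
  assume "coeff (p * q) 0 \<noteq> 0"
  then obtain b c where "b \<in> keys p" "c \<in> keys q" "0 = b + c"
    by (metis in_keys_iff keys_mult_cases)
  moreover from \<open>0 = b + c\<close> have "b = 0 \<and> c = 0"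
    by (auto simp: poly_mapping_eq_iff fun_eq_iff lookup_add)
  ultimately show False using assms by (auto simp: in_keys_iff)
qed

lemma coeff_minus_one_power_mult:
  fixes p :: "('v, 'k::field) mpoly"
  shows "coeff ((-1) ^ n * p) a = (-1) ^ n * coeff p a"
  by (induction n) auto

definition indicator_exp :: "'v::finite set \<Rightarrow> 'v \<Rightarrow>\<^sub>0 nat" where
  "indicator_exp S = (\<Sum>v\<in>S. var_exp v)"

lemma coeff_indicator_exp [simp]: "coeff (indicator_exp S) v = (if v \<in> S then 1 else 0)"
  by (simp add: indicator_exp_def lookup_sum lookup_single when_def sum.delta')

lemma indicator_exp_insert: "v \<notin> S \<Longrightarrow> indicator_exp (insert v S) = indicator_exp S + var_exp v"
  by (simp add: indicator_exp_def add.commute)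

lemma indicator_exp_Compl_insert:
  "v \<notin> T \<Longrightarrow> indicator_exp (- T) = indicator_exp (- insert v T) + var_exp v"
  by (subst indicator_exp_insert[symmetric]) (auto intro: arg_cong[of _ _ indicator_exp])

lemma indicator_exp_Compl_remove:
  "v \<in> T \<Longrightarrow> indicator_exp (- (T - {v})) = indicator_exp (- T) + var_exp v"
  using indicator_exp_Compl_insert[of v "T - {v}"] by (simp add: insert_absorb)

section \<open>The Koszul complex\<close>

context vertex_order
begin

lemma psgn_insert:
  assumes "u \<in> T" "v \<notin> T"
  shows "psgn u T * psgn v (insert v (T - {u})) =
    - (psgn v (insert v T) * psgn u (insert v T) :: 'r::comm_ring_1)"
proof -
  have eq: "insert v T - {v} = T" "insert v T - {u} = insert v (T - {u})" using assms by auto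
  have "psgn u T * psgn v (insert v (T - {u})) = psgn v (insert v T) *
      (psgn v (insert v T) * psgn u T) * (psgn v (insert v (T - {u})) :: 'r)"
    by (simp add: mult.assoc)
  also have "psgn v (insert v T) * psgn u T =
      - (psgn u (insert v T) * psgn v (insert v (T - {u})) :: 'r)"
    using psgn_anticommute[of v "insert v T" u, where 'r='r] assms unfolding eq by blast
  finally show ?thesis by (simp add: mult.assoc)
qed

lemma coeff_psgn_mult:
  fixes p :: "('v, 'k::field) mpoly"
  shows "coeff (psgn v T * p) a = psgn v T * coeff p a"
  by (simp add: psgn_def coeff_minus_one_power_mult)

lemma coeff_koszul_diff:
  fixes c :: "'v set \<Rightarrow> ('v, 'k::field) mpoly"
  shows "coeff (kdiff variable c T) a =
    (\<Sum>v\<in>T. if coeff a v = 0 then 0 else psgn v T * coeff (c (T - {v})) (a - var_exp v))"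
  unfolding kdiff_def lookup_sum
  by (intro sum.cong) (simp_all add: mult.assoc coeff_psgn_mult coeff_variable_mult)

text \<open>The Koszul complex splits into the multidegrees \<open>n = a + indicator_exp (- T)\<close>. If a variable
  \<open>v = ch n\<close> divides \<open>n\<close>, then dividing the coefficient by \<open>v\<close> and multiplying by \<open>e\<^sub>v\<close> is a contracting
  homotopy in this multidegree; in multidegree zero only the constants at \<open>T = UNIV\<close> survive. The
  choice of the variable is left open, since inside an ideal not every variable is admissible.\<close>

lemma koszul_homotopy:
  fixes c :: "'v set \<Rightarrow> ('v, 'k::field) mpoly"
  assumes ch: "\<And>n. n \<noteq> 0 \<Longrightarrow> coeff n (ch n) \<noteq> 0"
    and cycle: "\<And>T. kdiff variable c T = 0" and const: "coeff (c UNIV) 0 = 0"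
  shows "\<exists>d. (\<forall>T. kdiff variable d T = c T) \<and>
     (\<forall>T a. a \<in> keys (d T) \<longrightarrow> (let v = ch (a + indicator_exp (- T)) in
        v \<notin> T \<and> a + var_exp v \<in> keys (c (insert v T))))"
proof -
  define G where "G T a = (let v = ch (a + indicator_exp (- T)) in
    if v \<in> T then 0 else psgn v (insert v T) * coeff (c (insert v T)) (a + var_exp v))" for T a
  define d where "d T = Abs_poly_mapping (G T)" for T
  have coeff_d: "coeff (d T) = G T" for T
  proof -
    have "{a. G T a \<noteq> 0} \<subseteq> (\<Union>v. (\<lambda>b. b - var_exp v) ` keys (c (insert v T)))"
    proof
      fix a assume "a \<in> {a. G T a \<noteq> 0}"
      hence "a + var_exp (ch (a + indicator_exp (- T))) \<in>
          keys (c (insert (ch (a + indicator_exp (- T))) T))"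
        by (auto simp: G_def Let_def in_keys_iff split: if_splits)
      thus "a \<in> (\<Union>v. (\<lambda>b. b - var_exp v) ` keys (c (insert v T)))"
        by (force intro!: image_eqI[of a _ "a + _"])
    qed
    hence "finite {a. G T a \<noteq> 0}" by (rule finite_subset) auto
    thus ?thesis by (simp add: d_def)
  qed
  have "kdiff variable d T = c T" for T
  proof (rule poly_mapping_eqI)
    fix a
    define n where "n = a + indicator_exp (- T)"
    define v where "v = ch n"
    have "coeff (kdiff variable d T) a =
        (\<Sum>u\<in>T. if coeff a u = 0 then 0 else psgn u T * G (T - {u}) (a - var_exp u))"
      by (simp add: coeff_koszul_diff coeff_d cong: if_cong)
    also have "\<dots> = (\<Sum>u\<in>T. if coeff a u = 0 \<or> v \<in> T - {u} then 0 else psgn u T *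
        (psgn v (insert v (T - {u})) * coeff (c (insert v (T - {u}))) (a - var_exp u + var_exp v)))"
    proof (intro sum.cong refl)
      fix u assume "u \<in> T"
      hence "a - var_exp u + indicator_exp (- (T - {u})) = n" if "coeff a u \<noteq> 0"
        unfolding n_def indicator_exp_Compl_remove[OF \<open>u \<in> T\<close>]
        using exp_minus_add[OF that] by (metis add.assoc add.commute)
      thus "(if coeff a u = 0 then 0 else psgn u T * G (T - {u}) (a - var_exp u)) =
        (if coeff a u = 0 \<or> v \<in> T - {u} then 0 else psgn u T *
         (psgn v (insert v (T - {u})) * coeff (c (insert v (T - {u}))) (a - var_exp u + var_exp v)))"
        by (auto simp: G_def v_def Let_def)
    qed
    also have "\<dots> = coeff (c T) a"
    proof (cases "n = 0")
      case True
      have "a = 0" "- T = {}"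
      proof -
        have z: "coeff a w + (if w \<in> - T then 1 else 0) = (0::nat)" for w
          using True unfolding n_def poly_mapping_eq_iff fun_eq_iff lookup_add by simp
        show "a = 0" using z by (intro poly_mapping_eqI) (metis add_is_0 lookup_zero)
        show "- T = {}" using z by (metis add_is_0 equals0I one_neq_zero)
      qed
      hence "T = UNIV" by auto
      with \<open>a = 0\<close> show ?thesis using const by simp
    next
      case False
      hence nv: "coeff n v \<noteq> 0" by (simp add: v_def ch)
      \<comment> \<open>If \<open>v\<close> is in \<open>T\<close>, only \<open>u = v\<close> contributes. Otherwise the sum is evaluated by the cycle condition
          at \<open>insert v T\<close>.\<close>
      show ?thesis
      proof (cases "v \<in> T")
        case True
        hence av: "coeff a v \<noteq> 0" using nv by (simp add: n_def lookup_add)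
        have "(\<Sum>u\<in>T. if coeff a u = 0 \<or> v \<in> T - {u} then 0 else psgn u T *
          (psgn v (insert v (T - {u})) * coeff (c (insert v (T - {u}))) (a - var_exp u + var_exp v)))
          = (\<Sum>u\<in>T. if u = v then coeff (c T) a else 0)"
          using True av exp_minus_add[OF av] by (intro sum.cong) (auto simp: insert_absorb)
        thus ?thesis using True by simp
      next
        case False
        define T' where "T' = insert v T"
        have "0 = coeff (kdiff variable c T') (a + var_exp v)" by (simp add: cycle)
        also have "\<dots> = psgn v T' * coeff (c T) a + (\<Sum>u\<in>T. if coeff a u = 0 then 0 else
            psgn u T' * coeff (c (T' - {u})) (a + var_exp v - var_exp u))"
        proof -
          have "(\<Sum>u\<in>T. if coeff (a + var_exp v) u = 0 then 0 else
               psgn u T' * coeff (c (T' - {u})) (a + var_exp v - var_exp u)) =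
             (\<Sum>u\<in>T. if coeff a u = 0 then 0 else
               psgn u T' * coeff (c (T' - {u})) (a + var_exp v - var_exp u))"
            using False by (intro sum.cong) (auto simp: lookup_add lookup_single when_def)
          thus ?thesis unfolding coeff_koszul_diff using False
            by (simp add: T'_def lookup_add)
        qed
        finally have "psgn v T' * (psgn v T' * coeff (c T) a + (\<Sum>u\<in>T. if coeff a u = 0 then 0 else
            psgn u T' * coeff (c (T' - {u})) (a + var_exp v - var_exp u))) = 0" by simp
        hence "coeff (c T) a = (\<Sum>u\<in>T. - (psgn v T' * (if coeff a u = 0 then 0 else
            psgn u T' * coeff (c (T' - {u})) (a + var_exp v - var_exp u))))"
          by (simp add: distrib_left sum_distrib_left sum_negf eq_neg_iff_add_eq_0)
        also have "\<dots> = (\<Sum>u\<in>T. if coeff a u = 0 \<or> v \<in> T - {u} then 0 else psgn u T *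
          (psgn v (insert v (T - {u})) * coeff (c (insert v (T - {u}))) (a - var_exp u + var_exp v)))"
        proof (intro sum.cong refl)
          fix u assume u: "u \<in> T"
          hence uv: "u \<noteq> v" using False by auto
          have "insert v (T - {u}) = T' - {u}" "T' - {v} = T" using uv False by (auto simp: T'_def)
          moreover have "a + var_exp v - var_exp u = a - var_exp u + var_exp v" if "coeff a u \<noteq> 0"
            using that uv by (intro poly_mapping_eqI)
              (auto simp: lookup_add lookup_minus lookup_single when_def)
          moreover have "psgn u T * psgn v (T' - {u}) = - (psgn v T' * psgn u T' :: 'k)"
            using psgn_insert[OF u False, where 'r='k] calculation(1) by (simp add: T'_def)
          ultimately show "- (psgn v T' * (if coeff a u = 0 then 0 else
            psgn u T' * coeff (c (T' - {u})) (a + var_exp v - var_exp u))) =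
            (if coeff a u = 0 \<or> v \<in> T - {u} then 0 else psgn u T *
          (psgn v (insert v (T - {u})) * coeff (c (insert v (T - {u}))) (a - var_exp u + var_exp v)))"
            using False by (auto simp flip: mult.assoc minus_mult_left)
        qed
        finally show ?thesis by simp
      qed
    qed
    finally show "coeff (kdiff variable d T) a = coeff (c T) a" .
  qed
  moreover have "let v = ch (a + indicator_exp (- T)) in
        v \<notin> T \<and> a + var_exp v \<in> keys (c (insert v T))" if "a \<in> keys (d T)" for T a
    using that by (auto simp: in_keys_iff coeff_d G_def Let_def split: if_splits)
  ultimately show ?thesis by blast
qed

end

section \<open>Graded Betti numbers and Koszul homology\<close>

definition poly_scale :: "'k::field \<Rightarrow> ('a \<Rightarrow> nat \<Rightarrow> ('v, 'k) mpoly) \<Rightarrow> 'a \<Rightarrow> nat \<Rightarrow> ('v, 'k) mpoly" where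
  "poly_scale a c = (\<lambda>T k. single 0 a * c T k)"

lemma vector_space_poly_scale:
  "vector_space (poly_scale :: 'k::field \<Rightarrow> ('a \<Rightarrow> nat \<Rightarrow> ('v, 'k) mpoly) \<Rightarrow> _)"
proof
  fix a b :: 'k and x y :: "'a \<Rightarrow> nat \<Rightarrow> ('v, 'k) mpoly"
  show "poly_scale a (poly_scale b x) = poly_scale (a * b) x"
    by (simp add: poly_scale_def mult_single flip: mult.assoc)
  show "poly_scale 1 x = x" by (simp add: poly_scale_def)
qed (simp_all add: poly_scale_def fun_eq_iff distrib_left distrib_right single_add)

context vertex_order
begin

definition koszul :: "('v set \<Rightarrow> nat \<Rightarrow> ('v, 'k::field) mpoly) \<Rightarrow> 'v set \<Rightarrow> nat \<Rightarrow> ('v, 'k) mpoly" where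
  "koszul c T k = kdiff variable (\<lambda>T. c T k) T"

lemma koszul_0 [simp]: "koszul 0 = 0"
  and koszul_diff: "koszul (c - d) = koszul c - koszul d"
  and koszul_scale: "koszul (poly_scale a c) = poly_scale a (koszul c)"
  and koszul_koszul [simp]: "koszul (koszul c) = 0"
proof -
  show "koszul 0 = 0" by (simp add: koszul_def fun_eq_iff kdiff_def)
  show "koszul (c - d) = koszul c - koszul d"
    by (simp add: koszul_def fun_eq_iff kdiff_diff)
  show "koszul (poly_scale a c) = poly_scale a (koszul c)"
    by (simp add: koszul_def fun_eq_iff kdiff_scale poly_scale_def)
  have "(\<lambda>T. koszul c T k) = kdiff variable (\<lambda>T. c T k)" for k
    by (simp add: koszul_def fun_eq_iff)
  thus "koszul (koszul c) = 0" by (simp add: fun_eq_iff koszul_def[of "koszul c"])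
qed

end

locale grading =
  fixes \<gamma> :: "('v::finite \<Rightarrow>\<^sub>0 nat) \<Rightarrow> 'g::comm_monoid_add"
  assumes \<gamma>_0: "\<gamma> 0 = 0" and \<gamma>_add: "\<gamma> (a + b) = \<gamma> a + \<gamma> b"

text \<open>An exact complex \<open>\<dots> \<rightarrow> F\<^sub>2 \<rightarrow> F\<^sub>1 \<rightarrow> F\<^sub>0\<close> of graded free modules, \<open>M i\<close> being the matrix of
  \<open>F\<^sub>i\<^sub>+\<^sub>1 \<rightarrow> F\<^sub>i\<close>. In the application \<open>F\<^sub>0\<close> is the polynomial ring and \<open>F\<^sub>1 \<rightarrow> F\<^sub>0\<close> the augmentation of a
  minimal resolution; this is why the matrices are without constant terms from \<open>M 1\<close> on.\<close>

locale graded_exact_complex = vertex_order idx + grading \<gamma>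
  for idx :: "'v::finite \<Rightarrow> nat" and \<gamma> :: "('v \<Rightarrow>\<^sub>0 nat) \<Rightarrow> 'g::comm_monoid_add" +
  fixes n :: "nat \<Rightarrow> nat" and s :: "nat \<Rightarrow> nat \<Rightarrow> 'g"
    and M :: "nat \<Rightarrow> nat \<Rightarrow> nat \<Rightarrow> ('v, 'k::field) mpoly"
  assumes graded: "k < n i \<Longrightarrow> l < n (Suc i) \<Longrightarrow> m \<in> keys (M i k l) \<Longrightarrow> \<gamma> m + s i k = s (Suc i) l"
    and complex: "(\<Sum>l<n (Suc i). (\<Sum>j<n (Suc (Suc i)). x j * M (Suc i) l j) * M i k l) = 0"
    and exact: "(\<And>k. k < n i \<Longrightarrow> (\<Sum>l<n (Suc i). x l * M i k l) = 0) \<Longrightarrow>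
      \<exists>y. \<forall>l<n (Suc i). x l = (\<Sum>j<n (Suc (Suc i)). y j * M (Suc i) l j)"
    and minimal: "k < n (Suc i) \<Longrightarrow> l < n (Suc (Suc i)) \<Longrightarrow> coeff (M (Suc i) k l) 0 = 0"
begin

text \<open>The elements of degree \<open>g\<close> of the Koszul complex with coefficients in \<open>F\<^sub>i\<close>, in Koszul degree \<open>j\<close>.
  The basis element of the exterior algebra with complement \<open>T\<close> has multidegree
  \<open>indicator_exp (- T)\<close>.\<close>

definition chains :: "'g \<Rightarrow> nat \<Rightarrow> nat \<Rightarrow> ('v set \<Rightarrow> nat \<Rightarrow> ('v, 'k) mpoly) set" where
  "chains g i j = {c. (\<forall>T. \<forall>k\<ge>n i. c T k = 0) \<and>
     (\<forall>T k. \<forall>a\<in>keys (c T k). card (- T) = j \<and> \<gamma> (a + indicator_exp (- T)) + s i k = g)}"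

definition res_map :: "nat \<Rightarrow> ('v set \<Rightarrow> nat \<Rightarrow> ('v, 'k) mpoly) \<Rightarrow> 'v set \<Rightarrow> nat \<Rightarrow> ('v, 'k) mpoly" where
  "res_map i c T k = (if k < n i then \<Sum>l<n (Suc i). c T l * M i k l else 0)"

text \<open>Here the coefficients are in the image of \<open>F\<^sub>i\<^sub>+\<^sub>1 \<rightarrow> F\<^sub>i\<close>, a syzygy module.\<close>

definition cycles :: "'g \<Rightarrow> nat \<Rightarrow> nat \<Rightarrow> ('v set \<Rightarrow> nat \<Rightarrow> ('v, 'k) mpoly) set" where
  "cycles g i j = {z \<in> res_map i ` chains g (Suc i) j. koszul z = 0}"

definition boundaries :: "'g \<Rightarrow> nat \<Rightarrow> nat \<Rightarrow> ('v set \<Rightarrow> nat \<Rightarrow> ('v, 'k) mpoly) set" where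
  "boundaries g i j = koszul ` res_map i ` chains g (Suc i) (Suc j)"

lemma res_map_0 [simp]: "res_map i 0 = 0"
  and res_map_diff: "res_map i (c - d) = res_map i c - res_map i d"
  and res_map_scale: "res_map i (poly_scale a c) = poly_scale a (res_map i c)"
  and res_map_res_map [simp]: "res_map i (res_map (Suc i) c) = 0"
  by (simp_all add: res_map_def fun_eq_iff left_diff_distrib sum_subtractf poly_scale_def
      sum_distrib_left mult.assoc complex)

lemma koszul_res_map: "koszul (res_map i c) = res_map i (koszul c)"
proof (intro ext)
  fix T k
  have "kdiff variable (\<lambda>T. \<Sum>l<n (Suc i). c T l * M i k l) T =
      (\<Sum>l<n (Suc i). kdiff variable (\<lambda>T. c T l * M i k l) T)"
    by (rule kdiff_sum)
  also have "\<dots> = (\<Sum>l<n (Suc i). kdiff variable (\<lambda>T. c T l) T * M i k l)"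
    by (intro sum.cong refl) (simp add: kdiff_def sum_distrib_right mult.assoc)
  finally show "koszul (res_map i c) T k = res_map i (koszul c) T k"
    by (auto simp: koszul_def res_map_def kdiff_def)
qed

lemma chainsI:
  assumes "\<And>T k. n i \<le> k \<Longrightarrow> c T k = 0"
    and "\<And>T k a. a \<in> keys (c T k) \<Longrightarrow> card (- T) = j"
    and "\<And>T k a. a \<in> keys (c T k) \<Longrightarrow> \<gamma> (a + indicator_exp (- T)) + s i k = g"
  shows "c \<in> chains g i j"
  using assms by (simp add: chains_def)

lemma chains_bound: "c \<in> chains g i j \<Longrightarrow> n i \<le> k \<Longrightarrow> c T k = 0"
  and chains_card: "c \<in> chains g i j \<Longrightarrow> a \<in> keys (c T k) \<Longrightarrow> card (- T) = j"
  and chains_degree: "c \<in> chains g i j \<Longrightarrow> a \<in> keys (c T k) \<Longrightarrow>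
    \<gamma> (a + indicator_exp (- T)) + s i k = g"
  by (simp_all add: chains_def)

lemma chains_eq_0: "c \<in> chains g i j \<Longrightarrow> card (- T) \<noteq> j \<Longrightarrow> c T k = 0"
  by (rule poly_mapping_eqI) (metis chains_card in_keys_iff lookup_zero)

lemma chains_0: "0 \<in> chains g i j"
  by (simp add: chains_def)

lemma chains_diff:
  assumes "c \<in> chains g i j" "d \<in> chains g i j" shows "c - d \<in> chains g i j"
proof (rule chainsI)
  fix T k a assume "a \<in> keys ((c - d) T k)"
  hence "a \<in> keys (c T k) \<or> a \<in> keys (d T k)"
    by (auto simp: in_keys_iff lookup_minus)
  thus "card (- T) = j" "\<gamma> (a + indicator_exp (- T)) + s i k = g"
    using assms by (auto dest: chains_card chains_degree)
qed (use assms in \<open>simp add: chains_bound\<close>)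

lemma chains_scale:
  assumes "c \<in> chains g i j" shows "poly_scale x c \<in> chains g i j"
proof (rule chainsI)
  fix T k a assume "a \<in> keys (poly_scale x c T k)"
  hence "a \<in> keys (c T k)" by (auto simp: in_keys_iff poly_scale_def)
  thus "card (- T) = j" "\<gamma> (a + indicator_exp (- T)) + s i k = g"
    using assms by (auto dest: chains_card chains_degree)
qed (use assms in \<open>simp add: poly_scale_def chains_bound\<close>)

lemma koszul_chains:
  assumes c: "c \<in> chains g i (Suc j)" shows "koszul c \<in> chains g i j"
proof (rule chainsI)
  fix T k assume "n i \<le> k" thus "koszul c T k = 0"
    using c by (simp add: chains_bound koszul_def kdiff_def)
next
  fix T k a assume a: "a \<in> keys (koszul c T k)"
  have "coeff (koszul c T k) a = (\<Sum>v\<in>T. if coeff a v = 0 then 0 else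
      psgn v T * coeff (c (T - {v}) k) (a - var_exp v))"
    by (simp add: koszul_def coeff_koszul_diff)
  with a have "(\<Sum>v\<in>T. if coeff a v = 0 then 0 else
      psgn v T * coeff (c (T - {v}) k) (a - var_exp v)) \<noteq> 0"
    by (simp add: in_keys_iff)
  hence "\<exists>v\<in>T. (if coeff a v = 0 then 0 else
      psgn v T * coeff (c (T - {v}) k) (a - var_exp v)) \<noteq> 0"
    by (rule contrapos_np) (intro sum.neutral, blast)
  then obtain v where v: "v \<in> T" "coeff a v \<noteq> 0" "a - var_exp v \<in> keys (c (T - {v}) k)"
    by (auto simp: in_keys_iff split: if_splits)
  from chains_card[OF c v(3)] have 1: "card (- (T - {v})) = Suc j" .
  from chains_degree[OF c v(3)]
  have 2: "\<gamma> (a - var_exp v + indicator_exp (- (T - {v}))) + s i k = g" .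
  have "- (T - {v}) = insert v (- T)" by auto
  hence "card (- (T - {v})) = Suc (card (- T))" 
    using card_insert_disjoint[of "- T" v] v(1) by simp
  with 1 show "card (- T) = j" by simp
  have "a - var_exp v + indicator_exp (- (T - {v})) = a + indicator_exp (- T)"
    unfolding indicator_exp_Compl_remove[OF v(1)] using exp_minus_add[OF v(2)]
    by (metis add.assoc add.commute)
  with 2 show "\<gamma> (a + indicator_exp (- T)) + s i k = g" by simp
qed

lemma res_map_chains:
  assumes c: "c \<in> chains g (Suc i) j" shows "res_map i c \<in> chains g i j"
proof (rule chainsI)
  fix T k a assume a: "a \<in> keys (res_map i c T k)"
  hence k: "k < n i" by (auto simp: res_map_def split: if_splits)
  from a k have "a \<in> keys (\<Sum>l<n (Suc i). c T l * M i k l)" by (simp add: res_map_def)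
  then obtain l b m where l: "l < n (Suc i)" and b: "b \<in> keys (c T l)"
    and m: "m \<in> keys (M i k l)" and a: "a = b + m"
    by (elim keys_sum_cases keys_mult_cases) auto
  from chains_card[OF c b] show "card (- T) = j" .
  have "\<gamma> (a + indicator_exp (- T)) + s i k = \<gamma> (b + indicator_exp (- T)) + (\<gamma> m + s i k)"
    by (simp add: a \<gamma>_add add_ac)
  also have "\<gamma> m + s i k = s (Suc i) l" by (rule graded[OF k l m])
  also have "\<gamma> (b + indicator_exp (- T)) + s (Suc i) l = g" by (rule chains_degree[OF c b])
  finally show "\<gamma> (a + indicator_exp (- T)) + s i k = g" .
qed (simp add: res_map_def)

text \<open>A preimage of a homogeneous element may be replaced by its homogeneous component.\<close>

lemma res_map_lift:
  assumes c: "c \<in> chains g i j"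
    and y: "\<And>T k. k < n i \<Longrightarrow> c T k = (\<Sum>l<n (Suc i). y T l * M i k l)"
  shows "\<exists>u\<in>chains g (Suc i) j. res_map i u = c"
proof -
  define P where "P i T k a \<longleftrightarrow> card (- T) = j \<and> \<gamma> (a + indicator_exp (- T)) + s i k = g" for i T k a
  define u where "u T l = (if l < n (Suc i) then part (P (Suc i) T l) (y T l) else 0)" for T l
  have "u \<in> chains g (Suc i) j"
    by (rule chainsI) (auto simp: u_def keys_part P_def split: if_splits)
  moreover have "res_map i u T k = c T k" for T k
  proof (cases "k < n i")
    case True
    have "(\<Sum>l<n (Suc i). u T l * M i k l) = (\<Sum>l<n (Suc i). part (P i T k) (y T l * M i k l))"
    proof (intro sum.cong refl)
      fix l assume l: "l \<in> {..<n (Suc i)}"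
      have "P i T k (a + b) \<longleftrightarrow> P (Suc i) T l a" if "b \<in> keys (M i k l)" for a b
      proof -
        have "\<gamma> (a + b + indicator_exp (- T)) + s i k = \<gamma> (a + indicator_exp (- T)) + (\<gamma> b + s i k)"
          by (simp add: \<gamma>_add add_ac)
        also have "\<gamma> b + s i k = s (Suc i) l" using graded[OF True _ that] l by simp
        finally show ?thesis by (simp add: P_def)
      qed
      thus "u T l * M i k l = part (P i T k) (y T l * M i k l)"
        using l by (subst part_mult[where Q = "P (Suc i) T l"]) (auto simp: u_def)
    qed
    also have "\<dots> = part (P i T k) (c T k)" by (simp add: y[OF True] part_sum)
    also have "\<dots> = c T k" 
      using chains_card[OF c] chains_degree[OF c] by (intro part_id) (simp add: P_def)
    finally show ?thesis using True by (simp add: res_map_def)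
  next
    case False thus ?thesis using c by (simp add: res_map_def chains_bound)
  qed
  ultimately show ?thesis by (intro bexI[of _ u]) auto
qed

lemma res_map_exact:
  assumes c: "c \<in> chains g (Suc i) j" and "res_map i c = 0"
  shows "c \<in> res_map (Suc i) ` chains g (Suc (Suc i)) j"
proof -
  have "\<exists>y. \<forall>l<n (Suc i). c T l = (\<Sum>j<n (Suc (Suc i)). y j * M (Suc i) l j)" for T
  proof (rule exact)
    fix k assume "k < n i"
    moreover have "res_map i c T k = 0" using assms(2) by simp
    ultimately show "(\<Sum>l<n (Suc i). c T l * M i k l) = 0" by (simp add: res_map_def)
  qed
  then obtain y where "\<And>T l. l < n (Suc i) \<Longrightarrow> c T l = (\<Sum>j<n (Suc (Suc i)). y T j * M (Suc i) l j)"
    by metis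
  from res_map_lift[OF c this] show ?thesis by blast
qed

lemma koszul_exact:
  assumes c: "c \<in> chains g i j" and cycle: "koszul c = 0" and const: "\<And>k. coeff (c UNIV k) 0 = 0"
  shows "\<exists>u\<in>chains g i (Suc j). koszul u = c"
proof -
  have "\<exists>v. coeff m v \<noteq> 0" if "m \<noteq> 0" for m :: "'v \<Rightarrow>\<^sub>0 nat"
    using that by (metis poly_mapping_eqI lookup_zero)
  then obtain ch where ch: "\<And>m :: 'v \<Rightarrow>\<^sub>0 nat. m \<noteq> 0 \<Longrightarrow> coeff m (ch m) \<noteq> 0" by metis
  have "\<exists>d. (\<forall>T. kdiff variable d T = c T k) \<and>
     (\<forall>T a. a \<in> keys (d T) \<longrightarrow> (let v = ch (a + indicator_exp (- T)) in
        v \<notin> T \<and> a + var_exp v \<in> keys (c (insert v T) k)))" for k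
  proof (rule koszul_homotopy[OF ch])
    fix T have "koszul c T k = 0" by (simp add: cycle)
    thus "kdiff variable (\<lambda>T. c T k) T = 0" by (simp add: koszul_def)
  qed (use const in auto)
  then obtain d where d: "\<And>T k. kdiff variable (d k) T = c T k"
    "\<And>T k a. a \<in> keys (d k T) \<Longrightarrow> (let v = ch (a + indicator_exp (- T)) in
        v \<notin> T \<and> a + var_exp v \<in> keys (c (insert v T) k))" by metis
  define u where "u T k = d k T" for T k
  have key: "\<exists>v. v \<notin> T \<and> a + var_exp v \<in> keys (c (insert v T) k)" if "a \<in> keys (u T k)" for T k a
    using d(2)[of a k T] that by (auto simp: u_def Let_def)
  have "u \<in> chains g i (Suc j)"
  proof (rule chainsI)
    fix T k assume "n i \<le> k"
    hence "c T k = 0" for T using c by (simp add: chains_bound)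
    hence "a \<notin> keys (u T k)" for a using key[of a T k] by auto
    thus "u T k = 0" by (intro poly_mapping_eqI) (simp add: in_keys_iff)
  next
    fix T k a assume "a \<in> keys (u T k)"
    from key[OF this] obtain v where v: "v \<notin> T" "a + var_exp v \<in> keys (c (insert v T) k)" by blast
    note 1 = chains_card[OF c v(2)] and 2 = chains_degree[OF c v(2)]
    have "- T = insert v (- insert v T)" using v by auto
    thus "card (- T) = Suc j" using 1 by (metis card_insert_disjoint finite ComplD insertI1)
    show "\<gamma> (a + indicator_exp (- T)) + s i k = g"
      using 2 indicator_exp_Compl_insert[OF v(1)] by (simp add: add_ac)
  qed
  moreover have "koszul u = c" by (simp add: koszul_def fun_eq_iff u_def d(1))
  ultimately show ?thesis by blast
qed

lemma lin_subspace_boundaries: "lin_subspace poly_scale (boundaries g i j)"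
  unfolding lin_subspace_def
proof (intro conjI ballI allI)
  show "0 \<in> boundaries g i j"
    unfolding boundaries_def using chains_0 by (metis image_eqI koszul_0 res_map_0)
next
  fix x y assume "x \<in> boundaries g i j" "y \<in> boundaries g i j"
  then obtain c d where "c \<in> chains g (Suc i) (Suc j)" "d \<in> chains g (Suc i) (Suc j)"
    "x = koszul (res_map i c)" "y = koszul (res_map i d)" by (auto simp: boundaries_def)
  thus "x - y \<in> boundaries g i j"
    by (auto simp: boundaries_def koszul_diff res_map_diff
        intro!: image_eqI[of _ koszul "res_map i c - res_map i d"]
          image_eqI[of _ "res_map i" "c - d"] chains_diff)
next
  fix a x assume "x \<in> boundaries g i j"
  then obtain c where "c \<in> chains g (Suc i) (Suc j)" "x = koszul (res_map i c)"
    by (auto simp: boundaries_def)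
  thus "poly_scale a x \<in> boundaries g i j"
    by (auto simp: boundaries_def koszul_scale res_map_scale
        intro!: image_eqI[of _ koszul "poly_scale a (res_map i c)"]
          image_eqI[of _ "res_map i" "poly_scale a c"] chains_scale)
qed

text \<open>With \<open>M\<^sub>i\<close> for the image of \<open>F\<^sub>i\<^sub>+\<^sub>1 \<rightarrow> F\<^sub>i\<close>, this is the connecting isomorphism of
  \<open>0 \<rightarrow> M\<^sub>i\<^sub>+\<^sub>1 \<rightarrow> F\<^sub>i\<^sub>+\<^sub>1 \<rightarrow> M\<^sub>i \<rightarrow> 0\<close>: a cycle \<open>z\<close> over \<open>M\<^sub>i\<close> corresponds to the Koszul differential \<open>z'\<close> of a lift
  of \<open>z\<close> to \<open>F\<^sub>i\<^sub>+\<^sub>1\<close>. It is bijective since the Koszul homology of \<open>F\<^sub>i\<^sub>+\<^sub>1\<close> lives in Koszul degree zero,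
  and since minimality makes the classes of \<open>M\<^sub>i\<^sub>+\<^sub>1\<close> vanish there.\<close>

lemma dimension_shift:
  assumes "qdim poly_scale (cycles g (Suc i) j) (boundaries g (Suc i) j) d"
  shows "qdim poly_scale (cycles g i (Suc j)) (boundaries g i (Suc j)) d"
proof (rule qdim_transfer[where \<rho> = "\<lambda>z' z. \<exists>w\<in>chains g (Suc i) (Suc j). res_map i w = z \<and> koszul w = z'"])
  show "qdim poly_scale (cycles g (Suc i) j) (boundaries g (Suc i) j) d" by fact
  show "\<exists>w\<in>chains g (Suc i) (Suc j). res_map i w = 0 \<and> koszul w = 0"
    by (intro bexI[of _ 0] chains_0) simp
next
  fix x x' y y'
  assume "\<exists>w\<in>chains g (Suc i) (Suc j). res_map i w = x' \<and> koszul w = x"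
    "\<exists>w\<in>chains g (Suc i) (Suc j). res_map i w = y' \<and> koszul w = y"
  thus "\<exists>w\<in>chains g (Suc i) (Suc j). res_map i w = x' - y' \<and> koszul w = x - y"
    using chains_diff koszul_diff res_map_diff by metis
next
  fix c x x'
  assume "\<exists>w\<in>chains g (Suc i) (Suc j). res_map i w = x' \<and> koszul w = x"
  thus "\<exists>w\<in>chains g (Suc i) (Suc j). res_map i w = poly_scale c x' \<and> koszul w = poly_scale c x"
    using chains_scale koszul_scale res_map_scale by metis
next
  fix z' assume "z' \<in> cycles g (Suc i) j"
  then obtain y where y: "y \<in> chains g (Suc (Suc i)) j" "z' = res_map (Suc i) y"
    and cyc: "koszul z' = 0" by (auto simp: cycles_def)
  have "coeff (z' UNIV k) 0 = 0" for k
    unfolding y(2) res_map_def by (auto simp: lookup_sum intro!: sum.neutral coeff_mult_0 minimal)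
  from koszul_exact[OF _ cyc this] res_map_chains[OF y(1)] y(2)
  obtain w where w: "w \<in> chains g (Suc i) (Suc j)" "koszul w = z'" by blast
  have "koszul (res_map i w) = 0" unfolding koszul_res_map w(2) y(2) by simp
  with w show "\<exists>z\<in>cycles g i (Suc j). \<exists>w\<in>chains g (Suc i) (Suc j). res_map i w = z \<and> koszul w = z'"
    by (auto simp: cycles_def)
next
  fix z assume "z \<in> cycles g i (Suc j)"
  then obtain w where w: "w \<in> chains g (Suc i) (Suc j)" "z = res_map i w" and "koszul z = 0"
    by (auto simp: cycles_def)
  hence "res_map i (koszul w) = 0" by (simp add: koszul_res_map)
  from res_map_exact[OF koszul_chains[OF w(1)] this]
  have "koszul w \<in> cycles g (Suc i) j" by (simp add: cycles_def)
  with w show "\<exists>z'\<in>cycles g (Suc i) j. \<exists>w\<in>chains g (Suc i) (Suc j). res_map i w = z \<and> koszul w = z'"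
    by blast
next
  fix z' z assume "\<exists>w\<in>chains g (Suc i) (Suc j). res_map i w = z \<and> koszul w = z'"
  then obtain w where w: "w \<in> chains g (Suc i) (Suc j)" "res_map i w = z" "koszul w = z'" by blast
  show "z' \<in> boundaries g (Suc i) j \<longleftrightarrow> z \<in> boundaries g i (Suc j)"
  proof
    assume "z' \<in> boundaries g (Suc i) j"
    then obtain y where y: "y \<in> chains g (Suc (Suc i)) (Suc j)" "z' = koszul (res_map (Suc i) y)"
      by (auto simp: boundaries_def)
    define w' where "w' = w - res_map (Suc i) y"
    have w': "w' \<in> chains g (Suc i) (Suc j)" "koszul w' = 0" "res_map i w' = z"
      using w y by (auto simp: w'_def koszul_diff res_map_diff intro!: chains_diff res_map_chains)
    have "w' UNIV k = 0" for k using w'(1) by (rule chains_eq_0) simp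
    hence "\<exists>u\<in>chains g (Suc i) (Suc (Suc j)). koszul u = w'" by (intro koszul_exact w') simp
    then obtain u where "u \<in> chains g (Suc i) (Suc (Suc j))" "koszul u = w'" by blast
    moreover from this w'(3) have "z = koszul (res_map i u)" by (simp add: koszul_res_map)
    ultimately show "z \<in> boundaries g i (Suc j)" by (auto simp: boundaries_def)
  next
    assume "z \<in> boundaries g i (Suc j)"
    then obtain u where u: "u \<in> chains g (Suc i) (Suc (Suc j))" "z = koszul (res_map i u)"
      by (auto simp: boundaries_def)
    define w' where "w' = w - koszul u"
    have w': "w' \<in> chains g (Suc i) (Suc j)" "koszul w' = z'" "res_map i w' = 0"
      using w u by (auto simp: w'_def koszul_diff res_map_diff koszul_res_map
          intro!: chains_diff koszul_chains)
    from res_map_exact[OF w'(1,3)] w'(2) show "z' \<in> boundaries g (Suc i) j"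
      by (auto simp: boundaries_def)
  qed
qed

definition unit_chain :: "nat \<Rightarrow> 'v set \<Rightarrow> nat \<Rightarrow> ('v, 'k) mpoly" where
  "unit_chain l T k = (if T = UNIV \<and> k = l then 1 else 0)"

text \<open>In Koszul degree zero the homology is the syzygy module modulo its multiples by variables. By
  minimality the generators of degree \<open>g\<close> are a basis of its component of degree \<open>g\<close>: a relation
  among them has no constant terms.\<close>

lemma qdim_generators:
  "qdim poly_scale (cycles g i 0) (boundaries g i 0) (card {l. l < n (Suc i) \<and> s (Suc i) l = g})"
proof -
  define J where "J = {l. l < n (Suc i) \<and> s (Suc i) l = g}"
  have fin: "finite J" by (simp add: J_def)
  define comb where "comb c = (\<Sum>l\<in>J. poly_scale (c l) (unit_chain l))" for c
  have comb: "comb c T k = (if T = UNIV \<and> k \<in> J then single 0 (c k) else 0)" for c T k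
  proof -
    have "comb c T k = (\<Sum>l\<in>J. if l = k then (if T = UNIV then single 0 (c k) else 0) else 0)"
      unfolding comb_def sum_fun_apply by (intro sum.cong) (auto simp: poly_scale_def unit_chain_def)
    thus ?thesis using fin by simp
  qed
  have comb_chains: "comb c \<in> chains g (Suc i) 0" for c
    by (rule chainsI) (auto simp: comb J_def indicator_exp_def \<gamma>_0 split: if_splits)
  have res_comb: "res_map i (comb c) = (\<Sum>l\<in>J. poly_scale (c l) (res_map i (unit_chain l)))" for c
  proof -
    have plus: "res_map i (x + y) = res_map i x + res_map i y" for x y
      by (simp add: res_map_def fun_eq_iff distrib_right sum.distrib)
    have "res_map i (\<Sum>l\<in>J'. poly_scale (c l) (unit_chain l)) =
        (\<Sum>l\<in>J'. poly_scale (c l) (res_map i (unit_chain l)))" for J'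
    proof (induction J' rule: infinite_finite_induct)
      case (insert l J')
      thus ?case by (simp only: sum.insert plus res_map_scale not_False_eq_True)
    qed (simp_all only: sum.infinite sum.empty res_map_0 not_False_eq_True)
    thus ?thesis by (simp add: comb_def)
  qed
  have koszul_top: "koszul c = 0" if c: "c \<in> chains g i' 0" for c i'
  proof (intro ext)
    fix T k
    have "c (T - {v}) k = 0" if v: "v \<in> T" for v
    proof -
      have "card (- (T - {v})) \<noteq> 0" using v by auto
      with c show ?thesis by (rule chains_eq_0)
    qed
    thus "koszul c T k = 0 T k" by (simp add: koszul_def kdiff_def)
  qed
  have "qbasis poly_scale (cycles g i 0) (boundaries g i 0) J (\<lambda>l. res_map i (unit_chain l))"
    unfolding qbasis_def
  proof (intro conjI ballI allI impI)
    fix l assume l: "l \<in> J"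
    have "comb (\<lambda>k. if k = l then 1 else 0) = unit_chain l"
      using l by (auto simp: fun_eq_iff comb unit_chain_def)
    with comb_chains have "unit_chain l \<in> chains g (Suc i) 0" by metis
    thus "res_map i (unit_chain l) \<in> cycles g i 0"
      by (auto simp: cycles_def koszul_res_map koszul_top)
  next
    fix z assume "z \<in> cycles g i 0"
    then obtain x where x: "x \<in> chains g (Suc i) 0" "z = res_map i x" by (auto simp: cycles_def)
    \<comment> \<open>The constant terms of an element of degree \<open>g\<close> occur at generators of degree \<open>g\<close> only.\<close>
    define c where "c l = coeff (x UNIV l) 0" for l
    define y where "y = x - comb c"
    have y: "y \<in> chains g (Suc i) 0" unfolding y_def by (intro chains_diff x comb_chains)
    have "coeff (y UNIV k) 0 = 0" for k
    proof (cases "k \<in> J")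
      case False
      have "0 \<notin> keys (x UNIV k)"
      proof
        assume 0: "0 \<in> keys (x UNIV k)"
        hence "k < n (Suc i)" using chains_bound[OF x(1), of k UNIV] by (cases "k < n (Suc i)") auto
        moreover have "s (Suc i) k = g"
          using chains_degree[OF x(1) 0] by (simp add: indicator_exp_def \<gamma>_0)
        ultimately show False using False by (simp add: J_def)
      qed
      thus ?thesis using False by (simp add: y_def comb in_keys_iff)
    qed (simp add: y_def comb c_def lookup_minus)
    from koszul_exact[OF y koszul_top[OF y] this] obtain u
      where "u \<in> chains g (Suc i) (Suc 0)" "koszul u = y" by blast
    hence "res_map i y = koszul (res_map i u)" "u \<in> chains g (Suc i) (Suc 0)"
      by (simp_all add: koszul_res_map)
    hence "res_map i y \<in> boundaries g i 0" by (auto simp: boundaries_def)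
    thus "\<exists>c. z - (\<Sum>j\<in>J. poly_scale (c j) (res_map i (unit_chain j))) \<in> boundaries g i 0"
      by (intro exI[of _ c]) (simp add: x y_def res_map_diff res_comb)
  next
    fix c l assume l: "l \<in> J"
      and "(\<Sum>j\<in>J. poly_scale (c j) (res_map i (unit_chain j))) \<in> boundaries g i 0"
    hence "res_map i (comb c) \<in> boundaries g i 0" by (simp add: res_comb)
    then obtain u where u: "u \<in> chains g (Suc i) (Suc 0)" "res_map i (comb c) = res_map i (koszul u)"
      by (auto simp: boundaries_def koszul_res_map)
    have "comb c - koszul u \<in> res_map (Suc i) ` chains g (Suc (Suc i)) 0"
      by (intro res_map_exact) (simp_all add: res_map_diff u(2) chains_diff koszul_chains[OF u(1)] comb_chains)
    then obtain w where "comb c - koszul u = res_map (Suc i) w" by blast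
    hence "coeff (comb c UNIV l - koszul u UNIV l) 0 = coeff (res_map (Suc i) w UNIV l) 0"
      by (metis fun_diff_def)
    moreover have "coeff (res_map (Suc i) w UNIV l) 0 = 0"
      unfolding res_map_def by (auto simp: lookup_sum intro!: sum.neutral coeff_mult_0 minimal)
    moreover have "coeff (koszul u UNIV l) 0 = 0" by (simp add: koszul_def coeff_koszul_diff)
    ultimately show "c l = 0" using l by (simp add: comb lookup_minus)
  qed (use fin in auto)
  thus ?thesis unfolding qdim_def J_def by blast
qed

theorem betti_koszul:
  "qdim poly_scale (cycles g 0 i) (boundaries g 0 i) (card {l. l < n (Suc i) \<and> s (Suc i) l = g})"
proof -
  have "qdim poly_scale (cycles g k j) (boundaries g k j)
      (card {l. l < n (Suc (k + j)) \<and> s (Suc (k + j)) l = g})" for k j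
  proof (induction j arbitrary: k)
    case 0 show ?case using qdim_generators[of g k] by simp
  next
    case (Suc j)
    from Suc[of "Suc k"] show ?case by (intro dimension_shift) simp
  qed
  from this[of 0 i] show ?thesis by simp
qed

end

section \<open>Existence of minimal multigraded resolutions\<close>

definition homogeneous ::
  "nat \<Rightarrow> (nat \<Rightarrow> 'v \<Rightarrow>\<^sub>0 nat) \<Rightarrow> ('v \<Rightarrow>\<^sub>0 nat) \<Rightarrow> (nat \<Rightarrow> ('v, 'k::field) mpoly) \<Rightarrow> bool" where
  "homogeneous N a m x \<longleftrightarrow> (\<forall>k\<ge>N. x k = 0) \<and> (\<forall>k. \<forall>b\<in>keys (x k). b + a k = m)"

definition squarefree_exp :: "('v \<Rightarrow>\<^sub>0 nat) \<Rightarrow> bool" where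
  "squarefree_exp m \<longleftrightarrow> (\<forall>v. coeff m v \<le> 1)"

text \<open>Submodules of a free module that contain the multigraded components of their elements, and in
  which an element of degree \<open>m\<close> is divisible by every variable with exponent at least 2 in \<open>m\<close>, the
  quotient being again in the module.
  Such a module is generated by its elements of squarefree degree. There are finitely many of these
  degrees, which gives finite generation by linear algebra.\<close>

definition squarefree_module ::
  "nat \<Rightarrow> (nat \<Rightarrow> 'v \<Rightarrow>\<^sub>0 nat) \<Rightarrow> (nat \<Rightarrow> ('v, 'k::field) mpoly) set \<Rightarrow> bool" where
  "squarefree_module N a M \<longleftrightarrow>
     0 \<in> M \<and> (\<forall>x\<in>M. \<forall>k\<ge>N. x k = 0) \<and> (\<forall>x\<in>M. \<forall>y\<in>M. x + y \<in> M) \<and>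
     (\<forall>x\<in>M. \<forall>p. (\<lambda>k. p * x k) \<in> M) \<and>
     (\<forall>x\<in>M. \<forall>m. (\<lambda>k. part (\<lambda>b. b + a k = m) (x k)) \<in> M) \<and>
     (\<forall>x\<in>M. \<forall>m v. homogeneous N a m x \<and> 2 \<le> coeff m v \<longrightarrow>
        (\<exists>y\<in>M. homogeneous N a (m - var_exp v) y \<and> x = (\<lambda>k. variable v * y k)))"

definition generated :: "((nat \<Rightarrow> ('v, 'k::field) mpoly) \<times> ('v \<Rightarrow>\<^sub>0 nat)) set \<Rightarrow> (nat \<Rightarrow> ('v, 'k) mpoly) set" where
  "generated G = {x. \<exists>p. \<forall>k. x k = (\<Sum>g\<in>G. p g * fst g k)}"

definition generating_system where
  "generating_system N a M G \<longleftrightarrow> finite G \<and>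
     (\<forall>(g, d)\<in>G. g \<in> M \<and> homogeneous N a d g \<and> squarefree_exp d) \<and> M \<subseteq> generated G"

lemma generated_0: "0 \<in> generated G"
  by (auto simp: generated_def intro!: exI[of _ "\<lambda>_. 0"])

lemma generated_add:
  assumes "x \<in> generated G" "y \<in> generated G" shows "x + y \<in> generated G"
proof -
  from assms obtain p q where "\<And>k. x k = (\<Sum>g\<in>G. p g * fst g k)" "\<And>k. y k = (\<Sum>g\<in>G. q g * fst g k)"
    by (auto simp: generated_def)
  thus ?thesis unfolding generated_def
    by (intro CollectI exI[of _ "\<lambda>g. p g + q g"]) (simp add: distrib_right sum.distrib)
qed

lemma generated_mult:
  assumes "x \<in> generated G" shows "(\<lambda>k. p * x k) \<in> generated G"
proof -
  from assms obtain q where "\<And>k. x k = (\<Sum>g\<in>G. q g * fst g k)" by (auto simp: generated_def)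
  thus ?thesis unfolding generated_def
    by (intro CollectI exI[of _ "\<lambda>g. p * q g"]) (simp add: sum_distrib_left mult.assoc)
qed

lemma generated_sum: "(\<And>i. i \<in> I \<Longrightarrow> f i \<in> generated G) \<Longrightarrow> sum f I \<in> generated G"
  by (induction I rule: infinite_finite_induct) (auto intro: generated_0 generated_add)

lemma generated_base:
  assumes "finite G" "g \<in> G" shows "fst g \<in> generated G"
  unfolding generated_def
proof (intro CollectI exI[of _ "\<lambda>h. if h = g then 1 else 0"] allI)
  fix k
  have "(\<Sum>h\<in>G. (if h = g then 1 else 0) * fst h k) = (\<Sum>h\<in>G. if h = g then fst h k else 0)"
    by (intro sum.cong) auto
  thus "fst g k = (\<Sum>h\<in>G. (if h = g then 1 else 0) * fst h k)" using assms by simp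
qed

lemma generated_mono:
  assumes "\<And>g. g \<in> G \<Longrightarrow> fst g \<in> generated H"
  shows "generated G \<subseteq> generated H"
proof
  fix x assume "x \<in> generated G"
  then obtain p where p: "\<And>k. x k = (\<Sum>g\<in>G. p g * fst g k)" by (auto simp: generated_def)
  have "x = (\<Sum>g\<in>G. (\<lambda>k. p g * fst g k))"
  proof
    fix k
    show "x k = (\<Sum>g\<in>G. (\<lambda>k. p g * fst g k)) k" by (simp add: p sum_fun_apply)
  qed
  thus "x \<in> generated H" using assms by (simp add: generated_sum generated_mult)
qed

definition module_scale :: "'k::field \<Rightarrow> (nat \<Rightarrow> ('v, 'k) mpoly) \<Rightarrow> nat \<Rightarrow> ('v, 'k) mpoly" where
  "module_scale a x = (\<lambda>k. single 0 a * x k)"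

lemma vector_space_module_scale:
  "vector_space (module_scale :: 'k::field \<Rightarrow> (nat \<Rightarrow> ('v, 'k) mpoly) \<Rightarrow> _)"
proof
  fix a b :: 'k and x y :: "nat \<Rightarrow> ('v, 'k) mpoly"
  show "module_scale a (module_scale b x) = module_scale (a * b) x"
    by (simp add: module_scale_def mult_single flip: mult.assoc)
  show "module_scale 1 x = x" by (simp add: module_scale_def)
qed (simp_all add: module_scale_def fun_eq_iff distrib_left distrib_right single_add)

text \<open>An element of degree \<open>m\<close> is determined by one scalar in each of its \<open>N\<close> coordinates.\<close>

lemma homogeneous_finite_span:
  fixes S :: "(nat \<Rightarrow> ('v, 'k::field) mpoly) set"
  assumes S: "\<And>x. x \<in> S \<Longrightarrow> homogeneous N a m x"
  shows "\<exists>B. finite B \<and> B \<subseteq> S \<and> S \<subseteq> generated ((\<lambda>g. (g, m)) ` B)"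
proof -
  interpret vector_space "module_scale :: 'k \<Rightarrow> (nat \<Rightarrow> ('v, 'k) mpoly) \<Rightarrow> _"
    by (rule vector_space_module_scale)
  define e :: "nat \<Rightarrow> nat \<Rightarrow> ('v, 'k) mpoly"
    where "e k j = (if j = k then single (m - a k) 1 else 0)" for k j
  have S_span: "S \<subseteq> span (e ` {..<N})"
  proof
    fix x assume "x \<in> S"
    hence x: "\<And>k. k \<ge> N \<Longrightarrow> x k = 0" "\<And>k b. b \<in> keys (x k) \<Longrightarrow> b = m - a k"
      using S unfolding homogeneous_def by (blast, metis add_diff_cancel_right')
    have "x = (\<Sum>k<N. module_scale (coeff (x k) (m - a k)) (e k))"
    proof
      fix j
      have "x j = single (m - a j) (coeff (x j) (m - a j))"
        by (rule poly_mapping_eqI) (metis in_keys_iff lookup_single_eq lookup_single_not_eq x(2))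
      moreover have "(\<Sum>k<N. module_scale (coeff (x k) (m - a k)) (e k) j) =
          (\<Sum>k<N. if k = j then single (m - a j) (coeff (x j) (m - a j)) else 0)"
        by (intro sum.cong) (auto simp: module_scale_def e_def mult_single)
      ultimately show "x j = (\<Sum>k<N. module_scale (coeff (x k) (m - a k)) (e k)) j"
        using x(1)[of j] by (auto simp: sum_fun_apply)
    qed
    also have "\<dots> \<in> span (e ` {..<N})" by (intro span_sum span_scale span_base) auto
    finally show "x \<in> span (e ` {..<N})" .
  qed
  obtain B where B: "B \<subseteq> S" "independent B" "S \<subseteq> span B"
    using maximal_independent_subset[of S] by blast
  have fin: "finite B"
    using independent_span_bound[of "e ` {..<N}" B] B S_span by auto
  have "S \<subseteq> generated ((\<lambda>g. (g, m)) ` B)"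
  proof
    fix x assume "x \<in> S"
    hence "x \<in> span B" using B by blast
    then obtain u where u: "x = (\<Sum>g\<in>B. module_scale (u g) g)" using span_finite[OF fin] by auto
    also have "\<dots> \<in> generated ((\<lambda>g. (g, m)) ` B)"
      unfolding module_scale_def
    proof (intro generated_sum generated_mult)
      fix g assume "g \<in> B"
      thus "g \<in> generated ((\<lambda>g. (g, m)) ` B)"
        using generated_base[of "(\<lambda>g. (g, m)) ` B" "(g, m)"] fin by auto
    qed
    finally show "x \<in> generated ((\<lambda>g. (g, m)) ` B)" .
  qed
  with B fin show ?thesis by blast
qed

lemma squarefree_exp_indicator:
  assumes "squarefree_exp m" shows "m = indicator_exp {v. coeff m v \<noteq> 0}"
proof (rule poly_mapping_eqI)
  fix v
  have "coeff m v \<le> 1" using assms by (simp add: squarefree_exp_def)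
  thus "coeff m v = coeff (indicator_exp {v. coeff m v \<noteq> 0}) v" by auto
qed

lemma squarefree_exp_indicator_exp [simp]: "squarefree_exp (indicator_exp W)"
  by (simp add: squarefree_exp_def)

lemma squarefree_module_divide:
  "squarefree_module N a M \<Longrightarrow> x \<in> M \<Longrightarrow> homogeneous N a m x \<Longrightarrow> 2 \<le> coeff m v \<Longrightarrow>
    \<exists>y\<in>M. homogeneous N a (m - var_exp v) y \<and> x = (\<lambda>k. variable v * y k)"
  by (simp add: squarefree_module_def)

lemma generating_system_exists:
  fixes M :: "(nat \<Rightarrow> ('v::finite, 'k::field) mpoly) set"
  assumes M: "squarefree_module N a M"
  shows "\<exists>G. generating_system N a M G"
proof -
  define S where "S W = {x \<in> M. homogeneous N a (indicator_exp W) x}" for W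
  have "\<exists>B. finite B \<and> B \<subseteq> S W \<and> S W \<subseteq> generated ((\<lambda>g. (g, indicator_exp W)) ` B)" for W
    by (rule homogeneous_finite_span) (auto simp: S_def)
  then obtain B where B: "\<And>W. finite (B W)" "\<And>W. B W \<subseteq> S W"
    "\<And>W. S W \<subseteq> generated ((\<lambda>g. (g, indicator_exp W)) ` B W)" by metis
  define G where "G = (\<Union>W. (\<lambda>g. (g, indicator_exp W)) ` B W)"
  have fin: "finite G" using B(1) by (simp add: G_def)
  have SG: "S W \<subseteq> generated G" for W
  proof -
    have "generated ((\<lambda>g. (g, indicator_exp W)) ` B W) \<subseteq> generated G"
      by (intro generated_mono generated_base fin) (auto simp: G_def)
    thus ?thesis using B(3) by blast
  qed
  have hom: "x \<in> generated G" if "x \<in> M" "homogeneous N a m x" for x m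
    using that
  proof (induction "total_degree m" arbitrary: m x rule: less_induct)
    case less
    show ?case
    proof (cases "squarefree_exp m")
      case True
      from squarefree_exp_indicator[OF this] obtain W where "m = indicator_exp W" by blast
      with less.prems have "x \<in> S W" by (simp add: S_def)
      thus ?thesis using SG by blast
    next
      case False
      hence "\<exists>v. \<not> coeff m v \<le> 1" by (simp add: squarefree_exp_def)
      then obtain v where "\<not> coeff m v \<le> 1" ..
      hence v: "2 \<le> coeff m v" by simp
      then obtain y where y: "y \<in> M" "homogeneous N a (m - var_exp v) y" "x = (\<lambda>k. variable v * y k)"
        using squarefree_module_divide[OF M less.prems v] by blast
      have "total_degree m = total_degree (m - var_exp v + var_exp v)"
        using v by (subst exp_minus_add) auto
      also have "\<dots> = total_degree (m - var_exp v) + total_degree (var_exp v)"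
        by (simp add: total_degree_def lookup_add sum.distrib)
      also have "total_degree (var_exp v) = 1"
        by (simp add: total_degree_def lookup_single when_def)
      finally have "total_degree (m - var_exp v) < total_degree m" by simp
      from less.hyps[OF this y(1,2)] show ?thesis unfolding y(3) by (rule generated_mult)
    qed
  qed
  have "x \<in> generated G" if x: "x \<in> M" for x
  proof -
    define D where "D = (\<Union>k<N. (\<lambda>b. b + a k) ` keys (x k))"
    have "x = (\<Sum>m\<in>D. (\<lambda>k. part (\<lambda>b. b + a k = m) (x k)))"
    proof (intro ext poly_mapping_eqI)
      fix k b
      have xk: "k \<ge> N \<Longrightarrow> x k = 0" using M x by (auto simp: squarefree_module_def)
      have "finite D" by (simp add: D_def)
      hence "(\<Sum>m\<in>D. if b + a k = m then coeff (x k) b else 0) =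
          (if b + a k \<in> D then coeff (x k) b else 0)" by simp
      also have "\<dots> = coeff (x k) b"
      proof -
        have "b + a k \<in> D" if "coeff (x k) b \<noteq> 0"
        proof -
          have "k < N" using xk that by (cases "k < N") auto
          with that show ?thesis unfolding D_def by (intro UN_I[of k] imageI) (auto simp: in_keys_iff)
        qed
        thus ?thesis by auto
      qed
      finally show "coeff (x k) b = coeff ((\<Sum>m\<in>D. (\<lambda>k. part (\<lambda>b. b + a k = m) (x k))) k) b"
        by (simp add: sum_fun_apply lookup_sum coeff_part)
    qed
    also have "\<dots> \<in> generated G"
    proof (intro generated_sum hom)
      fix m
      show "(\<lambda>k. part (\<lambda>b. b + a k = m) (x k)) \<in> M" using M x by (simp add: squarefree_module_def)
      show "homogeneous N a m (\<lambda>k. part (\<lambda>b. b + a k = m) (x k))"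
        unfolding homogeneous_def
      proof (intro conjI allI impI ballI)
        fix k assume "N \<le> k"
        hence "x k = 0" using M x by (simp add: squarefree_module_def)
        thus "part (\<lambda>b. b + a k = m) (x k) = 0" by (intro poly_mapping_eqI) (simp add: coeff_part)
      qed (simp add: keys_part)
    qed
    finally show ?thesis .
  qed
  hence "generating_system N a M G"
    unfolding generating_system_def using fin B(2) by (auto simp: G_def S_def)
  thus ?thesis ..
qed

lemma part_comb:
  assumes "finite G" "\<And>g. g \<in> G \<Longrightarrow> homogeneous N a (snd g) (fst g)"
  shows "part (\<lambda>b. b + a k = m) (\<Sum>g\<in>G. p g * fst g k) =
    (\<Sum>g\<in>G. part (\<lambda>b. b + snd g = m) (p g) * (fst g k :: ('v, 'k::field) mpoly))"
  unfolding part_sum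
proof (intro sum.cong refl part_mult)
  fix g b c assume "g \<in> G" "b \<in> keys (fst g k)"
  hence "b + a k = snd g" using assms by (auto simp: homogeneous_def)
  thus "c + b + a k = m \<longleftrightarrow> c + snd g = m" by (metis add.assoc)
qed

text \<open>In a generating system of least cardinality no relation has a coefficient with a constant
  term, since such a relation would express one generator by the others.\<close>

lemma minimal_generating_system:
  fixes M :: "(nat \<Rightarrow> ('v::finite, 'k::field) mpoly) set"
  assumes M: "squarefree_module N a M"
  shows "\<exists>G. generating_system N a M G \<and>
    (\<forall>p. (\<forall>k. (\<Sum>g\<in>G. p g * fst g k) = 0) \<longrightarrow> (\<forall>g\<in>G. coeff (p g) 0 = 0))"
proof -
  from generating_system_exists[OF M] obtain G where G: "generating_system N a M G"
    and least: "\<And>H. generating_system N a M H \<Longrightarrow> card G \<le> card H"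
    using ex_has_least_nat[of "generating_system N a M" _ card] by blast
  have fin: "finite G" using G by (simp add: generating_system_def)
  have hom: "homogeneous N a (snd g) (fst g)" if "g \<in> G" for g
    using G that by (auto simp: generating_system_def)
  have "coeff (p g0) 0 = 0" if rel: "\<And>k. (\<Sum>g\<in>G. p g * fst g k) = 0" and g0: "g0 \<in> G" for p g0
  proof (rule ccontr)
    define c where "c = coeff (p g0) 0"
    assume "coeff (p g0) 0 \<noteq> 0"
    hence c: "c \<noteq> 0" by (simp add: c_def)
    \<comment> \<open>The component of the relation in the degree of \<open>g0\<close>: there the coefficient of \<open>g0\<close> is a scalar.\<close>
    define q where "q g = part (\<lambda>b. b + snd g = snd g0) (p g)" for g
    have q0: "q g0 = single 0 c"
      by (rule poly_mapping_eqI) (auto simp: q_def coeff_part c_def lookup_single when_def)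
    have "single 0 c * fst g0 k + (\<Sum>g\<in>G - {g0}. q g * fst g k) = 0" for k
    proof -
      have "0 = part (\<lambda>b. b + a k = snd g0) (\<Sum>g\<in>G. p g * fst g k)"
        by (rule poly_mapping_eqI) (simp add: rel coeff_part)
      also have "\<dots> = (\<Sum>g\<in>G. q g * fst g k)" unfolding q_def by (rule part_comb[OF fin hom])
      also have "\<dots> = q g0 * fst g0 k + (\<Sum>g\<in>G - {g0}. q g * fst g k)"
        by (rule sum.remove[OF fin g0])
      finally show ?thesis by (simp add: q0)
    qed
    hence eq: "single 0 c * fst g0 k = - (\<Sum>g\<in>G - {g0}. q g * fst g k)" for k
      by (simp add: eq_neg_iff_add_eq_0)
    have g0_eq: "fst g0 k = (\<Sum>g\<in>G - {g0}. (- single 0 (inverse c) * q g) * fst g k)" for k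
    proof -
      have "fst g0 k = single 0 (inverse c) * (single 0 c * fst g0 k)"
        using c by (simp add: mult_single flip: mult.assoc)
      also have "\<dots> = (\<Sum>g\<in>G - {g0}. (- single 0 (inverse c) * q g) * fst g k)"
        unfolding eq by (simp add: sum_distrib_left sum_negf mult.assoc)
      finally show ?thesis .
    qed
    have "fst g0 \<in> generated (G - {g0})" unfolding generated_def
      by (intro CollectI exI[of _ "\<lambda>g. - single 0 (inverse c) * q g"] allI g0_eq)
    hence "generated G \<subseteq> generated (G - {g0})"
      using generated_base[of "G - {g0}"] fin by (intro generated_mono) (metis DiffI finite_Diff singletonD)
    hence "generating_system N a M (G - {g0})"
      using G unfolding generating_system_def by blast
    from least[OF this] have "card G \<le> card (G - {g0})" .
    thus False using card_Diff1_less[OF fin g0] by linarith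
  qed
  with G show ?thesis by blast
qed

text \<open>The number, the degrees and the list of the generators.\<close>

type_synonym ('v, 'k) generators = "nat \<times> (nat \<Rightarrow> 'v \<Rightarrow>\<^sub>0 nat) \<times> (nat \<Rightarrow> nat \<Rightarrow> ('v, 'k) mpoly)"

definition minimal_generators ::
  "nat \<Rightarrow> (nat \<Rightarrow> 'v \<Rightarrow>\<^sub>0 nat) \<Rightarrow> (nat \<Rightarrow> ('v, 'k::field) mpoly) set \<Rightarrow> ('v, 'k) generators \<Rightarrow> bool" where
  "minimal_generators N a M = (\<lambda>(n, d, g).
     (\<forall>l<n. g l \<in> M \<and> homogeneous N a (d l) (g l) \<and> squarefree_exp (d l)) \<and>
     (\<forall>x\<in>M. \<exists>p. \<forall>k. x k = (\<Sum>l<n. p l * g l k)) \<and>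
     (\<forall>p. (\<forall>k. (\<Sum>l<n. p l * g l k) = 0) \<longrightarrow> (\<forall>l<n. coeff (p l) 0 = 0)))"

definition relations :: "('v, 'k::field) generators \<Rightarrow> (nat \<Rightarrow> ('v, 'k) mpoly) set" where
  "relations = (\<lambda>(n, d, g). {x. (\<forall>l\<ge>n. x l = 0) \<and> (\<forall>k. (\<Sum>l<n. x l * g l k) = 0)})"

lemma minimal_generators_exist:
  fixes M :: "(nat \<Rightarrow> ('v::finite, 'k::field) mpoly) set"
  assumes M: "squarefree_module N a M"
  shows "\<exists>\<sigma>. minimal_generators N a M \<sigma>"
proof -
  from minimal_generating_system[OF M] obtain G where G: "generating_system N a M G"
    and min: "\<And>p. (\<And>k. (\<Sum>g\<in>G. p g * fst g k) = 0) \<Longrightarrow> \<forall>g\<in>G. coeff (p g) 0 = 0" by blast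
  obtain h where h: "bij_betw h {..<card G} G"
    using G ex_bij_betw_nat_finite[of G] by (auto simp: generating_system_def atLeast0LessThan)
  have sum_h: "(\<Sum>l<card G. p l * fst (h l) k) =
      (\<Sum>g\<in>G. p (the_inv_into {..<card G} h g) * fst g k)" for p k
    using sum.reindex_bij_betw[OF h, of "\<lambda>g. p (the_inv_into {..<card G} h g) * fst g k"]
      the_inv_into_f_f[OF bij_betw_imp_inj_on[OF h]]
    by (metis (mono_tags, lifting) sum.cong)
  have "minimal_generators N a M (card G, \<lambda>l. snd (h l), \<lambda>l. fst (h l))"
    unfolding minimal_generators_def split
  proof (intro conjI allI impI ballI)
    fix l assume "l < card G"
    hence "h l \<in> G" using h by (auto dest: bij_betwE)
    thus "fst (h l) \<in> M" "homogeneous N a (snd (h l)) (fst (h l))" "squarefree_exp (snd (h l))"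
      using G by (auto simp: generating_system_def)
  next
    fix x assume "x \<in> M"
    then obtain p where p: "\<And>k. x k = (\<Sum>g\<in>G. p g * fst g k)"
      using G by (auto simp: generating_system_def generated_def)
    have "x k = (\<Sum>l<card G. p (h l) * fst (h l) k)" for k
      unfolding p using sum.reindex_bij_betw[OF h, of "\<lambda>g. p g * fst g k"] by simp
    thus "\<exists>p. \<forall>k. x k = (\<Sum>l<card G. p l * fst (h l) k)"
      by (intro exI[of _ "\<lambda>l. p (h l)"]) simp
  next
    fix p l assume "\<forall>k. (\<Sum>l<card G. p l * fst (h l) k) = 0" and l: "l < card G"
    hence "\<forall>g\<in>G. coeff (p (the_inv_into {..<card G} h g)) 0 = 0"
      by (intro min) (simp add: sum_h)
    moreover have "h l \<in> G" using h l by (auto dest: bij_betwE)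
    ultimately show "coeff (p l) 0 = 0"
      using the_inv_into_f_f[OF bij_betw_imp_inj_on[OF h]] l by force
  qed
  thus ?thesis ..
qed

lemma divide_by_variable:
  fixes p :: "('v, 'k::field) mpoly"
  assumes "\<And>b. b \<in> keys p \<Longrightarrow> coeff b v \<noteq> 0"
  shows "\<exists>q. p = variable v * q \<and> (\<forall>b. b \<in> keys q \<longleftrightarrow> b + var_exp v \<in> keys p)"
proof -
  define q where "q = Poly_Mapping.map_key (\<lambda>b. b + var_exp v) p"
  have "inj (\<lambda>b :: 'v \<Rightarrow>\<^sub>0 nat. b + var_exp v)" by (rule injI) simp
  hence q: "coeff q b = coeff p (b + var_exp v)" for b
    by (simp add: q_def map_key.rep_eq)
  have "p = variable v * q"
  proof (rule poly_mapping_eqI)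
    fix b
    show "coeff p b = coeff (variable v * q) b"
    proof (cases "coeff b v = 0")
      case True
      hence "coeff p b = 0" using assms by (metis in_keys_iff)
      with True show ?thesis by (simp add: coeff_variable_mult)
    next
      case False
      with exp_minus_add[OF this] show ?thesis by (simp add: coeff_variable_mult q)
    qed
  qed
  thus ?thesis using q by (auto simp: in_keys_iff)
qed

lemma variable_mult_eq_0:
  fixes p :: "('v, 'k::field) mpoly"
  assumes "variable v * p = 0" shows "p = 0"
proof (rule poly_mapping_eqI)
  fix b
  have "coeff (variable v * p) (b + var_exp v) = coeff p b"
    by (simp add: coeff_variable_mult lookup_add)
  thus "coeff p b = coeff 0 b" using assms by simp
qed

text \<open>If \<open>v\<close> has exponent at least 2 in the degree of a relation, then \<open>v\<close> divides all coefficients,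
  because it has exponent at most 1 in the degree of each generator.\<close>

lemma squarefree_module_relations:
  fixes g :: "nat \<Rightarrow> nat \<Rightarrow> ('v::finite, 'k::field) mpoly"
  assumes hom: "\<And>l. l < n \<Longrightarrow> homogeneous N a (d l) (g l)"
    and sqf: "\<And>l. l < n \<Longrightarrow> squarefree_exp (d l)"
  shows "squarefree_module n d (relations (n, d, g))"
  unfolding squarefree_module_def
proof (intro conjI ballI allI impI; (elim conjE)?)
  show "0 \<in> relations (n, d, g)" by (simp add: relations_def)
next
  fix x k assume "x \<in> relations (n, d, g)" "n \<le> k"
  thus "x k = 0" by (simp add: relations_def)
next
  fix x y assume "x \<in> relations (n, d, g)" "y \<in> relations (n, d, g)"
  thus "x + y \<in> relations (n, d, g)" by (simp add: relations_def distrib_right sum.distrib)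
next
  fix x p assume "x \<in> relations (n, d, g)"
  thus "(\<lambda>k. p * x k) \<in> relations (n, d, g)"
    by (simp add: relations_def mult.assoc flip: sum_distrib_left)
next
  fix x m assume x: "x \<in> relations (n, d, g)"
  have "(\<Sum>l<n. part (\<lambda>b. b + d l = m) (x l) * g l k) = 0" for k
  proof -
    have "(\<Sum>l<n. part (\<lambda>b. b + d l = m) (x l) * g l k) =
        (\<Sum>l<n. part (\<lambda>b. b + a k = m) (x l * g l k))"
    proof (intro sum.cong refl part_mult[symmetric])
      fix l b c assume "l \<in> {..<n}" "b \<in> keys (g l k)"
      hence "b + a k = d l" using hom[of l] by (auto simp: homogeneous_def)
      thus "c + b + a k = m \<longleftrightarrow> c + d l = m" by (metis add.assoc)
    qed
    also have "\<dots> = part (\<lambda>b. b + a k = m) (\<Sum>l<n. x l * g l k)" by (simp add: part_sum)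
    also have "\<dots> = 0"
      using x by (intro poly_mapping_eqI) (simp add: relations_def coeff_part)
    finally show ?thesis .
  qed
  moreover have "part (\<lambda>b. b + d l = m) (x l) = 0" if "n \<le> l" for l
    using that x by (intro poly_mapping_eqI) (simp add: relations_def coeff_part)
  ultimately show "(\<lambda>k. part (\<lambda>b. b + d k = m) (x k)) \<in> relations (n, d, g)"
    by (simp add: relations_def)
next
  fix x m v
  assume x: "x \<in> relations (n, d, g)" and m: "homogeneous n d m x" "2 \<le> coeff m v"
  have "coeff b v \<noteq> 0" if "b \<in> keys (x l)" for b l
  proof -
    have "l < n" using that m(1) by (cases "l < n") (auto simp: homogeneous_def)
    hence "coeff (d l) v \<le> 1" using sqf by (simp add: squarefree_exp_def)
    moreover have "b + d l = m" using that m(1) by (simp add: homogeneous_def)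
    ultimately show ?thesis using m(2) by (auto simp: lookup_add)
  qed
  hence "\<exists>q. x l = variable v * q \<and> (\<forall>b. b \<in> keys q \<longleftrightarrow> b + var_exp v \<in> keys (x l))" for l
    by (intro divide_by_variable) blast
  then obtain y where y: "\<And>l. x l = variable v * y l"
    "\<And>l b. b \<in> keys (y l) \<longleftrightarrow> b + var_exp v \<in> keys (x l)" by metis
  have y0: "y l = 0" if "n \<le> l" for l
    using y(1)[of l] m(1) that by (auto simp: homogeneous_def dest: variable_mult_eq_0)
  have "b + d l = m - var_exp v" if "b \<in> keys (y l)" for b l
  proof -
    have "b + var_exp v + d l = m" using m(1) that y(2) by (auto simp: homogeneous_def)
    hence "m = b + d l + var_exp v" by (simp add: add_ac)
    thus ?thesis by simp
  qed
  hence "homogeneous n d (m - var_exp v) y" using y0 by (simp add: homogeneous_def)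
  moreover have "(\<Sum>l<n. y l * g l k) = 0" for k
  proof (rule variable_mult_eq_0)
    have "(\<Sum>l<n. x l * g l k) = 0" using x by (simp add: relations_def)
    thus "variable v * (\<Sum>l<n. y l * g l k) = 0" by (simp add: y(1) sum_distrib_left mult.assoc)
  qed
  hence "y \<in> relations (n, d, g)" using y0 by (simp add: relations_def)
  ultimately show "\<exists>y\<in>relations (n, d, g). homogeneous n d (m - var_exp v) y \<and> x = (\<lambda>k. variable v * y k)"
    using y(1) by auto
qed

definition covers_edge :: "'v set set \<Rightarrow> ('v \<Rightarrow>\<^sub>0 nat) \<Rightarrow> bool" where
  "covers_edge E b \<longleftrightarrow> (\<exists>e\<in>E. \<forall>v\<in>e. coeff b v \<noteq> 0)"

lemma covers_edge_add: "covers_edge E b \<Longrightarrow> covers_edge E (a + b)"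
  unfolding covers_edge_def lookup_add by (meson add_is_0)

lemma edge_ideal_iff:
  fixes p :: "('v::finite, 'k::field) mpoly"
  assumes E: "simple_graph UNIV E"
  shows "p \<in> edge_ideal E \<longleftrightarrow> (\<forall>b\<in>keys p. covers_edge E b)"
proof -
  interpret R: module "(*) :: ('v, 'k) mpoly \<Rightarrow> _"
    by unfold_locales (simp_all add: algebra_simps)
  define S :: "('v, 'k) mpoly set" where "S = {variable u * variable v | u v. {u, v} \<in> E}"
  define J :: "('v, 'k) mpoly set" where "J = {p. \<forall>b\<in>keys p. covers_edge E b}"
  have J: "R.subspace J"
  proof (rule R.subspaceI)
    show "0 \<in> J" by (simp add: J_def)
    show "x + y \<in> J" if "x \<in> J" "y \<in> J" for x y
      using that keys_add[of x y] by (auto simp: J_def)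
    show "c * x \<in> J" if "x \<in> J" for c x
      using that by (auto simp: J_def elim!: keys_mult_cases intro: covers_edge_add)
  qed
  have edge: "u \<noteq> v" if "{u, v} \<in> E" for u v
    using E that by (auto simp: simple_graph_def)
  have "S \<subseteq> J"
  proof
    fix p assume "p \<in> S"
    then obtain u v where uv: "{u, v} \<in> E" "p = variable u * variable v" by (auto simp: S_def)
    hence "p = single (var_exp u + var_exp v) 1" by (simp add: variable_def mult_single)
    with uv(1) show "p \<in> J"
      by (auto simp: J_def covers_edge_def lookup_add intro!: bexI[of _ "{u, v}"])
  qed
  hence 1: "R.span S \<subseteq> J" using J by (rule R.span_minimal)
  have "p \<in> R.span S" if "p \<in> J" for p
  proof -
    have "single b (coeff p b) \<in> R.span S" if b: "b \<in> keys p" for b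
    proof -
      obtain e where e: "e \<in> E" "\<And>v. v \<in> e \<Longrightarrow> coeff b v \<noteq> 0"
        using \<open>p \<in> J\<close> b by (auto simp: J_def covers_edge_def)
      have "card e = 2" using E e(1) by (simp add: simple_graph_def)
      then obtain u v where uv: "e = {u, v}" "u \<noteq> v" by (meson card_2_iff)
      define b' where "b' = b - var_exp u - var_exp v"
      have "b = b' + (var_exp u + var_exp v)"
        unfolding b'_def using e(2)[of u] e(2)[of v] uv
        by (intro poly_mapping_eqI) (auto simp: lookup_add lookup_minus lookup_single when_def)
      hence "single b (coeff p b) = single b' (coeff p b) * (variable u * variable v)"
        by (simp add: variable_def mult_single)
      also have "\<dots> \<in> R.span S"
        using e(1) uv(1) by (intro R.span_scale R.span_base) (auto simp: S_def)
      finally show ?thesis .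
    qed
    hence "(\<Sum>b\<in>keys p. single b (coeff p b)) \<in> R.span S" by (rule R.span_sum)
    thus ?thesis using poly_mapping_sum_single[of p] by simp
  qed
  with 1 have "R.span S = J" by blast
  thus ?thesis by (simp add: edge_ideal_def S_def J_def)
qed

text \<open>An ideal as a submodule of the free module of rank one.\<close>

definition embed_ideal :: "('v, 'k::field) mpoly set \<Rightarrow> (nat \<Rightarrow> ('v, 'k) mpoly) set" where
  "embed_ideal I = {x. x 0 \<in> I \<and> (\<forall>k\<ge>1. x k = 0)}"

lemma squarefree_module_edge_ideal:
  assumes E: "simple_graph UNIV E"
  shows "squarefree_module 1 (\<lambda>_. 0)
    (embed_ideal (edge_ideal E :: ('v::finite, 'k::field) mpoly set))"
  unfolding squarefree_module_def
proof (intro conjI ballI allI impI; (elim conjE)?)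
  let ?M = "embed_ideal (edge_ideal E :: ('v, 'k) mpoly set)"
  note iff = edge_ideal_iff[OF E, where 'k='k]
  show "0 \<in> ?M" by (simp add: embed_ideal_def iff)
  fix x assume x: "x \<in> ?M"
  show "x k = 0" if "1 \<le> k" for k using x that by (simp add: embed_ideal_def)
  show "x + y \<in> ?M" if "y \<in> ?M" for y
    using x that keys_add[of "x 0" "y 0"] by (auto simp: embed_ideal_def iff)
  show "(\<lambda>k. p * x k) \<in> ?M" for p
    using x by (auto simp: embed_ideal_def iff elim!: keys_mult_cases intro: covers_edge_add)
  show "(\<lambda>k. part (\<lambda>b. b + 0 = m) (x k)) \<in> ?M" for m
    using x by (auto simp: embed_ideal_def iff keys_part coeff_part intro!: poly_mapping_eqI)
  fix m v assume m: "homogeneous 1 (\<lambda>_. 0) m x" "2 \<le> coeff m v"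
  have key: "b = m" if "b \<in> keys (x 0)" for b using m(1) that by (auto simp: homogeneous_def)
  obtain q where q: "x 0 = variable v * q" "\<And>b. b \<in> keys q \<longleftrightarrow> b + var_exp v \<in> keys (x 0)"
    using divide_by_variable[of "x 0" v] key m(2) by force
  have qk: "b + var_exp v = m" if "b \<in> keys q" for b using that q(2) key by blast
  have "covers_edge E b" if b: "b \<in> keys q" for b
  proof -
    have "covers_edge E m" using x b q(2) qk[OF b] by (auto simp: embed_ideal_def iff)
    moreover have "coeff b u \<noteq> 0" if "coeff m u \<noteq> 0" for u
      using that m(2) unfolding qk[OF b, symmetric]
      by (auto simp: lookup_add lookup_single when_def split: if_splits)
    ultimately show ?thesis unfolding covers_edge_def by blast
  qed
  moreover have "b = m - var_exp v" if "b \<in> keys q" for b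
    using qk[OF that] by (metis add_diff_cancel_right')
  ultimately show "\<exists>y\<in>?M. homogeneous 1 (\<lambda>_. 0) (m - var_exp v) y \<and> x = (\<lambda>k. variable v * y k)"
    using x q(1)
    by (intro bexI[of _ "\<lambda>k. if k = 0 then q else 0"])
       (auto simp: embed_ideal_def iff homogeneous_def fun_eq_iff)
qed

lemma relations_image:
  assumes gen: "minimal_generators n d (relations (n, d, g)) (n', d', g')"
  shows "relations (n, d, g) =
    (\<lambda>x k. if k < n then \<Sum>l<n'. x l * g' l k else 0) ` {x. \<forall>l\<ge>n'. x l = 0}" (is "_ = ?f ` _")
proof (intro equalityI subsetI)
  fix x assume x: "x \<in> relations (n, d, g)"
  then obtain p where p: "\<And>k. x k = (\<Sum>l<n'. p l * g' l k)"
    using gen unfolding minimal_generators_def split by blast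
  define q where "q l = (if l < n' then p l else 0)" for l
  have "x = ?f q"
  proof
    fix k
    have "(\<Sum>l<n'. q l * g' l k) = (\<Sum>l<n'. p l * g' l k)"
      by (intro sum.cong) (auto simp: q_def)
    thus "x k = ?f q k" using p[of k] x by (auto simp: relations_def)
  qed
  thus "x \<in> ?f ` {x. \<forall>l\<ge>n'. x l = 0}" by (auto simp: q_def)
next
  fix y assume "y \<in> ?f ` {x. \<forall>l\<ge>n'. x l = 0}"
  then obtain x where y: "y = ?f x" by blast
  have g': "(\<Sum>k<n. g' l k * g k j) = 0" if "l < n'" for l j
    using gen that by (auto simp: minimal_generators_def relations_def)
  have "(\<Sum>k<n. y k * g k j) = (\<Sum>k<n. \<Sum>l<n'. x l * (g' l k * g k j))" for j
    by (simp add: y sum_distrib_right mult.assoc)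
  also have "\<dots> j = (\<Sum>l<n'. \<Sum>k<n. x l * (g' l k * g k j))" for j by (rule sum.swap)
  also have "\<dots> j = 0" for j by (simp add: g' flip: sum_distrib_left)
  finally show "y \<in> relations (n, d, g)" by (simp add: relations_def y)
qed

text \<open>Each step chooses minimal generators of the relations among the previous generators. The matrix
  entries have no constant terms because a relation among minimal generators has none.\<close>

theorem minimal_multigraded_resolution_exists:
  assumes E: "simple_graph UNIV E"
  shows "\<exists>F. minimal_graded_free_resolution (\<lambda>m. m) (edge_ideal E :: ('v::finite, 'k::field) mpoly set) F"
proof -
  define I where "I = (edge_ideal E :: ('v, 'k) mpoly set)"
  note iff = edge_ideal_iff[OF E, where 'k='k, folded I_def]
  from minimal_generators_exist[OF squarefree_module_edge_ideal[OF E]]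
  obtain \<sigma>0 :: "('v, 'k) generators" where \<sigma>0: "minimal_generators 1 (\<lambda>_. 0) (embed_ideal I) \<sigma>0"
    unfolding I_def by blast
  define P where "P \<sigma> \<longleftrightarrow> (\<exists>N a M. minimal_generators N a M \<sigma>)" for \<sigma> :: "('v, 'k) generators"
  define Q where "Q \<sigma> \<sigma>' \<longleftrightarrow> minimal_generators (fst \<sigma>) (fst (snd \<sigma>)) (relations \<sigma>) \<sigma>'"
    for \<sigma> \<sigma>' :: "('v, 'k) generators"
  have "\<exists>f. \<forall>i. ((i = 0 \<longrightarrow> f i = \<sigma>0) \<and> P (f i)) \<and> Q (f i) (f (Suc i))"
  proof (rule dependent_nat_choice)
    show "\<exists>\<sigma>. (0 = (0::nat) \<longrightarrow> \<sigma> = \<sigma>0) \<and> P \<sigma>" using \<sigma>0 by (auto simp: P_def)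
    fix \<sigma> :: "('v, 'k) generators" and i :: nat
    assume "(i = 0 \<longrightarrow> \<sigma> = \<sigma>0) \<and> P \<sigma>"
    then obtain N a M n d g where \<sigma>: "\<sigma> = (n, d, g)" "minimal_generators N a M (n, d, g)"
      unfolding P_def by (metis prod_cases3)
    have "squarefree_module n d (relations (n, d, g))"
      using \<sigma>(2) by (intro squarefree_module_relations[of _ N a]) (auto simp: minimal_generators_def)
    from minimal_generators_exist[OF this] obtain \<sigma>' where
      "minimal_generators n d (relations (n, d, g)) \<sigma>'" ..
    hence "P \<sigma>'" "Q \<sigma> \<sigma>'" unfolding P_def Q_def \<sigma>(1) by auto
    thus "\<exists>\<sigma>'. ((Suc i = 0 \<longrightarrow> \<sigma>' = \<sigma>0) \<and> P \<sigma>') \<and> Q \<sigma> \<sigma>'" by blast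
  qed
  then obtain f where f0: "f 0 = \<sigma>0" and fQ: "\<And>i. Q (f i) (f (Suc i))" by blast
  define n d g where "n i = fst (f i)" and "d i = fst (snd (f i))" and "g i = snd (snd (f i))" for i
  have f: "f i = (n i, d i, g i)" for i by (simp add: n_def d_def g_def)
  have g0: "minimal_generators 1 (\<lambda>_. 0) (embed_ideal I) (n 0, d 0, g 0)"
    using \<sigma>0 f0 f[of 0] by simp
  have gS: "minimal_generators (n i) (d i) (relations (n i, d i, g i)) (n (Suc i), d (Suc i), g (Suc i))" for i
    using fQ[of i] by (simp add: Q_def f)
  have hom0: "\<And>l. l < n 0 \<Longrightarrow> homogeneous 1 (\<lambda>_. 0) (d 0 l) (g 0 l)"
    and memb0: "\<And>l. l < n 0 \<Longrightarrow> g 0 l \<in> embed_ideal I"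
    using g0 by (auto simp: minimal_generators_def)
  have homS: "\<And>i l. l < n (Suc i) \<Longrightarrow> homogeneous (n i) (d i) (d (Suc i) l) (g (Suc i) l)"
    using gS by (auto simp: minimal_generators_def)
  have min: "coeff (p l) 0 = 0" if "\<And>k. (\<Sum>l<n i. p l * g i l k) = 0" "l < n i" for p l i
  proof -
    obtain N a M where "minimal_generators N a M (n i, d i, g i)"
      using g0 gS by (cases i) blast+
    with that show ?thesis unfolding minimal_generators_def split by blast
  qed
  define F :: "(('v, 'k) mpoly, 'v \<Rightarrow>\<^sub>0 nat) free_complex" where
    "F = \<lparr> rk = n, shift = d, aug = (\<lambda>k. g 0 k 0), mat = (\<lambda>i k l. g (Suc i) l k) \<rparr>"
  have "graded_complex (\<lambda>m. m) F"
    using hom0 homS by (auto simp: graded_complex_def F_def homogeneous_def)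
  moreover have "minimal_complex F"
    unfolding minimal_complex_def
  proof (intro allI impI)
    fix i k l assume kl: "k < rk F i" "l < rk F (Suc i)"
    have "g (Suc i) l \<in> relations (n i, d i, g i)"
      using gS[of i] kl by (auto simp: minimal_generators_def F_def)
    hence "(\<Sum>k<n i. g (Suc i) l k * g i k j) = 0" for j by (auto simp: relations_def)
    from min[OF this] kl show "coeff (mat F i k l) 0 = 0" by (simp add: F_def)
  qed
  moreover have "resolves F I"
    unfolding resolves_def
  proof (intro conjI allI)
    show "aug_map F ` free_module F 0 = I"
    proof (intro equalityI subsetI)
      fix p assume "p \<in> aug_map F ` free_module F 0"
      then obtain x where "p = (\<Sum>k<n 0. x k * g 0 k 0)" by (auto simp: aug_map_def F_def)
      thus "p \<in> I" using memb0
        by (auto simp: iff embed_ideal_def elim!: keys_sum_cases keys_mult_cases intro!: covers_edge_add)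
    next
      fix p assume "p \<in> I"
      define x where "x k = (if k = 0 then p else 0)" for k :: nat
      have "x \<in> embed_ideal I" using \<open>p \<in> I\<close> by (simp add: embed_ideal_def x_def)
      then obtain q where "\<And>k. x k = (\<Sum>l<n 0. q l * g 0 l k)"
        using g0 unfolding minimal_generators_def split by blast
      from this[of 0] have "p = (\<Sum>l<n 0. (if l < n 0 then q l else 0) * g 0 l 0)"
        by (simp add: x_def)
      thus "p \<in> aug_map F ` free_module F 0"
        by (intro image_eqI[of _ _ "\<lambda>l. if l < n 0 then q l else 0"])
           (auto simp: aug_map_def F_def free_module_def)
    qed
    have image: "diff_map F i ` free_module F (Suc i) = relations (n i, d i, g i)" for i
      using relations_image[OF gS[of i]]
      by (simp add: diff_map_def[abs_def] free_module_def F_def cong: if_cong)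
    have "{x \<in> free_module F 0. aug_map F x = 0} = relations (n 0, d 0, g 0)"
    proof -
      have "g 0 l k = 0" if "l < n 0" "k \<noteq> 0" for k l using memb0[OF that(1)] that(2)
        by (simp add: embed_ideal_def)
      hence z: "(\<Sum>l<n 0. x l * g 0 l k) = 0" if "k \<noteq> 0" for x k using that by simp
      have "(\<forall>k. (\<Sum>l<n 0. x l * g 0 l k) = 0) \<longleftrightarrow> (\<Sum>l<n 0. x l * g 0 l 0) = 0" for x
      proof (intro iffI allI)
        fix k assume "(\<Sum>l<n 0. x l * g 0 l 0) = 0"
        thus "(\<Sum>l<n 0. x l * g 0 l k) = 0" using z by (cases "k = 0") auto
      qed simp
      thus ?thesis by (simp add: free_module_def aug_map_def F_def relations_def)
    qed
    thus "{x \<in> free_module F 0. aug_map F x = 0} = diff_map F 0 ` free_module F 1"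
      using image[of 0] by simp
    fix i
    have "{x \<in> free_module F (Suc i). diff_map F i x = (\<lambda>_. 0)} = relations (n (Suc i), d (Suc i), g (Suc i))"
    proof -
      have "g (Suc i) l k = 0" if "l < n (Suc i)" "\<not> k < n i" for k l using homS[OF that(1)] that(2)
        by (simp add: homogeneous_def)
      hence z: "(\<Sum>l<n (Suc i). x l * g (Suc i) l k) = 0" if "\<not> k < n i" for x k using that by simp
      have "(\<forall>k. (\<Sum>l<n (Suc i). x l * g (Suc i) l k) = 0) \<longleftrightarrow>
          (\<forall>k. (if k < n i then \<Sum>l<n (Suc i). x l * g (Suc i) l k else 0) = 0)" for x
      proof (intro iffI allI)
        fix k assume "\<forall>k. (if k < n i then \<Sum>l<n (Suc i). x l * g (Suc i) l k else 0) = 0"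
        hence "(if k < n i then \<Sum>l<n (Suc i). x l * g (Suc i) l k else 0) = 0" by (rule spec)
        thus "(\<Sum>l<n (Suc i). x l * g (Suc i) l k) = 0" using z by (cases "k < n i") auto
      qed auto
      thus ?thesis
        unfolding free_module_def diff_map_def F_def relations_def fun_eq_iff by simp
    qed
    thus "{x \<in> free_module F (Suc i). diff_map F i x = (\<lambda>_. 0)} =
        diff_map F (Suc i) ` free_module F (Suc (Suc i))"
      using image[of "Suc i"] by simp
  qed
  ultimately show ?thesis unfolding minimal_graded_free_resolution_def I_def by blast
qed

section \<open>Cohomology of families of sets\<close>

context vertex_order
begin

abbreviation codiff :: "('v set \<Rightarrow> 'k::field) \<Rightarrow> 'v set \<Rightarrow> 'k" where
  "codiff \<equiv> kdiff (\<lambda>_. 1)"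

text \<open>The index \<open>n\<close> counts elements, so it exceeds the simplicial dimension by one. Cochains are
  arbitrary functions on sets; only their values at the relevant members of \<open>\<Delta>\<close> enter.\<close>

definition cocycles :: "'v set set \<Rightarrow> nat \<Rightarrow> ('v set \<Rightarrow> 'k::field) set" where
  "cocycles \<Delta> n = {\<phi>. \<forall>T\<in>\<Delta>. card T = Suc n \<longrightarrow> codiff \<phi> T = 0}"

definition coboundaries :: "'v set set \<Rightarrow> nat \<Rightarrow> ('v set \<Rightarrow> 'k::field) set" where
  "coboundaries \<Delta> n = {\<phi>. \<exists>\<psi>. \<forall>T\<in>\<Delta>. card T = n \<longrightarrow> \<phi> T = codiff \<psi> T}"

definition cochain_scale :: "'k::field \<Rightarrow> ('v set \<Rightarrow> 'k) \<Rightarrow> 'v set \<Rightarrow> 'k" where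
  "cochain_scale a \<phi> = (\<lambda>T. a * \<phi> T)"

lemma codiff_minus: "codiff (\<phi> - \<psi>) = codiff \<phi> - codiff \<psi>"
  and codiff_plus: "codiff (\<phi> + \<psi>) = codiff \<phi> + codiff \<psi>"
  and codiff_cochain_scale: "codiff (cochain_scale a \<phi>) = cochain_scale a (codiff \<phi>)"
proof -
  show "codiff (\<phi> - \<psi>) = codiff \<phi> - codiff \<psi>"
    unfolding fun_diff_def by (intro ext kdiff_diff)
  show "codiff (\<phi> + \<psi>) = codiff \<phi> + codiff \<psi>"
    unfolding plus_fun_def by (intro ext kdiff_add)
  show "codiff (cochain_scale a \<phi>) = cochain_scale a (codiff \<phi>)"
    by (simp add: fun_eq_iff cochain_scale_def kdiff_scale)
qed

lemma codiff_codiff [simp]: "codiff (codiff \<phi>) = 0"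
  by (simp add: fun_eq_iff)

lemma cocyclesD: "\<phi> \<in> cocycles \<Delta> n \<Longrightarrow> T \<in> \<Delta> \<Longrightarrow> card T = Suc n \<Longrightarrow> codiff \<phi> T = 0"
  by (simp add: cocycles_def)

lemma coboundariesI:
  "(\<And>T. T \<in> \<Delta> \<Longrightarrow> card T = n \<Longrightarrow> \<phi> T = codiff \<psi> T) \<Longrightarrow> \<phi> \<in> coboundaries \<Delta> n"
  by (auto simp: coboundaries_def)

lemma lin_subspace_coboundaries:
  "lin_subspace cochain_scale (coboundaries \<Delta> n :: ('v set \<Rightarrow> 'k::field) set)"
  unfolding lin_subspace_def
proof (intro conjI ballI allI)
  show "0 \<in> coboundaries \<Delta> n" by (rule coboundariesI[of _ _ _ 0]) (simp add: kdiff_def)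
next
  fix x y :: "'v set \<Rightarrow> 'k" assume "x \<in> coboundaries \<Delta> n" "y \<in> coboundaries \<Delta> n"
  then obtain u v where "\<forall>T\<in>\<Delta>. card T = n \<longrightarrow> x T = codiff u T"
    "\<forall>T\<in>\<Delta>. card T = n \<longrightarrow> y T = codiff v T"
    unfolding coboundaries_def by blast
  thus "x - y \<in> coboundaries \<Delta> n"
    by (intro coboundariesI[of _ _ _ "u - v"]) (simp add: codiff_minus)
next
  fix x :: "'v set \<Rightarrow> 'k" and a assume "x \<in> coboundaries \<Delta> n"
  then obtain u where "\<forall>T\<in>\<Delta>. card T = n \<longrightarrow> x T = codiff u T"
    unfolding coboundaries_def by blast
  thus "cochain_scale a x \<in> coboundaries \<Delta> n"
    by (intro coboundariesI[of _ _ _ "cochain_scale a u"])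
       (simp add: codiff_cochain_scale, simp add: cochain_scale_def)
qed

lemmas coboundaries_add = lin_subspace_add[OF lin_subspace_coboundaries]

lemma cocycles_mono: "\<Delta>' \<subseteq> \<Delta> \<Longrightarrow> cocycles \<Delta> n \<subseteq> cocycles \<Delta>' n"
  by (auto simp: cocycles_def)

text \<open>Inserting the apex \<open>x\<close> is a contracting homotopy.\<close>

lemma cone_acyclic:
  assumes x: "\<And>T. T \<in> \<Delta> \<Longrightarrow> insert x T \<in> \<Delta>"
  shows "cocycles \<Delta> n \<subseteq> (coboundaries \<Delta> n :: ('v set \<Rightarrow> 'k::field) set)"
proof
  fix \<phi> :: "'v set \<Rightarrow> 'k" assume \<phi>: "\<phi> \<in> cocycles \<Delta> n"
  define \<psi> where "\<psi> T = (if x \<in> T then 0 else psgn x (insert x T) * \<phi> (insert x T))" for T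
  show "\<phi> \<in> coboundaries \<Delta> n"
  proof (rule coboundariesI)
    fix T assume T: "T \<in> \<Delta>" "card T = n"
    show "\<phi> T = codiff \<psi> T"
    proof (cases "x \<in> T")
      case True
      hence "codiff \<psi> T = (\<Sum>v\<in>T. if v = x then \<phi> T else 0)"
        unfolding kdiff_def by (intro sum.cong) (auto simp: \<psi>_def insert_absorb)
      thus ?thesis using True by simp
    next
      case False
      define T' where "T' = insert x T"
      have "codiff \<psi> T = (\<Sum>v\<in>T. psgn v T * psgn x (insert x (T - {v})) * \<phi> (insert x (T - {v})))"
        unfolding kdiff_def using False by (intro sum.cong) (auto simp: \<psi>_def)
      also have "\<dots> = (\<Sum>v\<in>T. - (psgn x T' * (psgn v T' * \<phi> (T' - {v}))))"
      proof (intro sum.cong refl)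
        fix v assume v: "v \<in> T"
        have "insert x (T - {v}) = T' - {v}" using v False by (auto simp: T'_def)
        thus "psgn v T * psgn x (insert x (T - {v})) * \<phi> (insert x (T - {v})) =
            - (psgn x T' * (psgn v T' * \<phi> (T' - {v})))"
          unfolding psgn_insert[OF v False] by (simp add: T'_def mult.assoc)
      qed
      also have "\<dots> = - (psgn x T' * (\<Sum>v\<in>T. psgn v T' * \<phi> (T' - {v})))"
        by (simp add: sum_negf sum_distrib_left)
      also have "(\<Sum>v\<in>T. psgn v T' * \<phi> (T' - {v})) = - (psgn x T' * \<phi> T)"
      proof -
        have "codiff \<phi> T' = 0"
          using \<phi> x T False by (intro cocyclesD) (auto simp: T'_def)
        moreover have "codiff \<phi> T' = psgn x T' * \<phi> T + (\<Sum>v\<in>T. psgn v T' * \<phi> (T' - {v}))"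
          using False by (simp add: kdiff_def T'_def)
        ultimately show ?thesis by (simp add: eq_neg_iff_add_eq_0 add.commute)
      qed
      finally show ?thesis by simp
    qed
  qed
qed

text \<open>The extension by zero of a cochain on the link of \<open>x\<close> to the sets containing \<open>x\<close>, up to sign.
  It induces the map from the cohomology of the link to that of the complex in the exact sequence
  that also involves the deletion.\<close>

definition join :: "'v \<Rightarrow> ('v set \<Rightarrow> 'k::field) \<Rightarrow> 'v set \<Rightarrow> 'k" where
  "join x \<theta> T = (if x \<in> T then psgn x T * \<theta> (T - {x}) else 0)"

lemma codiff_join:
  fixes \<theta> :: "'v set \<Rightarrow> 'k::field"
  shows "codiff (join x \<theta>) = - join x (codiff \<theta>)"
proof
  fix T
  show "codiff (join x \<theta>) T = (- join x (codiff \<theta>)) T"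
  proof (cases "x \<in> T")
    case False
    thus ?thesis by (simp add: join_def kdiff_def)
  next
    case True
    have "codiff (join x \<theta>) T = (\<Sum>v\<in>T. psgn v T * join x \<theta> (T - {v}))" by (simp add: kdiff_def)
    also have "\<dots> = (\<Sum>v\<in>T - {x}. psgn v T * join x \<theta> (T - {v}))"
      by (intro sum.mono_neutral_right) (auto simp: join_def)
    also have "\<dots> = (\<Sum>v\<in>T - {x}. - (psgn x T * (psgn v (T - {x}) * \<theta> (T - {x} - {v}))))"
    proof (intro sum.cong refl)
      fix v assume v: "v \<in> T - {x}"
      have "T - {v} - {x} = T - {x} - {v}" by auto
      hence "psgn v T * join x \<theta> (T - {v}) = (psgn v T * psgn x (T - {v})) * \<theta> (T - {x} - {v})"
        using True v by (auto simp: join_def mult.assoc)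
      also have "psgn v T * psgn x (T - {v}) = - (psgn x T * psgn v (T - {x}) :: 'k)"
        using True v by (intro psgn_anticommute) auto
      finally show "psgn v T * join x \<theta> (T - {v}) =
          - (psgn x T * (psgn v (T - {x}) * \<theta> (T - {x} - {v})))" by (simp add: mult.assoc)
    qed
    also have "\<dots> = - join x (codiff \<theta>) T"
      using True by (simp add: join_def kdiff_def sum_negf sum_distrib_left)
    finally show ?thesis by simp
  qed
qed

lemma join_diff: "join x (\<phi> - \<psi>) = join x \<phi> - join x \<psi>"
  by (simp add: join_def fun_eq_iff right_diff_distrib)

lemma join_scale: "join x (cochain_scale a \<phi>) = cochain_scale a (join x \<phi>)"
  by (simp add: join_def cochain_scale_def fun_eq_iff)

definition deletion :: "'v \<Rightarrow> 'v set set \<Rightarrow> 'v set set" where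
  "deletion x \<Delta> = {T \<in> \<Delta>. x \<notin> T}"

definition link :: "'v \<Rightarrow> 'v set set \<Rightarrow> 'v set set" where
  "link x \<Delta> = {T. x \<notin> T \<and> insert x T \<in> \<Delta>}"

lemma linkI: "T \<in> \<Delta> \<Longrightarrow> x \<in> T \<Longrightarrow> T - {x} \<in> link x \<Delta>"
  by (simp add: link_def insert_absorb)

lemma codiff_extend:
  assumes "x \<in> T"
  shows "codiff (\<lambda>T. if x \<in> T then 0 else \<psi> T) T = join x \<psi> T"
proof -
  have "codiff (\<lambda>T. if x \<in> T then 0 else \<psi> T) T = (\<Sum>v\<in>T. if v = x then join x \<psi> T else 0)"
    unfolding kdiff_def using assms by (intro sum.cong) (auto simp: join_def)
  thus ?thesis using assms by simp
qed

lemma join_coboundary_link: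
  assumes "\<chi> \<in> coboundaries (link x \<Delta>) n" shows "join x \<chi> \<in> coboundaries \<Delta> (Suc n)"
proof -
  from assms obtain \<theta> where \<theta>: "\<And>T. T \<in> link x \<Delta> \<Longrightarrow> card T = n \<Longrightarrow> \<chi> T = codiff \<theta> T"
    by (auto simp: coboundaries_def)
  show ?thesis
  proof (rule coboundariesI[of _ _ _ "join x (- \<theta>)"])
    fix T assume T: "T \<in> \<Delta>" "card T = Suc n"
    have neg: "codiff (- \<theta>) T = - codiff \<theta> T" for T by (simp add: kdiff_def sum_negf)
    have "\<chi> (T - {x}) = codiff \<theta> (T - {x})" if "x \<in> T"
      using T that by (intro \<theta> linkI) auto
    thus "join x \<chi> T = codiff (join x (- \<theta>)) T"
      unfolding codiff_join by (simp add: join_def neg)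
  qed
qed

lemma join_coboundary_deletion:
  assumes "\<chi> \<in> cocycles (deletion x \<Delta>) n" shows "join x \<chi> \<in> coboundaries \<Delta> (Suc n)"
proof (rule coboundariesI)
  fix T assume T: "T \<in> \<Delta>" "card T = Suc n"
  show "join x \<chi> T = codiff (\<lambda>T. if x \<in> T then 0 else \<chi> T) T"
  proof (cases "x \<in> T")
    case True thus ?thesis by (simp add: codiff_extend)
  next
    case False
    hence "codiff (\<lambda>T. if x \<in> T then 0 else \<chi> T) T = codiff \<chi> T"
      by (intro kdiff_cong) auto
    also have "\<dots> = 0" using T False by (intro cocyclesD[OF assms]) (auto simp: deletion_def)
    finally show ?thesis using False by (simp add: join_def)
  qed
qed

text \<open>Exactness at the cohomology of the link: a class that dies in the complex comes from the
  deletion.\<close>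

lemma join_coboundaryD:
  assumes "join x \<chi> \<in> coboundaries \<Delta> (Suc n)"
  shows "\<exists>\<chi>'\<in>cocycles (deletion x \<Delta>) n. \<chi> - \<chi>' \<in> coboundaries (link x \<Delta>) n"
proof -
  from assms obtain \<psi> where \<psi>: "\<And>T. T \<in> \<Delta> \<Longrightarrow> card T = Suc n \<Longrightarrow> join x \<chi> T = codiff \<psi> T"
    by (auto simp: coboundaries_def)
  have "codiff \<psi> T = 0" if "T \<in> deletion x \<Delta>" "card T = Suc n" for T
    using \<psi>[of T] that by (auto simp: deletion_def join_def)
  hence cocycle: "\<psi> \<in> cocycles (deletion x \<Delta>) n" by (simp add: cocycles_def)
  define \<theta> where "\<theta> T = psgn x (insert x T) * \<psi> (insert x T)" for T
  have "\<psi> = (\<lambda>T. (if x \<in> T then 0 else \<psi> T) + join x \<theta> T)"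
    by (auto simp: fun_eq_iff join_def \<theta>_def insert_absorb)
  hence "codiff \<psi> T = codiff (\<lambda>T. (if x \<in> T then 0 else \<psi> T) + join x \<theta> T) T" for T by simp
  hence split: "codiff \<psi> T = codiff (\<lambda>T. if x \<in> T then 0 else \<psi> T) T - join x (codiff \<theta>) T" for T
    by (simp add: kdiff_add codiff_join)
  have "\<chi> - \<psi> \<in> coboundaries (link x \<Delta>) n"
  proof (rule coboundariesI[of _ _ _ "- \<theta>"])
    fix T assume T: "T \<in> link x \<Delta>" "card T = n"
    hence xT: "x \<notin> T" "insert x T \<in> \<Delta>" by (auto simp: link_def)
    have "join x \<chi> (insert x T) = join x \<psi> (insert x T) - join x (codiff \<theta>) (insert x T)"
      using \<psi>[OF xT(2)] xT T unfolding split by (simp add: codiff_extend)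
    hence "psgn x (insert x T) * \<chi> T = psgn x (insert x T) * (\<psi> T - codiff \<theta> T)"
      using xT by (simp add: join_def right_diff_distrib)
    hence "\<chi> T = \<psi> T - codiff \<theta> T" by (simp only: psgn_mult_cancel)
    thus "(\<chi> - \<psi>) T = codiff (- \<theta>) T" by (simp add: kdiff_def sum_negf)
  qed
  with cocycle show ?thesis by blast
qed

text \<open>Exactness at the cohomology of the complex: when its restriction to the deletion is a
  coboundary, a cocycle comes from the link.\<close>

lemma cocycle_reduction:
  assumes closed: "\<And>T v. T \<in> \<Delta> \<Longrightarrow> T - {v} \<in> \<Delta>"
    and acyclic: "cocycles (deletion x \<Delta>) (Suc n) \<subseteq> (coboundaries (deletion x \<Delta>) (Suc n) :: ('v set \<Rightarrow> 'k::field) set)"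
    and \<phi>: "\<phi> \<in> cocycles \<Delta> (Suc n)"
  shows "\<exists>\<chi> :: 'v set \<Rightarrow> 'k. \<chi> \<in> cocycles (link x \<Delta>) n \<and> \<phi> - join x \<chi> \<in> coboundaries \<Delta> (Suc n)"
proof -
  have "\<phi> \<in> coboundaries (deletion x \<Delta>) (Suc n)"
    using \<phi> acyclic by (auto simp: cocycles_def deletion_def)
  then obtain \<psi> where \<psi>: "\<And>T. T \<in> deletion x \<Delta> \<Longrightarrow> card T = Suc n \<Longrightarrow> \<phi> T = codiff \<psi> T"
    by (auto simp: coboundaries_def)
  \<comment> \<open>This cocycle vanishes on the deletion, so it is the join of \<open>x\<close> with a cochain on the link.\<close>
  define \<phi>' where "\<phi>' = \<phi> - codiff \<psi>"
  have \<phi>': "\<phi>' T = 0" if "T \<in> \<Delta>" "x \<notin> T" "card T = Suc n" for T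
    using that \<psi>[of T] by (simp add: \<phi>'_def deletion_def)
  define \<chi> where "\<chi> T = psgn x (insert x T) * \<phi>' (insert x T)" for T
  have eq: "\<phi>' T = join x \<chi> T" if "T \<in> \<Delta>" "card T = Suc n" for T
    using \<phi>'[OF that(1) _ that(2)] by (auto simp: join_def \<chi>_def insert_absorb)
  have "\<chi> \<in> cocycles (link x \<Delta>) n"
    unfolding cocycles_def
  proof (intro CollectI ballI impI)
    fix T assume T: "T \<in> link x \<Delta>" "card T = Suc n"
    define T' where "T' = insert x T"
    have T': "T' \<in> \<Delta>" "card T' = Suc (Suc n)" "x \<in> T'" "T' - {x} = T"
      using T by (auto simp: T'_def link_def)
    have "0 = codiff \<phi> T'" using cocyclesD[OF \<phi> T'(1,2)] by simp
    also have "\<dots> = codiff \<phi>' T'" by (simp add: \<phi>'_def codiff_minus)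
    also have "\<dots> = codiff (join x \<chi>) T'"
      using T' by (intro kdiff_cong eq closed) auto
    also have "\<dots> = - (psgn x T' * codiff \<chi> T)" using T' by (simp add: codiff_join join_def)
    finally show "codiff \<chi> T = 0" by simp
  qed
  moreover have "\<phi> - join x \<chi> \<in> coboundaries \<Delta> (Suc n)"
    by (rule coboundariesI[of _ _ _ \<psi>]) (simp add: eq[symmetric] \<phi>'_def)
  ultimately show ?thesis by blast
qed

lemma acyclic_by_vertex:
  assumes closed: "\<And>T v. T \<in> \<Delta> \<Longrightarrow> T - {v} \<in> \<Delta>"
    and deletion: "cocycles (deletion x \<Delta>) (Suc n) \<subseteq> (coboundaries (deletion x \<Delta>) (Suc n) :: ('v set \<Rightarrow> 'k::field) set)"
    and link: "\<And>\<chi> :: 'v set \<Rightarrow> 'k. \<chi> \<in> cocycles (link x \<Delta>) n \<Longrightarrow>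
      \<exists>\<chi>'\<in>cocycles (deletion x \<Delta>) n. \<chi> - \<chi>' \<in> coboundaries (link x \<Delta>) n"
  shows "cocycles \<Delta> (Suc n) \<subseteq> (coboundaries \<Delta> (Suc n) :: ('v set \<Rightarrow> 'k) set)"
proof
  fix \<phi> :: "'v set \<Rightarrow> 'k" assume "\<phi> \<in> cocycles \<Delta> (Suc n)"
  from cocycle_reduction[OF closed deletion this] obtain \<chi> :: "'v set \<Rightarrow> 'k"
    where \<chi>: "\<chi> \<in> cocycles (link x \<Delta>) n" "\<phi> - join x \<chi> \<in> coboundaries \<Delta> (Suc n)" by blast
  from link[OF \<chi>(1)] obtain \<chi>' where
    \<chi>': "\<chi>' \<in> cocycles (deletion x \<Delta>) n" "\<chi> - \<chi>' \<in> coboundaries (link x \<Delta>) n" by blast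
  have "(\<phi> - join x \<chi>) + (join x (\<chi> - \<chi>') + join x \<chi>') \<in> coboundaries \<Delta> (Suc n)"
    by (intro coboundaries_add \<chi>(2) join_coboundary_link[OF \<chi>'(2)] join_coboundary_deletion[OF \<chi>'(1)])
  thus "\<phi> \<in> coboundaries \<Delta> (Suc n)" by (simp add: join_diff)
qed

end

section \<open>Complexes of bicliques in a bipartite graph\<close>

text \<open>In the application \<open>B\<close> is the bipartite complement; its sides are \<open>X\<close> and the complement of
  \<open>X\<close>.\<close>

locale bipartite_graph = vertex_order idx for idx :: "'v::finite \<Rightarrow> nat" +
  fixes X :: "'v set" and B :: "'v set set"
  assumes bipartite: "B \<subseteq> {{x, y} | x y. x \<in> X \<and> y \<notin> X}"
begin

definition adj :: "'v \<Rightarrow> 'v \<Rightarrow> bool" where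
  "adj u v \<longleftrightarrow> {u, v} \<in> B"

text \<open>Sets of vertices whose parts on the two sides are completely joined, one of these parts possibly
  being empty.\<close>

definition bicliques :: "'v set \<Rightarrow> 'v set set" where
  "bicliques W = {T. T \<subseteq> W \<and> (\<forall>x\<in>T \<inter> X. \<forall>y\<in>T - X. adj x y)}"

definition link_set :: "'v set \<Rightarrow> 'v \<Rightarrow> 'v set" where
  "link_set W x = {v \<in> W. v \<noteq> x \<and> ((v \<in> X \<longleftrightarrow> x \<in> X) \<or> adj x v)}"

definition locally_constant :: "'v set \<Rightarrow> ('v \<Rightarrow> 'k) \<Rightarrow> bool" where
  "locally_constant W p \<longleftrightarrow> (\<forall>u\<in>W. \<forall>v\<in>W. adj u v \<longrightarrow> p u = p v)"

lemma adj_sym: "adj u v \<longleftrightarrow> adj v u"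
  by (simp add: adj_def insert_commute)

lemma adj_sides:
  assumes "adj u v" shows "u \<in> X \<longleftrightarrow> v \<notin> X"
proof -
  obtain x y where "{u, v} = {x, y}" "x \<in> X" "y \<notin> X"
    using bipartite assms unfolding adj_def by blast
  thus ?thesis by (auto simp: doubleton_eq_iff)
qed

lemma bicliques_closed: "T \<in> bicliques W \<Longrightarrow> T - {v} \<in> bicliques W"
  by (auto simp: bicliques_def)

lemma deletion_bicliques: "deletion x (bicliques W) = bicliques (W - {x})"
  by (auto simp: deletion_def bicliques_def)

lemma link_bicliques: "x \<in> W \<Longrightarrow> link x (bicliques W) = bicliques (link_set W x)"
proof (rule set_eqI)
  fix T assume x: "x \<in> W"
  show "T \<in> link x (bicliques W) \<longleftrightarrow> T \<in> bicliques (link_set W x)"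
  proof (cases "x \<in> X")
    case True
    have "insert x T \<inter> X = insert x (T \<inter> X)" "insert x T - X = T - X" using True by auto
    thus ?thesis using x True unfolding link_def bicliques_def link_set_def by auto
  next
    case False
    have "insert x T \<inter> X = T \<inter> X" "insert x T - X = insert x (T - X)" using False by auto
    thus ?thesis using x False adj_sym[of x] unfolding link_def bicliques_def link_set_def by auto
  qed
qed

lemma link_set_subset: "link_set W x \<subseteq> W - {x}"
  by (auto simp: link_set_def)

lemma bicliques_mono: "W' \<subseteq> W \<Longrightarrow> bicliques W' \<subseteq> bicliques W"
  by (auto simp: bicliques_def)

lemma psgn_pair: "u \<noteq> v \<Longrightarrow> psgn v {u, v} = - (psgn u {u, v} :: 'r::comm_ring_1)"
  using psgn_anticommute[of u "{u, v}" v, where 'r='r] by (simp add: insert_Diff_if)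

lemma codiff_pair: "u \<noteq> v \<Longrightarrow> codiff \<phi> {u, v} = psgn u {u, v} * (\<phi> {v} - \<phi> {u})"
  by (simp add: kdiff_def insert_Diff_if psgn_pair[of u v] right_diff_distrib)

definition vertex_cochain :: "('v \<Rightarrow> 'k::field) \<Rightarrow> 'v set \<Rightarrow> 'k" where
  "vertex_cochain p T = (\<Sum>v\<in>T. if v \<in> X then 0 else p v)"

text \<open>The cochain on pairs with value \<open>p y\<close>, up to sign, at an edge \<open>{x, y}\<close> with \<open>y\<close> outside \<open>X\<close>, and with
  value zero at pairs inside one side. It differs from a coboundary only at pairs outside \<open>X\<close>.\<close>

definition edge_cochain :: "('v \<Rightarrow> 'k::field) \<Rightarrow> 'v set \<Rightarrow> 'k" where
  "edge_cochain p T = (if T \<inter> X = {} then 0 else codiff (vertex_cochain p) T)"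

lemma edge_cochain_X: "u \<in> X \<Longrightarrow> v \<in> X \<Longrightarrow> u \<noteq> v \<Longrightarrow> edge_cochain p {u, v} = 0"
  and edge_cochain_Y: "u \<notin> X \<Longrightarrow> v \<notin> X \<Longrightarrow> edge_cochain p {u, v} = 0"
  by (simp_all add: edge_cochain_def codiff_pair vertex_cochain_def)

lemma edge_cochain_XY:
  assumes "u \<in> X" "v \<notin> X" shows "edge_cochain p {u, v} = psgn u {u, v} * p v"
proof -
  have "u \<noteq> v" using assms by blast
  with assms show ?thesis by (simp add: edge_cochain_def codiff_pair vertex_cochain_def)
qed

lemma edge_cochain_linear:
  "edge_cochain (\<lambda>v. a * p v + q v) = cochain_scale a (edge_cochain p) + edge_cochain q"
proof -
  have "vertex_cochain (\<lambda>v. a * p v + q v) T =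
      (cochain_scale a (vertex_cochain p) + vertex_cochain q) T" for T
  proof -
    have "vertex_cochain (\<lambda>v. a * p v + q v) T =
        (\<Sum>v\<in>T. a * (if v \<in> X then 0 else p v) + (if v \<in> X then 0 else q v))"
      unfolding vertex_cochain_def by (intro sum.cong) auto
    thus ?thesis
      by (simp add: vertex_cochain_def cochain_scale_def sum.distrib sum_distrib_left)
  qed
  hence "vertex_cochain (\<lambda>v. a * p v + q v) = cochain_scale a (vertex_cochain p) + vertex_cochain q"
    by blast
  hence "codiff (vertex_cochain (\<lambda>v. a * p v + q v)) =
      cochain_scale a (codiff (vertex_cochain p)) + codiff (vertex_cochain q)"
    by (simp only: codiff_plus codiff_cochain_scale)
  thus ?thesis by (simp add: fun_eq_iff edge_cochain_def cochain_scale_def)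
qed

lemma edge_cochain_cong:
  assumes "\<And>y. y \<in> T - X \<Longrightarrow> p y = q y" shows "edge_cochain p T = edge_cochain q T"
proof -
  have "vertex_cochain p (T - {v}) = vertex_cochain q (T - {v})" for v
    unfolding vertex_cochain_def using assms by (intro sum.cong) auto
  thus ?thesis by (auto simp: edge_cochain_def intro: kdiff_cong)
qed

text \<open>A triple \<open>{x, y, z}\<close> with only \<open>x\<close> in \<open>X\<close> is the one case in which the change of the coboundary at
  pairs outside \<open>X\<close> matters; there \<open>p y = p x = p z\<close>.\<close>

lemma edge_cochain_cocycle:
  assumes "locally_constant W p" shows "edge_cochain p \<in> cocycles (bicliques W) 2"
  unfolding cocycles_def
proof (intro CollectI ballI impI)
  fix T assume T: "T \<in> bicliques W" "card T = Suc 2"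
  show "codiff (edge_cochain p) T = 0"
  proof (cases "T \<inter> X = {}")
    case True
    hence "(T - {v}) \<inter> X = {}" for v by auto
    thus ?thesis by (simp add: kdiff_def edge_cochain_def)
  next
    case False
    have "edge_cochain p (T - {v}) = codiff (vertex_cochain p) (T - {v})" if v: "v \<in> T" for v
    proof (cases "(T - {v}) \<inter> X = {}")
      case True
      with False v have vX: "v \<in> X" by auto
      have "card (T - {v}) = 2" using T v by simp
      then obtain y z where yz: "T - {v} = {y, z}" "y \<noteq> z" by (meson card_2_iff)
      hence "y \<in> T" "z \<in> T" "y \<notin> X" "z \<notin> X" using True by auto
      hence "adj v y" "adj v z" using T v vX by (auto simp: bicliques_def)
      hence "p v = p y" "p v = p z"
        using assms T v \<open>y \<in> T\<close> \<open>z \<in> T\<close> by (auto simp: locally_constant_def bicliques_def)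
      thus ?thesis using True yz \<open>y \<notin> X\<close> \<open>z \<notin> X\<close>
        by (simp add: edge_cochain_def codiff_pair vertex_cochain_def)
    qed (simp add: edge_cochain_def)
    hence "codiff (edge_cochain p) T = codiff (codiff (vertex_cochain p)) T"
      by (rule kdiff_cong)
    thus ?thesis by simp
  qed
qed

lemma edge_cochain_const: "edge_cochain (\<lambda>_. a) \<in> coboundaries \<Delta> 2"
proof (rule coboundariesI)
  fix T :: "'v set" assume T: "card T = 2"
  show "edge_cochain (\<lambda>_. a) T = codiff (vertex_cochain (\<lambda>_. a)) T"
  proof (cases "T \<inter> X = {}")
    case True
    from T obtain y z where "T = {y, z}" "y \<noteq> z" by (meson card_2_iff)
    with True show ?thesis by (simp add: edge_cochain_def codiff_pair vertex_cochain_def)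
  qed (simp add: edge_cochain_def)
qed

lemma edge_cochain_coboundaryD:
  assumes cob: "edge_cochain p \<in> coboundaries (bicliques W) 2"
    and W: "{x, x', y, y'} \<subseteq> W" "adj x y" "adj x' y'" "x \<in> X" "x' \<in> X"
  shows "p y = p y'"
proof -
  from cob obtain \<psi> where \<psi>: "\<And>T. T \<in> bicliques W \<Longrightarrow> card T = 2 \<Longrightarrow> edge_cochain p T = codiff \<psi> T"
    by (auto simp: coboundaries_def)
  have Y: "y \<notin> X" "y' \<notin> X" using W adj_sides by blast+
  have XX: "\<psi> {x} = \<psi> {x'}"
  proof (cases "x = x'")
    case False
    have "edge_cochain p {x, x'} = codiff \<psi> {x, x'}"
      using W False by (intro \<psi>) (auto simp: bicliques_def)
    thus ?thesis using W False by (simp add: edge_cochain_X codiff_pair)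
  qed simp
  have YY: "\<psi> {y} = \<psi> {y'}"
  proof (cases "y = y'")
    case False
    have "edge_cochain p {y, y'} = codiff \<psi> {y, y'}"
      using W Y False by (intro \<psi>) (auto simp: bicliques_def)
    thus ?thesis using Y False by (simp add: edge_cochain_Y codiff_pair)
  qed simp
  have XY: "p w = \<psi> {w} - \<psi> {v}" if "v \<in> W" "w \<in> W" "v \<in> X" "w \<notin> X" "adj v w" for v w
  proof -
    have ne: "v \<noteq> w" using that by blast
    have "edge_cochain p {v, w} = codiff \<psi> {v, w}"
      using that ne by (intro \<psi>) (auto simp: bicliques_def)
    thus ?thesis using that ne by (simp add: edge_cochain_XY codiff_pair psgn_mult_cancel)
  qed
  show ?thesis using XY[of x y] XY[of x' y'] W Y XX YY by simp
qed

lemma side_acyclic: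
  assumes "W \<subseteq> X \<or> W \<inter> X = {}" "n > 0"
  shows "cocycles (bicliques W) n \<subseteq> (coboundaries (bicliques W) n :: ('v set \<Rightarrow> 'k::field) set)"
proof (cases "W = {}")
  case True
  hence "bicliques W = {{}}" by (auto simp: bicliques_def)
  thus ?thesis using assms(2) by (auto simp: coboundaries_def)
next
  case False
  then obtain x where "x \<in> W" by blast
  with assms(1) have "insert x T \<in> bicliques W" if "T \<in> bicliques W" for T
    using that unfolding bicliques_def by auto
  thus ?thesis by (rule cone_acyclic)
qed

lemma sign_cancel:
  fixes a b c d y z :: "'r::comm_ring_1"
  assumes "a * b = - (c * d)" and "a * (b * y) + c * (d * z) = 0"
  shows "c * (d * (z - y)) = 0"
proof -
  have "a * (b * y) = - (c * d) * y" using assms(1) by (simp flip: mult.assoc)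
  with assms(2) show ?thesis by (simp add: right_diff_distrib mult.assoc)
qed

text \<open>Each side spans a simplex, so subtracting a coboundary makes the cocycle vanish at the pairs
  inside one side. The cocycle condition at triples then says that its signed values at edges with a
  common vertex agree, which means that they come from a locally constant function.\<close>

lemma cocycle_normal_form:
  fixes \<chi> :: "'v set \<Rightarrow> 'k::field"
  assumes \<chi>: "\<chi> \<in> cocycles (bicliques W) 2"
  shows "\<exists>p. locally_constant W p \<and> \<chi> - edge_cochain p \<in> coboundaries (bicliques W) 2"
proof -
  have "\<chi> \<in> coboundaries (bicliques (W \<inter> X)) 2"
    using \<chi> cocycles_mono[OF bicliques_mono, of "W \<inter> X" W] side_acyclic[of "W \<inter> X" 2, where 'k='k]
    by auto
  then obtain \<alpha> where \<alpha>: "\<And>T. T \<in> bicliques (W \<inter> X) \<Longrightarrow> card T = 2 \<Longrightarrow> \<chi> T = codiff \<alpha> T"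
    by (auto simp: coboundaries_def)
  have "\<chi> \<in> coboundaries (bicliques (W - X)) 2"
    using \<chi> cocycles_mono[OF bicliques_mono, of "W - X" W] side_acyclic[of "W - X" 2, where 'k='k]
    by auto
  then obtain \<beta> where \<beta>: "\<And>T. T \<in> bicliques (W - X) \<Longrightarrow> card T = 2 \<Longrightarrow> \<chi> T = codiff \<beta> T"
    by (auto simp: coboundaries_def)
  define \<gamma> where "\<gamma> T = (if T \<subseteq> X then \<alpha> T else \<beta> T)" for T
  define \<xi> where "\<xi> = \<chi> - codiff \<gamma>"
  have XX: "\<xi> {u, v} = 0" if "u \<in> W" "v \<in> W" "u \<in> X" "v \<in> X" "u \<noteq> v" for u v
  proof -
    have "\<chi> {u, v} = codiff \<alpha> {u, v}" using that by (intro \<alpha>) (auto simp: bicliques_def)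
    thus ?thesis using that by (simp add: \<xi>_def codiff_pair \<gamma>_def)
  qed
  have YY: "\<xi> {u, v} = 0" if "u \<in> W" "v \<in> W" "u \<notin> X" "v \<notin> X" "u \<noteq> v" for u v
  proof -
    have "\<chi> {u, v} = codiff \<beta> {u, v}" using that by (intro \<beta>) (auto simp: bicliques_def)
    thus ?thesis using that by (simp add: \<xi>_def codiff_pair \<gamma>_def)
  qed
  have triangle: "psgn u {u, v, w} * \<xi> {v, w} + psgn v {u, v, w} * \<xi> {u, w} + psgn w {u, v, w} * \<xi> {u, v} = 0"
    if "{u, v, w} \<in> bicliques W" "u \<noteq> v" "u \<noteq> w" "v \<noteq> w" for u v w
  proof -
    have "codiff \<chi> {u, v, w} = 0" using that by (intro cocyclesD[OF \<chi>]) auto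
    hence "codiff \<xi> {u, v, w} = 0" by (simp add: \<xi>_def codiff_minus)
    moreover have "{u, v, w} - {u} = {v, w}" "{u, v, w} - {v} = {u, w}" "{u, v, w} - {w} = {u, v}"
      using that by auto
    ultimately show ?thesis using that by (simp add: kdiff_def add.assoc)
  qed
  define e where "e u v = psgn u {u, v} * \<xi> {u, v}" for u v
  have eX: "e x y = e x' y" if "x \<in> X" "x' \<in> X" "{x, x', y} \<subseteq> W" "adj x y" "adj x' y" for x x' y
  proof (cases "x = x'")
    case False
    have y: "y \<notin> X" using that adj_sides by blast
    hence ne: "x \<noteq> y" "x' \<noteq> y" using that by auto
    define T where "T = {x, x', y}"
    have "psgn x T * \<xi> {x', y} + psgn x' T * \<xi> {x, y} + psgn y T * \<xi> {x, x'} = 0"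
      unfolding T_def using that y False ne by (intro triangle) (auto simp: bicliques_def)
    hence "psgn x T * (psgn x' {x', y} * e x' y) + psgn x' T * (psgn x {x, y} * e x y) = 0"
      using XX[of x x'] that False by (simp add: e_def)
    moreover have "psgn x T * psgn x' {x', y} = - (psgn x' T * psgn x {x, y} :: 'k)"
    proof -
      have "T - {x} = {x', y}" "T - {x'} = {x, y}" using False ne by (auto simp: T_def)
      thus ?thesis using psgn_anticommute[of x T x', where 'r='k] False by (simp add: T_def)
    qed
    ultimately have "psgn x' T * (psgn x {x, y} * (e x y - e x' y)) = 0"
      by (intro sign_cancel)
    thus ?thesis by simp
  qed simp
  have eY: "e x y = e x y'" if "x \<in> X" "{x, y, y'} \<subseteq> W" "adj x y" "adj x y'" for x y y'
  proof (cases "y = y'")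
    case False
    have y: "y \<notin> X" "y' \<notin> X" using that adj_sides by blast+
    hence ne: "x \<noteq> y" "x \<noteq> y'" using that by auto
    define T where "T = {x, y, y'}"
    have "psgn x T * \<xi> {y, y'} + psgn y T * \<xi> {x, y'} + psgn y' T * \<xi> {x, y} = 0"
      unfolding T_def using that y False ne by (intro triangle) (auto simp: bicliques_def)
    hence "psgn y T * (psgn x {x, y'} * e x y') + psgn y' T * (psgn x {x, y} * e x y) = 0"
      using YY[of y y'] that y False by (simp add: e_def)
    moreover have "T - {x} = {y, y'}" "T - {y} = {x, y'}" "T - {y'} = {x, y}"
      using False ne by (auto simp: T_def)
    hence "psgn y T * psgn x {x, y'} = - (psgn x T * psgn y {y, y'} :: 'k)"
      and "psgn y' T * psgn x {x, y} = - (psgn x T * psgn y' {y, y'} :: 'k)"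
      using psgn_anticommute[of y T x, where 'r='k] psgn_anticommute[of y' T x, where 'r='k] ne
      by (simp_all add: T_def)
    hence "psgn y T * psgn x {x, y'} = - (psgn y' T * psgn x {x, y} :: 'k)"
      using psgn_pair[OF False, where 'r='k] by simp
    ultimately have "psgn y' T * (psgn x {x, y} * (e x y - e x y')) = 0"
      by (intro sign_cancel)
    thus ?thesis by simp
  qed simp
  define nb where "nb v = (SOME u. u \<in> W \<and> adj v u)" for v
  have nb: "nb v \<in> W" "adj v (nb v)" if "u \<in> W" "adj v u" for u v
    using someI[of "\<lambda>u. u \<in> W \<and> adj v u" u] that unfolding nb_def by auto
  define p where "p v = (if v \<in> X then e v (nb v) else e (nb v) v)" for v
  have pe: "p x = e x y" "p y = e x y" if "x \<in> X" "x \<in> W" "y \<in> W" "adj x y" for x y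
  proof -
    show "p x = e x y" using eY[of x "nb x" y] nb[of y x] that by (simp add: p_def)
    have "y \<notin> X" using that adj_sides by blast
    moreover have "adj y x" using that adj_sym by blast
    moreover have "nb y \<in> X" using adj_sides nb(2)[OF _ \<open>adj y x\<close>] \<open>y \<notin> X\<close> that by blast
    ultimately show "p y = e x y" using eX[of "nb y" x y] nb[of x y] that adj_sym by (auto simp: p_def)
  qed
  have "p u = p v" if "u \<in> W" "v \<in> W" "adj u v" for u v
  proof (cases "u \<in> X")
    case True with pe[of u v] that show ?thesis by simp
  next
    case False
    with that have "v \<in> X" "adj v u" using adj_sides adj_sym by blast+
    with pe[of v u] that show ?thesis by simp
  qed
  hence "locally_constant W p" by (simp add: locally_constant_def)
  moreover have "\<chi> - edge_cochain p \<in> coboundaries (bicliques W) 2"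
  proof (rule coboundariesI[of _ _ _ \<gamma>])
    fix T assume T: "T \<in> bicliques W" "card T = 2"
    then obtain u v where uv: "T = {u, v}" "u \<noteq> v" by (meson card_2_iff)
    have W: "u \<in> W" "v \<in> W" using T uv by (auto simp: bicliques_def)
    have XY: "\<xi> {x, y} = edge_cochain p {x, y}" if "x \<in> X" "y \<notin> X" "{x, y} = T" for x y
    proof -
      have "adj x y" "x \<in> W" "y \<in> W" using T that by (auto simp: bicliques_def)
      thus ?thesis using pe(2)[of x y] edge_cochain_XY[of x y p] that by (simp add: e_def)
    qed
    have "\<xi> T = edge_cochain p T"
      using XX[OF W _ _ uv(2)] YY[OF W _ _ uv(2)] XY[of u v] XY[of v u] uv
        edge_cochain_X[of u v p] edge_cochain_Y[of u v p]
      by (cases "u \<in> X"; cases "v \<in> X") (auto simp: insert_commute)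
    thus "(\<chi> - edge_cochain p) T = codiff \<gamma> T" by (simp add: \<xi>_def diff_eq_eq add.commute)
  qed
  ultimately show ?thesis by blast
qed

end

section \<open>Induced cycles\<close>

lemma is_cycle_enumerated:
  fixes c :: "nat \<Rightarrow> 'v"
  assumes N: "4 \<le> N" and inj: "inj_on c {..<N}" and B: "\<And>e. e \<in> B \<Longrightarrow> card e = 2"
    and adj: "\<And>i j. i < N \<Longrightarrow> j < N \<Longrightarrow> {c i, c j} \<in> B \<longleftrightarrow>
      j = Suc i \<or> i = Suc j \<or> (i = 0 \<and> j = N - 1) \<or> (j = 0 \<and> i = N - 1)"
  shows "is_cycle N (c ` {..<N}) (induced_edges B (c ` {..<N}))"
proof -
  define V where "V = c ` {..<N}"
  define r where "r u v \<longleftrightarrow> {u, v} \<in> induced_edges B V" for u v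
  have r: "r (c i) (c j) \<longleftrightarrow> j = Suc i \<or> i = Suc j \<or> (i = 0 \<and> j = N - 1) \<or> (j = 0 \<and> i = N - 1)"
    if "i < N" "j < N" for i j
    using adj[OF that] that by (auto simp: r_def induced_edges_def V_def)
  have to: "r\<^sup>*\<^sup>* (c 0) (c i)" if "i < N" for i
    using that
  proof (induction i)
    case (Suc i)
    hence "r\<^sup>*\<^sup>* (c 0) (c i)" "r (c i) (c (Suc i))" using r[of i "Suc i"] by auto
    thus ?case by (rule rtranclp.rtrancl_into_rtrancl)
  qed simp
  have from': "r\<^sup>*\<^sup>* (c i) (c 0)" if "i < N" for i
    using that
  proof (induction i)
    case (Suc i)
    hence "r (c (Suc i)) (c i)" "r\<^sup>*\<^sup>* (c i) (c 0)" using r[of "Suc i" i] by auto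
    thus ?case by (rule converse_rtranclp_into_rtranclp)
  qed simp
  have "r\<^sup>*\<^sup>* u v" if "u \<in> V" "v \<in> V" for u v
  proof -
    from that obtain i j where "i < N" "j < N" "u = c i" "v = c j" by (auto simp: V_def)
    thus ?thesis using rtranclp_trans[OF from'[of i] to[of j]] by simp
  qed
  moreover have "V \<noteq> {}" using N by (auto simp: V_def lessThan_empty_iff)
  moreover have "r = (\<lambda>u v. {u, v} \<in> induced_edges B V)" by (simp add: r_def fun_eq_iff)
  ultimately have "connected_graph V (induced_edges B V)"
    by (simp add: connected_graph_def)
  moreover have "vertex_degree (induced_edges B V) v = 2" if "v \<in> V" for v
  proof -
    from that obtain i where i: "i < N" "v = c i" by (auto simp: V_def)
    define next_i prev_i where "next_i = (if Suc i = N then 0 else Suc i)"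
      and "prev_i = (if i = 0 then N - 1 else i - 1)"
    have np: "next_i < N" "prev_i < N" "next_i \<noteq> prev_i"
      using i N by (auto simp: next_i_def prev_i_def split: if_splits)
    have eq: "(j = Suc i \<or> i = Suc j \<or> (i = 0 \<and> j = N - 1) \<or> (j = 0 \<and> i = N - 1)) \<longleftrightarrow>
        j = next_i \<or> j = prev_i" if "j < N" for j
      using i that N unfolding next_i_def prev_i_def by auto
    have "{e \<in> induced_edges B V. v \<in> e} = {{v, c next_i}, {v, c prev_i}}"
    proof (intro equalityI subsetI)
      fix e assume "e \<in> {e \<in> induced_edges B V. v \<in> e}"
      hence e: "e \<in> B" "e \<subseteq> V" "v \<in> e" by (auto simp: induced_edges_def)
      obtain a b where "e = {a, b}" using B[OF e(1)] by (auto simp: card_2_iff)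
      then obtain w where w: "e = {v, w}" using e(3) by blast
      then obtain j where j: "j < N" "w = c j" using e(2) by (auto simp: V_def)
      have "{c i, c j} \<in> B" using e(1) w j i by simp
      hence "j = next_i \<or> j = prev_i" using adj[OF i(1) j(1)] eq[OF j(1)] by simp
      thus "e \<in> {{v, c next_i}, {v, c prev_i}}" using w j by auto
    next
      fix e assume "e \<in> {{v, c next_i}, {v, c prev_i}}"
      hence "e = {c i, c next_i} \<or> e = {c i, c prev_i}" using i by simp
      then obtain j where j: "j < N" "j = next_i \<or> j = prev_i" "e = {c i, c j}"
        using np by blast
      hence "{c i, c j} \<in> B" using adj[OF i(1) j(1)] eq[OF j(1)] by simp
      thus "e \<in> {e \<in> induced_edges B V. v \<in> e}"
        using i j by (auto simp: induced_edges_def V_def)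
    qed
    moreover have "c next_i \<noteq> c prev_i" using inj np by (auto dest: inj_onD)
    hence "{v, c next_i} \<noteq> {v, c prev_i}" by (auto simp: doubleton_eq_iff)
    ultimately show ?thesis by (simp add: vertex_degree_def)
  qed
  moreover have "card V = N" using inj by (simp add: V_def card_image)
  moreover have "simple_graph V (induced_edges B V)"
    using B by (auto simp: simple_graph_def V_def induced_edges_def)
  ultimately show ?thesis using N by (simp add: is_cycle_def V_def)
qed

context bipartite_graph
begin

lemma edge_card: "e \<in> B \<Longrightarrow> card e = 2"
  using bipartite by (fastforce simp: card_2_iff)

text \<open>A chordless path of which exactly the end points are adjacent to \<open>x\<close> closes up to an induced
  cycle. Position 0 of the cycle is \<open>x\<close>, and position \<open>i + 1\<close> is \<open>q i\<close>.\<close>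

lemma shortest_path_cycle:
  fixes q :: "nat \<Rightarrow> 'v"
  assumes x: "x \<in> X" and n: "4 \<le> n"
    and path: "\<And>i. i < n \<Longrightarrow> adj (q i) (q (Suc i))"
    and avoid: "\<And>i. i \<le> n \<Longrightarrow> q i \<noteq> x"
    and distinct: "\<And>i j. i < j \<Longrightarrow> j \<le> n \<Longrightarrow> q i \<noteq> q j"
    and chordless: "\<And>i j. i < j \<Longrightarrow> j \<le> n \<Longrightarrow> adj (q i) (q j) \<Longrightarrow> j = Suc i"
    and ends: "\<And>i. i \<le> n \<Longrightarrow> adj x (q i) \<longleftrightarrow> i = 0 \<or> i = n"
  shows "insert x (q ` {..n}) \<in> induced_cycles B (n + 2)"
proof -
  define c where "c i = (case i of 0 \<Rightarrow> x | Suc i \<Rightarrow> q i)" for i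
  have image: "c ` {..<n + 2} = insert x (q ` {..n})"
  proof -
    have "{..<n + 2} = insert 0 (Suc ` {..n})"
      by (simp add: lessThan_Suc_atMost atMost_Suc_eq_insert_0)
    thus ?thesis by (simp add: c_def image_image)
  qed
  have qadj: "adj (q a) (q b) \<longleftrightarrow> b = Suc a \<or> a = Suc b" if "a \<le> n" "b \<le> n" for a b
  proof -
    consider "a < b" | "b < a" | "a = b" by linarith
    thus ?thesis
    proof cases
      case 1 thus ?thesis using chordless[of a b] path[of a] that by auto
    next
      case 2 thus ?thesis using chordless[of b a] path[of b] adj_sym[of "q a" "q b"] that by auto
    next
      case 3 thus ?thesis using adj_sides[of "q a" "q a"] by auto
    qed
  qed
  have "is_cycle (n + 2) (c ` {..<n + 2}) (induced_edges B (c ` {..<n + 2}))"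
  proof (rule is_cycle_enumerated)
    show "inj_on c {..<n + 2}"
    proof (rule linorder_inj_onI')
      fix i j assume "i \<in> {..<n + 2}" "j \<in> {..<n + 2}" and ij: "i < j"
      then obtain b where b: "j = Suc b" "b \<le> n" by (cases j) auto
      show "c i \<noteq> c j"
      proof (cases i)
        case 0 thus ?thesis using avoid[of b] b by (auto simp: c_def)
      next
        case (Suc a) thus ?thesis using distinct[of a b] b ij by (auto simp: c_def)
      qed
    qed
    fix i j assume ij: "i < n + 2" "j < n + 2"
    have "adj (c i) (c j) \<longleftrightarrow> j = Suc i \<or> i = Suc j \<or> (i = 0 \<and> j = n + 2 - 1) \<or> (j = 0 \<and> i = n + 2 - 1)"
    proof (cases i; cases j)
      assume "i = 0" "j = 0"
      thus ?thesis using adj_sides[of x x] by (auto simp: c_def)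
    next
      fix b assume "i = 0" "j = Suc b"
      thus ?thesis using ends[of b] ij by (auto simp: c_def)
    next
      fix a assume "i = Suc a" "j = 0"
      thus ?thesis using ends[of a] adj_sym[of x "q a"] ij by (auto simp: c_def)
    next
      fix a b assume "i = Suc a" "j = Suc b"
      thus ?thesis using qadj[of a b] ij by (auto simp: c_def)
    qed
    thus "{c i, c j} \<in> B \<longleftrightarrow>
        j = Suc i \<or> i = Suc j \<or> (i = 0 \<and> j = n + 2 - 1) \<or> (j = 0 \<and> i = n + 2 - 1)"
      by (simp add: adj_def)
  qed (use n edge_card in auto)
  thus ?thesis unfolding image by (simp add: induced_cycles_def)
qed

definition steps :: "'v set \<Rightarrow> ('v \<times> 'v) set" where
  "steps W = {(u, v). u \<in> W \<and> v \<in> W \<and> adj u v}"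

text \<open>Among all paths in \<open>W - {x}\<close> between neighbours of \<open>x\<close> with different values of \<open>p\<close> take one of
  minimal length \<open>n\<close>. It has no chords, and no interior vertex is adjacent to \<open>x\<close>, as one of the two
  parts of the path would still join different values. The length is even as the graph is
  bipartite, and it is not 2, because the middle vertex of a path of length 2 belongs to the link,
  where \<open>p\<close> is locally constant. So \<open>n\<close> is at least 4, and with \<open>x\<close> there is an induced cycle of
  length \<open>n + 2\<close>.\<close>

lemma equal_on_component:
  assumes no_cycles: "\<And>l C. 6 \<le> l \<Longrightarrow> C \<in> induced_cycles B l \<Longrightarrow> \<not> C \<subseteq> W"
    and x: "x \<in> W" "x \<in> X" and p: "locally_constant (link_set W x) p"
    and y: "y \<in> W" "adj x y" and y': "y' \<in> W" "adj x y'"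
    and reach: "(y, y') \<in> (steps (W - {x}))\<^sup>*"
  shows "p y = p y'"
proof (rule ccontr)
  assume neq: "p y \<noteq> p y'"
  define R where "R = steps (W - {x})"
  define good where "good n q \<longleftrightarrow> (\<forall>i<n. (q i, q (Suc i)) \<in> R) \<and> q 0 \<in> W \<and> adj x (q 0) \<and>
    q n \<in> W \<and> adj x (q n) \<and> p (q 0) \<noteq> p (q n)" for n and q :: "nat \<Rightarrow> 'v"
  obtain m where "(y, y') \<in> R ^^ m" using reach by (auto simp: R_def dest: rtrancl_imp_relpow)
  then obtain q0 where "q0 0 = y" "q0 m = y'" "\<forall>i<m. (q0 i, q0 (Suc i)) \<in> R"
    by (auto simp: relpow_fun_conv)
  hence "good m q0" using y y' neq by (simp add: good_def)
  then obtain n where "\<exists>q. good n q" and least: "\<And>m q. good m q \<Longrightarrow> n \<le> m"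
    using ex_has_least_nat[of "\<lambda>n. \<exists>q. good n q" m id] by auto
  then obtain q where q: "good n q" by blast
  have path: "(q i, q (Suc i)) \<in> R" if "i < n" for i using q that by (simp add: good_def)
  have ends: "q 0 \<in> W" "adj x (q 0)" "q n \<in> W" "adj x (q n)" "p (q 0) \<noteq> p (q n)"
    using q by (auto simp: good_def)
  have n0: "n > 0" using ends(5) by (cases n) auto
  have inW: "q i \<in> W - {x}" if i: "i \<le> n" for i
  proof (cases "i < n")
    case True thus ?thesis using path[of i] by (auto simp: R_def steps_def)
  next
    case False
    then obtain k where "i = Suc k" "k < n" using i n0 by (cases n) auto
    thus ?thesis using path[of k] by (auto simp: R_def steps_def)
  qed
  have padj: "adj (q i) (q (Suc i))" if "i < n" for i
    using path[OF that] by (simp add: R_def steps_def)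
  \<comment> \<open>Skipping the part of the path from \<open>i\<close> to \<open>j\<close> would give a shorter path of the same kind.\<close>
  have shortcut: False if ij: "i < j" "j \<le> n" and q': "\<And>k. k < i \<Longrightarrow> q' k = q k"
    "\<And>k. i \<le> k \<Longrightarrow> q' k = q (k + (j - i))" "q' 0 = q 0" "i > 0 \<longrightarrow> (q' (i - 1), q' i) \<in> R" for i j q'
  proof -
    have "good (n - (j - i)) q'"
      unfolding good_def
    proof (intro conjI allI impI)
      have "q' (n - (j - i)) = q n" using ij q'(2)[of "n - (j - i)"] by simp
      thus "q' (n - (j - i)) \<in> W" "adj x (q' (n - (j - i)))" "p (q' 0) \<noteq> p (q' (n - (j - i)))"
        using ends q'(3) by simp_all
      show "q' 0 \<in> W" "adj x (q' 0)" using ends q'(3) by simp_all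
      fix k assume k: "k < n - (j - i)"
      consider "Suc k < i" | "Suc k = i" | "i \<le> k" by linarith
      thus "(q' k, q' (Suc k)) \<in> R"
      proof cases
        case 1 thus ?thesis using q'(1)[of k] q'(1)[of "Suc k"] path[of k] ij by simp
      next
        case 2 thus ?thesis using q'(4) by auto
      next
        case 3 thus ?thesis using q'(2)[of k] q'(2)[of "Suc k"] path[of "k + (j - i)"] k by simp
      qed
    qed
    from least[OF this] ij show False by simp
  qed
  have distinct: "q i \<noteq> q j" if ij: "i < j" "j \<le> n" for i j
  proof
    assume eq: "q i = q j"
    define q' where "q' k = (if k < i then q k else q (k + (j - i)))" for k
    have "i > 0 \<longrightarrow> (q' (i - 1), q' i) \<in> R"
      using path[of "i - 1"] ij eq by (auto simp: q'_def)
    thus False using ij eq by (intro shortcut[of i j q']) (auto simp: q'_def)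
  qed
  have chordless: "j = Suc i" if ij: "i < j" "j \<le> n" "adj (q i) (q j)" for i j
  proof (rule ccontr)
    assume "j \<noteq> Suc i"
    hence less: "Suc i < j" using ij by simp
    define q' where "q' k = (if k < Suc i then q k else q (k + (j - Suc i)))" for k
    have "(q i, q j) \<in> R" using inW[of i] inW[of j] ij by (auto simp: R_def steps_def)
    thus False using less ij by (intro shortcut[of "Suc i" j q']) (auto simp: q'_def)
  qed
  have interior: "\<not> adj x (q i)" if i: "0 < i" "i < n" for i
  proof
    assume xi: "adj x (q i)"
    have W: "q i \<in> W" using inW[of i] i by simp
    show False
    proof (cases "p (q 0) = p (q i)")
      case False
      hence "good i q" using W xi ends path i by (auto simp: good_def)
      from least[OF this] i show False by simp
    next
      case True
      hence "good (n - i) (\<lambda>k. q (k + i))"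
        using W xi ends path i by (auto simp: good_def)
      from least[OF this] i show False by simp
    qed
  qed
  have parity: "q i \<in> X \<longleftrightarrow> odd i" if "i \<le> n" for i
    using that
  proof (induction i)
    case 0 show ?case using adj_sides[OF ends(2)] x by simp
  next
    case (Suc i) thus ?case using adj_sides[OF padj[of i]] by simp
  qed
  have "even n" using parity[of n] adj_sides[OF ends(4)] x by simp
  moreover have "n \<noteq> 2"
  proof
    assume n2: "n = 2"
    have a: "adj (q 0) (q 1)" "adj (q 1) (q 2)" using padj[of 0] padj[of 1] n2 by (auto simp: numeral_2_eq_2)
    have "q 1 \<in> X" using parity[of 1] n2 by simp
    hence "{q 0, q 1, q 2} \<subseteq> link_set W x"
      using inW[of 0] inW[of 1] inW[of 2] ends x n2 by (auto simp: link_set_def)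
    hence "p (q 0) = p (q 2)" using a p unfolding locally_constant_def by (metis insert_subset)
    thus False using ends(5) n2 by simp
  qed
  ultimately have n4: "4 \<le> n" using n0 by presburger
  have "insert x (q ` {..n}) \<in> induced_cycles B (n + 2)"
  proof (rule shortest_path_cycle)
    show "adj x (q i) \<longleftrightarrow> i = 0 \<or> i = n" if "i \<le> n" for i
      using interior[of i] ends that by (cases "i = 0 \<or> i = n") auto
  qed (use x n4 padj inW distinct chordless in auto)
  moreover have "insert x (q ` {..n}) \<subseteq> W" using inW x by auto
  moreover have "6 \<le> n + 2" using n4 by simp
  ultimately show False using no_cycles by blast
qed

text \<open>A vertex joined in \<open>W - {x}\<close> to a neighbour of \<open>x\<close> gets the value of this neighbour. On components
  that contain no neighbour of \<open>x\<close> the choice is from the empty set, hence constant as well.\<close>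

lemma locally_constant_extension:
  fixes p :: "'v \<Rightarrow> 'k"
  assumes no_cycles: "\<And>l C. 6 \<le> l \<Longrightarrow> C \<in> induced_cycles B l \<Longrightarrow> \<not> C \<subseteq> W"
    and x: "x \<in> W" "x \<in> X" and p: "locally_constant (link_set W x) p"
  shows "\<exists>p'. locally_constant (W - {x}) p' \<and> (\<forall>y\<in>link_set W x - X. p' y = p y)"
proof -
  define R where "R = steps (W - {x})"
  define S where "S v = {y \<in> W. adj x y \<and> (y, v) \<in> R\<^sup>*}" for v
  define p' where "p' v = p (SOME y. y \<in> S v)" for v
  have "S u = S v" if "u \<in> W - {x}" "v \<in> W - {x}" "adj u v" for u v
  proof -
    have "(u, v) \<in> R" "(v, u) \<in> R" using that adj_sym by (auto simp: R_def steps_def)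
    thus ?thesis unfolding S_def by (auto intro: rtrancl_into_rtrancl)
  qed
  hence "locally_constant (W - {x}) p'" unfolding locally_constant_def p'_def by metis
  moreover have "p' y = p y" if y: "y \<in> link_set W x - X" for y
  proof -
    have y': "y \<in> W" "adj x y" using y x by (auto simp: link_set_def)
    hence "y \<in> S y" by (simp add: S_def)
    hence "(SOME z. z \<in> S y) \<in> S y" by (rule someI)
    hence z: "(SOME z. z \<in> S y) \<in> W" "adj x (SOME z. z \<in> S y)" "((SOME z. z \<in> S y), y) \<in> R\<^sup>*"
      by (auto simp: S_def)
    show ?thesis unfolding p'_def
      using equal_on_component[OF no_cycles x p z(1,2) y' z(3)[unfolded R_def]] by simp
  qed
  ultimately show ?thesis by blast
qed

section \<open>Vanishing\<close>

text \<open>By the normal form, extending locally constant functions from the link of \<open>x\<close> to its deletion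
  amounts to surjectivity of the restriction map in the exact sequence.\<close>

theorem acyclic_without_cycles:
  assumes "\<And>l C. 6 \<le> l \<Longrightarrow> C \<in> induced_cycles B l \<Longrightarrow> \<not> C \<subseteq> W"
  shows "cocycles (bicliques W) 3 \<subseteq> (coboundaries (bicliques W) 3 :: ('v set \<Rightarrow> 'k::field) set)"
  using assms
proof (induction "card W" arbitrary: W rule: less_induct)
  case less
  note no_cycles = less.prems
  show ?case
  proof (cases "W \<inter> X = {}")
    case True thus ?thesis by (intro side_acyclic) auto
  next
    case False
    then obtain x where x: "x \<in> W" "x \<in> X" by blast
    have "cocycles (bicliques W) (Suc 2) \<subseteq> (coboundaries (bicliques W) (Suc 2) :: ('v set \<Rightarrow> 'k) set)"
    proof (rule acyclic_by_vertex[where x = x])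
      show "T - {v} \<in> bicliques W" if "T \<in> bicliques W" for T v
        using that by (rule bicliques_closed)
      have "card (W - {x}) < card W" using x by (intro psubset_card_mono) auto
      from less.hyps[OF this] no_cycles
      show "cocycles (deletion x (bicliques W)) (Suc 2) \<subseteq>
          (coboundaries (deletion x (bicliques W)) (Suc 2) :: ('v set \<Rightarrow> 'k) set)"
        by (simp add: deletion_bicliques numeral_3_eq_3) blast
      fix \<chi> :: "'v set \<Rightarrow> 'k" assume "\<chi> \<in> cocycles (link x (bicliques W)) 2"
      hence "\<chi> \<in> cocycles (bicliques (link_set W x)) 2" by (simp add: link_bicliques[OF x(1)])
      from cocycle_normal_form[OF this] obtain p where p: "locally_constant (link_set W x) p"
        "\<chi> - edge_cochain p \<in> coboundaries (bicliques (link_set W x)) 2" by blast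
      have "\<exists>p'. locally_constant (W - {x}) p' \<and> (\<forall>y\<in>link_set W x - X. p' y = p y)"
        by (rule locally_constant_extension[OF _ x p(1)]) (rule no_cycles)
      then obtain p' where
        p': "locally_constant (W - {x}) p'" "\<And>y. y \<in> link_set W x - X \<Longrightarrow> p' y = p y" by blast
      obtain \<psi> where \<psi>: "\<And>T. T \<in> bicliques (link_set W x) \<Longrightarrow> card T = 2 \<Longrightarrow>
          (\<chi> - edge_cochain p) T = codiff \<psi> T"
        using p(2) by (auto simp: coboundaries_def)
      have "\<chi> - edge_cochain p' \<in> coboundaries (bicliques (link_set W x)) 2"
      proof (rule coboundariesI)
        fix T assume T: "T \<in> bicliques (link_set W x)" "card T = 2"
        have "edge_cochain p' T = edge_cochain p T"
          using T p'(2) by (intro edge_cochain_cong) (auto simp: bicliques_def)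
        thus "(\<chi> - edge_cochain p') T = codiff \<psi> T" using \<psi>[OF T] by simp
      qed
      moreover have "edge_cochain p' \<in> cocycles (deletion x (bicliques W)) 2"
        unfolding deletion_bicliques by (rule edge_cochain_cocycle[OF p'(1)])
      ultimately show "\<exists>\<chi>'\<in>cocycles (deletion x (bicliques W)) 2.
          \<chi> - \<chi>' \<in> coboundaries (link x (bicliques W)) 2"
        unfolding link_bicliques[OF x(1)] by blast
    qed
    thus ?thesis by (simp add: numeral_3_eq_3)
  qed
qed

lemma induced_cycle_card: "C \<in> induced_cycles B l \<Longrightarrow> card C = l"
  by (simp add: induced_cycles_def is_cycle_def)

text \<open>At \<open>n = 3\<close> an induced cycle of length at least 6 inside \<open>W\<close> has at least \<open>t \<ge> card W\<close> vertices, so it is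
  all of \<open>W\<close>. For larger \<open>n\<close>, a vertex whose link omits only the vertex itself is the apex of a cone.
  Any other link misses at least two elements of \<open>W\<close>; it then satisfies the bound for \<open>n - 1\<close> with
  one to spare, so that it is not the exceptional cycle.\<close>

theorem acyclic_small:
  assumes t: "\<And>l. 6 \<le> l \<Longrightarrow> induced_cycles B l \<noteq> {} \<Longrightarrow> t \<le> l"
    and "3 \<le> n" "card W + 3 \<le> t + n" "\<not> (n = 3 \<and> W \<in> induced_cycles B t)"
  shows "cocycles (bicliques W) n \<subseteq> (coboundaries (bicliques W) n :: ('v set \<Rightarrow> 'k::field) set)"
  using assms(2-)
proof (induction n arbitrary: W rule: dec_induct)
  case base
  show ?case
  proof (rule acyclic_without_cycles)
    fix l C assume C: "6 \<le> l" "C \<in> induced_cycles B l"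
    show "\<not> C \<subseteq> W"
    proof
      assume "C \<subseteq> W"
      moreover have "t \<le> l" using t[OF C(1)] C(2) by blast
      ultimately have "C = W" using base induced_cycle_card[OF C(2)] by (intro card_seteq) auto
      moreover from this have "l = t" using base induced_cycle_card[OF C(2)] \<open>t \<le> l\<close> by simp
      ultimately show False using base C(2) by simp
    qed
  qed
next
  case (step n)
  have "card W + 3 \<le> t + Suc n" by fact
  thus ?case
  proof (induction "card W" arbitrary: W rule: less_induct)
    case less
    show ?case
    proof (cases "W = {}")
      case True thus ?thesis by (intro side_acyclic) auto
    next
      case False
      then obtain x where x: "x \<in> W" by blast
      show ?thesis
      proof (cases "link_set W x = W - {x}")
        case True
        have "insert x T \<in> bicliques W" if T: "T \<in> bicliques W" for T
        proof -
          have "(v \<in> X \<longleftrightarrow> x \<in> X) \<or> adj x v" if "v \<in> W - {x}" for v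
            using that unfolding True[symmetric] by (simp add: link_set_def)
          thus ?thesis using T x adj_sym[of x] by (cases "x \<in> X") (auto simp: bicliques_def)
        qed
        thus ?thesis by (rule cone_acyclic)
      next
        case False
        hence "card (link_set W x) < card (W - {x})"
          using link_set_subset[of W x] by (intro psubset_card_mono) auto
        hence small: "card (link_set W x) + 2 \<le> card W" using x by simp
        have cyc: "\<not> (n = 3 \<and> link_set W x \<in> induced_cycles B t)"
          using small less.prems induced_cycle_card[of "link_set W x" t] by auto
        show ?thesis
        proof (rule acyclic_by_vertex[where x = x])
          show "T - {v} \<in> bicliques W" if "T \<in> bicliques W" for T v
            using that by (rule bicliques_closed)
          show "cocycles (deletion x (bicliques W)) (Suc n) \<subseteq>
              (coboundaries (deletion x (bicliques W)) (Suc n) :: ('v set \<Rightarrow> 'k) set)"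
            unfolding deletion_bicliques
          proof (rule less.hyps)
            show "card (W - {x}) < card W" using x by (intro psubset_card_mono) auto
            thus "card (W - {x}) + 3 \<le> t + Suc n" using less.prems by simp
          qed
          fix \<chi> :: "'v set \<Rightarrow> 'k" assume "\<chi> \<in> cocycles (link x (bicliques W)) n"
          hence "\<chi> \<in> coboundaries (link x (bicliques W)) n"
            using step.IH[of "link_set W x"] small less.prems cyc
            unfolding link_bicliques[OF x] by auto
          thus "\<exists>\<chi>'\<in>cocycles (deletion x (bicliques W)) n. \<chi> - \<chi>' \<in> coboundaries (link x (bicliques W)) n"
            by (intro bexI[of _ 0]) (auto simp: cocycles_def kdiff_def)
        qed
      qed
    qed
  qed
qed

section \<open>The cohomology of an induced cycle\<close>

lemma join_cocycle:
  assumes closed: "\<And>T v. T \<in> \<Delta> \<Longrightarrow> T - {v} \<in> \<Delta>"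
    and \<chi>: "\<chi> \<in> cocycles (link x \<Delta>) n"
  shows "join x \<chi> \<in> cocycles \<Delta> (Suc n)"
  unfolding cocycles_def
proof (intro CollectI ballI impI)
  fix T assume T: "T \<in> \<Delta>" "card T = Suc (Suc n)"
  have "codiff \<chi> (T - {x}) = 0" if "x \<in> T"
    using T that by (intro cocyclesD[OF \<chi>] linkI) auto
  thus "codiff (join x \<chi>) T = 0" by (simp add: codiff_join join_def)
qed

lemma coboundaries_cong:
  "(\<And>T. T \<in> \<Delta> \<Longrightarrow> card T = n \<Longrightarrow> \<phi> T = \<psi> T) \<Longrightarrow> \<phi> \<in> coboundaries \<Delta> n \<longleftrightarrow> \<psi> \<in> coboundaries \<Delta> n"
  by (simp add: coboundaries_def)

lemma coboundaries_mono: "\<Delta>' \<subseteq> \<Delta> \<Longrightarrow> coboundaries \<Delta> n \<subseteq> coboundaries \<Delta>' n"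
  by (auto simp: coboundaries_def)

lemma cycle_neighbours:
  assumes W: "W \<in> induced_cycles B t" and v: "v \<in> W"
  shows "card {w \<in> W. adj v w} = 2"
proof -
  have bij: "bij_betw (\<lambda>w. {v, w}) {w \<in> W. adj v w} {e \<in> induced_edges B W. v \<in> e}"
    unfolding bij_betw_def
  proof
    show "inj_on (\<lambda>w. {v, w}) {w \<in> W. adj v w}" by (auto simp: inj_on_def doubleton_eq_iff)
    show "(\<lambda>w. {v, w}) ` {w \<in> W. adj v w} = {e \<in> induced_edges B W. v \<in> e}"
    proof (intro equalityI subsetI)
      fix e assume "e \<in> {e \<in> induced_edges B W. v \<in> e}"
      hence e: "e \<in> B" "e \<subseteq> W" "v \<in> e" by (auto simp: induced_edges_def)
      obtain a b where "e = {a, b}" using edge_card[OF e(1)] by (auto simp: card_2_iff)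
      then obtain w where "e = {v, w}" using e(3) by blast
      thus "e \<in> (\<lambda>w. {v, w}) ` {w \<in> W. adj v w}" using e by (auto simp: adj_def)
    qed (use v in \<open>auto simp: induced_edges_def adj_def\<close>)
  qed
  have "card {e \<in> induced_edges B W. v \<in> e} = 2"
    using W v by (simp add: induced_cycles_def is_cycle_def vertex_degree_def)
  thus ?thesis using bij_betw_same_card[OF bij] by simp
qed

text \<open>Deleting a vertex of a cycle leaves a connected graph. A locally constant function separating
  the two neighbours of the deleted vertex would cut out a set of vertices in which all degrees are
  even except one, and counting its edges from both sides of the bipartition is contradictory.\<close>

lemma cycle_minus_vertex_connected:
  assumes W: "W \<in> induced_cycles B t" and x: "x \<in> W" "x \<in> X"
    and nb: "{w \<in> W. adj x w} = {y1, y2}" "y1 \<noteq> y2"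
    and p: "locally_constant (W - {x}) p"
  shows "p y1 = p y2"
proof (rule ccontr)
  assume neq: "p y1 \<noteq> p y2"
  have y: "y1 \<in> W" "y2 \<in> W" "adj x y1" "adj x y2" using nb by auto
  hence yX: "y1 \<notin> X" "y2 \<notin> X" using adj_sides x by blast+
  \<comment> \<open>\<open>K\<close> contains all neighbours of its vertices except \<open>x\<close>, and \<open>y1\<close> is its only neighbour of \<open>x\<close>.\<close>
  define K where "K = {v \<in> W - {x}. p v = p y1}"
  have closed: "v \<in> K" if "u \<in> K" "v \<in> W" "v \<noteq> x" "adj u v" for u v
    using p that unfolding K_def locally_constant_def by auto
  have K: "K \<subseteq> W" "x \<notin> K" "y1 \<in> K" "y2 \<notin> K" using y neq x yX by (auto simp: K_def)
  have left: "card {v \<in> K - X. adj u v} = 2" if u: "u \<in> K \<inter> X" for u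
  proof -
    have "{v \<in> K - X. adj u v} = {v \<in> W. adj u v}"
    proof (intro equalityI subsetI)
      fix v assume "v \<in> {v \<in> W. adj u v}"
      moreover from this have "v \<notin> X" using adj_sides u by blast
      moreover from this have "v \<noteq> x" using x by blast
      ultimately show "v \<in> {v \<in> K - X. adj u v}" using u closed by blast
    qed (use K in auto)
    thus ?thesis using cycle_neighbours[OF W, of u] u K by auto
  qed
  have right: "card {u \<in> K \<inter> X. adj u v} = (if v = y1 then 1 else 2)" if v: "v \<in> K - X" for v
  proof -
    have eq: "{u \<in> K \<inter> X. adj u v} = {u \<in> W. adj v u} - {x}"
    proof (intro equalityI subsetI)
      fix u assume "u \<in> {u \<in> W. adj v u} - {x}"
      moreover from this have "u \<in> X" using adj_sides v by blast
      ultimately show "u \<in> {u \<in> K \<inter> X. adj u v}" using v closed adj_sym by blast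
    next
      fix u assume "u \<in> {u \<in> K \<inter> X. adj u v}"
      thus "u \<in> {u \<in> W. adj v u} - {x}" using K adj_sym by blast
    qed
    have card2: "card {u \<in> W. adj v u} = 2" using cycle_neighbours[OF W, of v] v K by auto
    show ?thesis
    proof (cases "v = y1")
      case True
      hence "x \<in> {u \<in> W. adj v u}" using x y adj_sym by blast
      thus ?thesis using True card2 unfolding eq by simp
    next
      case False
      have "\<not> adj v x"
      proof
        assume "adj v x"
        hence "v \<in> {w \<in> W. adj x w}" using adj_sym v K by blast
        thus False using nb False v K by auto
      qed
      hence "{u \<in> W. adj v u} - {x} = {u \<in> W. adj v u}" by auto
      thus ?thesis using False card2 unfolding eq by simp
    qed
  qed
  have "(\<Sum>u\<in>K \<inter> X. card {v \<in> K - X. adj u v}) = (\<Sum>v\<in>K - X. if v = y1 then 1 else 2)"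
    using right by (intro sum_multicount_gen) auto
  moreover have "(\<Sum>u\<in>K \<inter> X. card {v \<in> K - X. adj u v}) = 2 * card (K \<inter> X)"
    using left by simp
  moreover have "(\<Sum>v\<in>K - X. if v = y1 then 1 else 2) = 1 + 2 * card (K - X - {y1})"
  proof -
    have "(\<Sum>v\<in>K - X. if v = y1 then 1 else (2::nat)) =
        1 + (\<Sum>v\<in>K - X - {y1}. if v = y1 then 1 else 2)"
      using K yX by (subst sum.remove[of _ y1]) auto
    also have "(\<Sum>v\<in>K - X - {y1}. if v = y1 then 1 else (2::nat)) = (\<Sum>v\<in>K - X - {y1}. 2)"
      by (intro sum.cong) auto
    finally show ?thesis by simp
  qed
  ultimately show False by presburger
qed

text \<open>Let \<open>y1\<close> and \<open>y2\<close> be the neighbours of a vertex \<open>x\<close> of the cycle. In the link of \<open>x\<close> they lie in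
  different components, since the cycle has more than four vertices; so modulo constants every
  locally constant function on the link is a multiple of the one that takes the value 1 on the
  component of \<open>y1\<close> and 0 elsewhere, up to its values at isolated vertices of \<open>X\<close>. This function does
  not extend to the deletion, which is connected.\<close>

theorem qdim_cycle:
  assumes W: "W \<in> induced_cycles B t" and t: "6 \<le> t"
    and least: "\<And>l. 6 \<le> l \<Longrightarrow> induced_cycles B l \<noteq> {} \<Longrightarrow> t \<le> l"
  shows "qdim (cochain_scale :: 'k::field \<Rightarrow> _) (cocycles (bicliques W) 3) (coboundaries (bicliques W) 3) 1"
proof -
  have cardW: "card W = t" using W by (rule induced_cycle_card)
  then obtain v where v: "v \<in> W" using t by fastforce
  have nonempty: "\<exists>w\<in>W. adj v w" if "v \<in> W" for v
  proof -
    have "{w \<in> W. adj v w} \<noteq> {}" using cycle_neighbours[OF W that] by force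
    thus ?thesis by blast
  qed
  obtain x where x: "x \<in> W" "x \<in> X" using v nonempty[OF v] adj_sides by blast
  obtain y1 y2 where nb: "{w \<in> W. adj x w} = {y1, y2}" "y1 \<noteq> y2"
    using cycle_neighbours[OF W x(1)] by (meson card_2_iff)
  have y: "y1 \<in> W" "y2 \<in> W" "adj x y1" "adj x y2" using nb by auto
  hence yX: "y1 \<notin> X" "y2 \<notin> X" using adj_sides x by blast+
  have other: "\<exists>z\<in>W. adj y z \<and> z \<noteq> x" if "y \<in> W" for y
  proof (rule ccontr)
    assume "\<not> ?thesis"
    hence "{w \<in> W. adj y w} \<subseteq> {x}" by blast
    from card_mono[OF _ this] cycle_neighbours[OF W that] show False by simp
  qed
  \<comment> \<open>Otherwise the four vertices form a connected component.\<close>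
  have no_common: False if z: "z \<in> W" "z \<noteq> x" "adj z y1" "adj z y2" for z
  proof -
    have zX: "z \<in> X" using adj_sides z yX by blast
    define S where "S = {x, z, y1, y2}"
    have two: "w \<in> {a, b}" if "{a, b} \<subseteq> {w \<in> W. adj u w}" "a \<noteq> b" "u \<in> W" "w \<in> W" "adj u w" for u w a b
    proof -
      have "{a, b} = {w \<in> W. adj u w}"
        using cycle_neighbours[OF W that(3)] that(1,2) by (intro card_seteq) auto
      thus ?thesis using that by blast
    qed
    have closed: "w \<in> S" if "u \<in> S" "w \<in> W" "adj u w" for u w
    proof -
      have sym: "adj y1 x" "adj y2 x" "adj y1 z" "adj y2 z" using z y adj_sym by blast+
      from that(1) consider "u = x" | "u = z" | "u = y1" | "u = y2" by (auto simp: S_def)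
      thus ?thesis
      proof cases
        case 1 thus ?thesis using that nb by (auto simp: S_def)
      next
        case 2 thus ?thesis using two[of y1 y2 z w] that z y nb(2) by (auto simp: S_def)
      next
        case 3 thus ?thesis using two[of x z y1 w] that z y x sym by (auto simp: S_def)
      next
        case 4 thus ?thesis using two[of x z y2 w] that z y x sym by (auto simp: S_def)
      qed
    qed
    have "W \<subseteq> S"
    proof
      fix w assume "w \<in> W"
      hence "(\<lambda>u v. {u, v} \<in> induced_edges B W)\<^sup>*\<^sup>* x w"
        using W x(1) by (auto simp: induced_cycles_def is_cycle_def connected_graph_def)
      thus "w \<in> S"
      proof (induction rule: rtranclp_induct)
        case base show ?case by (simp add: S_def)
      next
        case (step u v) thus ?case using closed[of u v] by (auto simp: induced_edges_def adj_def)
      qed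
    qed
    hence "card W \<le> card S" by (intro card_mono) auto
    also have "card S \<le> 4" by (simp add: S_def card_insert_if)
    finally show False using cardW t by simp
  qed
  define L where "L = link_set W x"
  have L: "v \<in> L \<longleftrightarrow> v \<in> W \<and> v \<noteq> x \<and> (v \<in> X \<or> v = y1 \<or> v = y2)" for v
    using nb x by (auto simp: L_def link_set_def)
  have LW: "L \<subseteq> W - {x}" unfolding L_def by (rule link_set_subset)
  have link: "link x (bicliques W) = bicliques L"
    unfolding L_def by (rule link_bicliques[OF x(1)])
  define p1 :: "'v \<Rightarrow> 'k" where "p1 v = (if v = y1 \<or> adj y1 v then 1 else 0)" for v
  have p1y: "p1 y1 = 1" "p1 y2 = 0" using nb(2) adj_sides yX by (auto simp: p1_def)
  have p1_XY: "p1 u = p1 v" if "u \<in> L" "v \<in> L" "adj u v" "u \<in> X" for u v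
  proof -
    have "v \<notin> X" using adj_sides that by blast
    hence "v = y1 \<or> v = y2" using that(2) L[of v] by blast
    then consider "v = y1" | "v = y2" by blast
    thus ?thesis
    proof cases
      case 1 thus ?thesis using that p1y adj_sym by (auto simp: p1_def)
    next
      case 2
      have "\<not> adj y1 u" using no_common[of u] that 2 L adj_sym by blast
      moreover have "u \<noteq> y1" using that yX by blast
      ultimately show ?thesis using p1y 2 by (simp add: p1_def)
    qed
  qed
  have "p1 u = p1 v" if "u \<in> L" "v \<in> L" "adj u v" for u v
  proof (cases "u \<in> X")
    case False
    hence "p1 v = p1 u" using that adj_sides adj_sym by (intro p1_XY) blast+
    thus ?thesis by simp
  qed (use p1_XY that in blast)
  hence p1: "locally_constant L p1" by (simp add: locally_constant_def)
  define b where "b = join x (edge_cochain p1)"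
  have acyclic: "cocycles (bicliques (W - {x})) 3 \<subseteq> (coboundaries (bicliques (W - {x})) 3 :: ('v set \<Rightarrow> 'k) set)"
  proof (rule acyclic_without_cycles)
    fix l C assume C: "6 \<le> l" "C \<in> induced_cycles B l"
    have "card (W - {x}) < t" using cardW x t by simp
    moreover have "t \<le> card C" using least[OF C(1)] C(2) induced_cycle_card[OF C(2)] by blast
    ultimately show "\<not> C \<subseteq> W - {x}" using card_mono[of "W - {x}" C] by auto
  qed
  have "qbasis cochain_scale (cocycles (bicliques W) (Suc 2)) (coboundaries (bicliques W) (Suc 2)) {0} (\<lambda>_. b)"
    unfolding qbasis_def
  proof (intro conjI ballI allI impI)
    have "edge_cochain p1 \<in> cocycles (link x (bicliques W)) 2"
      unfolding link by (rule edge_cochain_cocycle[OF p1])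
    thus "b \<in> cocycles (bicliques W) (Suc 2)"
      unfolding b_def by (intro join_cocycle bicliques_closed)
  next
    fix \<phi> :: "'v set \<Rightarrow> 'k" assume \<phi>: "\<phi> \<in> cocycles (bicliques W) (Suc 2)"
    have "\<exists>\<chi>. \<chi> \<in> cocycles (link x (bicliques W)) 2 \<and> \<phi> - join x \<chi> \<in> coboundaries (bicliques W) (Suc 2)"
      using acyclic
      by (intro cocycle_reduction[OF bicliques_closed _ \<phi>]) (simp_all add: deletion_bicliques numeral_3_eq_3)
    then obtain \<chi> where \<chi>: "\<chi> \<in> cocycles (bicliques L) 2"
      "\<phi> - join x \<chi> \<in> coboundaries (bicliques W) (Suc 2)" unfolding link by blast
    from cocycle_normal_form[OF \<chi>(1)] obtain p where
      p: "\<chi> - edge_cochain p \<in> coboundaries (bicliques L) 2" by blast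
    define a where "a = p y1 - p y2"
    have "edge_cochain p T = edge_cochain (\<lambda>v. a * p1 v + p y2) T" if "T \<in> bicliques L" for T
    proof (rule edge_cochain_cong)
      fix y assume "y \<in> T - X"
      hence "y = y1 \<or> y = y2" using that L by (auto simp: bicliques_def)
      thus "p y = a * p1 y + p y2" using p1y by (auto simp: a_def)
    qed
    hence eq: "(\<chi> - edge_cochain p + edge_cochain (\<lambda>_. p y2)) T = (\<chi> - cochain_scale a (edge_cochain p1)) T"
      if "T \<in> bicliques L" for T using that by (simp add: edge_cochain_linear)
    have "\<chi> - edge_cochain p + edge_cochain (\<lambda>_. p y2) \<in> coboundaries (bicliques L) 2"
      by (intro coboundaries_add p edge_cochain_const)
    also have "?this \<longleftrightarrow> \<chi> - cochain_scale a (edge_cochain p1) \<in> coboundaries (bicliques L) 2"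
      by (rule coboundaries_cong) (rule eq)
    finally have "\<chi> - cochain_scale a (edge_cochain p1) \<in> coboundaries (link x (bicliques W)) 2"
      unfolding link .
    from coboundaries_add[OF \<chi>(2) join_coboundary_link[OF this]]
    have "\<phi> - cochain_scale a b \<in> coboundaries (bicliques W) (Suc 2)"
      by (simp add: join_diff join_scale b_def)
    thus "\<exists>c. \<phi> - (\<Sum>j\<in>{0::nat}. cochain_scale (c j) b) \<in> coboundaries (bicliques W) (Suc 2)"
      by (intro exI[of _ "\<lambda>_. a"]) simp
  next
    fix c :: "nat \<Rightarrow> 'k" and j assume j: "j \<in> {0::nat}"
      and "(\<Sum>j\<in>{0}. cochain_scale (c j) b) \<in> coboundaries (bicliques W) (Suc 2)"
    hence "join x (cochain_scale (c 0) (edge_cochain p1)) \<in> coboundaries (bicliques W) (Suc 2)"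
      by (simp add: b_def join_scale)
    from join_coboundaryD[OF this] obtain \<chi> where \<chi>: "\<chi> \<in> cocycles (bicliques (W - {x})) 2"
      "cochain_scale (c 0) (edge_cochain p1) - \<chi> \<in> coboundaries (bicliques L) 2"
      unfolding link deletion_bicliques by blast
    from cocycle_normal_form[OF \<chi>(1)] obtain p where p: "locally_constant (W - {x}) p"
      "\<chi> - edge_cochain p \<in> coboundaries (bicliques (W - {x})) 2" by blast
    have "\<chi> - edge_cochain p \<in> coboundaries (bicliques L) 2"
      using p(2) coboundaries_mono[OF bicliques_mono[OF LW]] by blast
    from coboundaries_add[OF \<chi>(2) this]
    have "cochain_scale (c 0) (edge_cochain p1) - edge_cochain p \<in> coboundaries (bicliques L) 2" by simp
    also have "cochain_scale (c 0) (edge_cochain p1) - edge_cochain p = edge_cochain (\<lambda>v. c 0 * p1 v - p v)"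
      using edge_cochain_linear[of "c 0" p1 "\<lambda>v. - p v"] edge_cochain_linear[of "- 1" p "\<lambda>v. 0"]
      by (simp add: fun_eq_iff cochain_scale_def edge_cochain_def vertex_cochain_def kdiff_def)
    finally have cob: "edge_cochain (\<lambda>v. c 0 * p1 v - p v) \<in> coboundaries (bicliques L) 2" .
    obtain x1 x2 where x12: "x1 \<in> W" "adj y1 x1" "x1 \<noteq> x" "x2 \<in> W" "adj y2 x2" "x2 \<noteq> x"
      using other y by blast
    have "c 0 * p1 y1 - p y1 = c 0 * p1 y2 - p y2"
    proof (rule edge_cochain_coboundaryD[OF cob])
      show "adj x1 y1" "adj x2 y2" "x1 \<in> X" "x2 \<in> X" using x12 adj_sym adj_sides yX by blast+
      thus "{x1, x2, y1, y2} \<subseteq> L" using x12 L y x yX by auto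
    qed
    moreover have "p y1 = p y2" by (rule cycle_minus_vertex_connected[OF W x nb p(1)])
    ultimately show "c j = 0" using p1y j by simp
  qed simp
  hence "qbasis cochain_scale (cocycles (bicliques W) 3) (coboundaries (bicliques W) 3) {0} (\<lambda>_. b)"
    by (simp add: numeral_3_eq_3)
  thus ?thesis unfolding qdim_def by (intro exI[of _ "{0}"] exI[of _ "\<lambda>_. b"]) simp
qed

end

section \<open>Betti numbers as dimensions of Koszul homology\<close>

text \<open>Members of \<open>free_module\<close> vanish beyond the rank, which arbitrary coefficient vectors need not
  do.\<close>

definition trunc :: "nat \<Rightarrow> (nat \<Rightarrow> 'a::zero) \<Rightarrow> nat \<Rightarrow> 'a" where
  "trunc n x k = (if k < n then x k else 0)"

lemma sum_trunc: "(\<Sum>l<n. trunc n x l * f l) = (\<Sum>l<n. x l * (f l :: 'a::comm_ring_1))"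
  by (intro sum.cong) (auto simp: trunc_def)

lemma trunc_free_module: "trunc (rk F i) x \<in> free_module F i"
  by (simp add: free_module_def trunc_def)

lemma resolves_kernel_aug:
  assumes "resolves F I"
  shows "(\<Sum>l<rk F 0. x l * aug F l) = 0 \<longleftrightarrow>
    (\<exists>y. \<forall>l<rk F 0. x l = (\<Sum>j<rk F (Suc 0). y j * mat F 0 l j))"
proof -
  have eq: "{x \<in> free_module F 0. aug_map F x = 0} = diff_map F 0 ` free_module F (Suc 0)"
    using assms by (simp add: resolves_def)
  show ?thesis
  proof
    assume "(\<Sum>l<rk F 0. x l * aug F l) = 0"
    hence "trunc (rk F 0) x \<in> {x \<in> free_module F 0. aug_map F x = 0}"
      by (simp add: trunc_free_module aug_map_def sum_trunc)
    then obtain y where "trunc (rk F 0) x = diff_map F 0 y" unfolding eq by blast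
    hence y: "trunc (rk F 0) x l = diff_map F 0 y l" for l by simp
    have "x l = (\<Sum>j<rk F (Suc 0). y j * mat F 0 l j)" if "l < rk F 0" for l
      using y[of l] that by (simp add: trunc_def diff_map_def)
    thus "\<exists>y. \<forall>l<rk F 0. x l = (\<Sum>j<rk F (Suc 0). y j * mat F 0 l j)" by blast
  next
    assume "\<exists>y. \<forall>l<rk F 0. x l = (\<Sum>j<rk F (Suc 0). y j * mat F 0 l j)"
    then obtain y where y: "\<And>l. l < rk F 0 \<Longrightarrow> x l = (\<Sum>j<rk F (Suc 0). y j * mat F 0 l j)" by blast
    have "diff_map F 0 (trunc (rk F (Suc 0)) y) \<in> {x \<in> free_module F 0. aug_map F x = 0}"
      unfolding eq by (intro imageI trunc_free_module)
    hence "aug_map F (diff_map F 0 (trunc (rk F (Suc 0)) y)) = 0" by simp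
    thus "(\<Sum>l<rk F 0. x l * aug F l) = 0"
      by (simp add: aug_map_def diff_map_def sum_trunc y)
  qed
qed

lemma resolves_kernel_diff:
  assumes "resolves F I"
  shows "(\<forall>k<rk F i. (\<Sum>l<rk F (Suc i). x l * mat F i k l) = 0) \<longleftrightarrow>
    (\<exists>y. \<forall>l<rk F (Suc i). x l = (\<Sum>j<rk F (Suc (Suc i)). y j * mat F (Suc i) l j))"
proof -
  have eq: "{x \<in> free_module F (Suc i). diff_map F i x = (\<lambda>_. 0)} =
      diff_map F (Suc i) ` free_module F (Suc (Suc i))"
    using assms by (simp add: resolves_def)
  have dm: "diff_map F i (trunc (rk F (Suc i)) x) = (\<lambda>_. 0) \<longleftrightarrow>
      (\<forall>k<rk F i. (\<Sum>l<rk F (Suc i). x l * mat F i k l) = 0)" for x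
    unfolding diff_map_def fun_eq_iff sum_trunc by auto
  show ?thesis
  proof
    assume "\<forall>k<rk F i. (\<Sum>l<rk F (Suc i). x l * mat F i k l) = 0"
    hence "trunc (rk F (Suc i)) x \<in> {x \<in> free_module F (Suc i). diff_map F i x = (\<lambda>_. 0)}"
      by (simp add: trunc_free_module dm)
    then obtain y where "trunc (rk F (Suc i)) x = diff_map F (Suc i) y" unfolding eq by blast
    hence y: "trunc (rk F (Suc i)) x l = diff_map F (Suc i) y l" for l by simp
    have "x l = (\<Sum>j<rk F (Suc (Suc i)). y j * mat F (Suc i) l j)" if "l < rk F (Suc i)" for l
      using y[of l] that by (simp add: trunc_def diff_map_def)
    thus "\<exists>y. \<forall>l<rk F (Suc i). x l = (\<Sum>j<rk F (Suc (Suc i)). y j * mat F (Suc i) l j)" by blast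
  next
    assume "\<exists>y. \<forall>l<rk F (Suc i). x l = (\<Sum>j<rk F (Suc (Suc i)). y j * mat F (Suc i) l j)"
    then obtain y where y: "\<And>l. l < rk F (Suc i) \<Longrightarrow> x l = (\<Sum>j<rk F (Suc (Suc i)). y j * mat F (Suc i) l j)"
      by blast
    have "trunc (rk F (Suc i)) x = diff_map F (Suc i) (trunc (rk F (Suc (Suc i))) y)"
      unfolding diff_map_def sum_trunc fun_eq_iff using y by (simp add: trunc_def)
    also have "\<dots> \<in> {x \<in> free_module F (Suc i). diff_map F i x = (\<lambda>_. 0)}"
      unfolding eq by (intro imageI trunc_free_module)
    finally show "\<forall>k<rk F i. (\<Sum>l<rk F (Suc i). x l * mat F i k l) = 0" by (simp add: dm)
  qed
qed

text \<open>The resolution together with its augmentation: position 0 is the ring, with shift 0, and position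
  \<open>i + 1\<close> is \<open>F i\<close>.\<close>

definition aug_rank :: "(('v, 'k::field) mpoly, 'g) free_complex \<Rightarrow> nat \<Rightarrow> nat" where
  "aug_rank F i = (case i of 0 \<Rightarrow> 1 | Suc j \<Rightarrow> rk F j)"

definition aug_shift :: "(('v, 'k::field) mpoly, 'g::zero) free_complex \<Rightarrow> nat \<Rightarrow> nat \<Rightarrow> 'g" where
  "aug_shift F i k = (case i of 0 \<Rightarrow> 0 | Suc j \<Rightarrow> shift F j k)"

definition aug_mat :: "(('v, 'k::field) mpoly, 'g) free_complex \<Rightarrow> nat \<Rightarrow> nat \<Rightarrow> nat \<Rightarrow> ('v, 'k) mpoly" where
  "aug_mat F i k l = (if k < aug_rank F i then case i of 0 \<Rightarrow> aug F l | Suc j \<Rightarrow> mat F j k l else 0)"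

lemma graded_exact_complex_resolution:
  assumes \<gamma>: "grading \<gamma>" and idx: "vertex_order idx"
    and F: "minimal_graded_free_resolution \<gamma> I F"
  shows "graded_exact_complex idx \<gamma> (aug_rank F) (aug_shift F) (aug_mat F)"
proof -
  interpret grading \<gamma> by (fact \<gamma>)
  interpret vertex_order idx by (fact idx)
  have res: "resolves F I" and gr: "graded_complex \<gamma> F" and min: "minimal_complex F"
    using F by (auto simp: minimal_graded_free_resolution_def)
  show ?thesis
  proof
    fix k i l m
    assume "k < aug_rank F i" "l < aug_rank F (Suc i)" "m \<in> keys (aug_mat F i k l)"
    thus "\<gamma> m + aug_shift F i k = aug_shift F (Suc i) l"
      using gr by (cases i) (auto simp: graded_complex_def aug_rank_def aug_shift_def aug_mat_def)
  next
    fix i k and x :: "nat \<Rightarrow> ('a, 'c) mpoly"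
    show "(\<Sum>l<aug_rank F (Suc i). (\<Sum>j<aug_rank F (Suc (Suc i)). x j * aug_mat F (Suc i) l j) * aug_mat F i k l) = 0"
    proof (cases "k < aug_rank F i")
      case k: True
      define y where "y l = (\<Sum>j<aug_rank F (Suc (Suc i)). x j * aug_mat F (Suc i) l j)" for l
      have "(\<Sum>l<aug_rank F (Suc i). y l * aug_mat F i k l) = 0"
      proof (cases i)
        case 0
        have "(\<Sum>l<rk F 0. y l * aug F l) = 0"
          unfolding resolves_kernel_aug[OF res]
          by (intro exI[of _ x]) (simp add: y_def 0 aug_rank_def aug_mat_def)
        thus ?thesis using k 0 by (simp add: aug_rank_def aug_mat_def)
      next
        case (Suc j)
        have "\<forall>k<rk F j. (\<Sum>l<rk F (Suc j). y l * mat F j k l) = 0"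
          unfolding resolves_kernel_diff[OF res]
          by (intro exI[of _ x]) (simp add: y_def Suc aug_rank_def aug_mat_def)
        thus ?thesis using k Suc by (simp add: aug_rank_def aug_mat_def)
      qed
      thus ?thesis by (simp add: y_def)
    qed (simp add: aug_mat_def)
  next
    fix i and x :: "nat \<Rightarrow> ('a, 'c) mpoly"
    assume x: "\<And>k. k < aug_rank F i \<Longrightarrow> (\<Sum>l<aug_rank F (Suc i). x l * aug_mat F i k l) = 0"
    show "\<exists>y. \<forall>l<aug_rank F (Suc i). x l = (\<Sum>j<aug_rank F (Suc (Suc i)). y j * aug_mat F (Suc i) l j)"
    proof (cases i)
      case 0
      have "(\<Sum>l<rk F 0. x l * aug F l) = 0"
        using x[of 0] 0 by (simp add: aug_rank_def aug_mat_def)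
      thus ?thesis unfolding resolves_kernel_aug[OF res] 0 by (simp add: aug_rank_def aug_mat_def)
    next
      case (Suc j)
      have "\<forall>k<rk F j. (\<Sum>l<rk F (Suc j). x l * mat F j k l) = 0"
        using x Suc by (simp add: aug_rank_def aug_mat_def)
      thus ?thesis unfolding resolves_kernel_diff[OF res] Suc by (simp add: aug_rank_def aug_mat_def)
    qed
  next
    fix k i l assume "k < aug_rank F (Suc i)" "l < aug_rank F (Suc (Suc i))"
    thus "coeff (aug_mat F (Suc i) k l) 0 = 0"
      using min by (auto simp: minimal_complex_def aug_rank_def aug_mat_def)
  qed
qed

text \<open>Degree \<open>g\<close> of the Koszul complex with coefficients in the ideal \<open>I\<close>; only the coordinate 0
  carries a polynomial, to match the chains with coefficients in a free module of rank one.\<close>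

definition ideal_chains ::
  "(('v::finite \<Rightarrow>\<^sub>0 nat) \<Rightarrow> 'g) \<Rightarrow> ('v, 'k::field) mpoly set \<Rightarrow> 'g::comm_monoid_add \<Rightarrow> nat \<Rightarrow>
    ('v set \<Rightarrow> nat \<Rightarrow> ('v, 'k) mpoly) set" where
  "ideal_chains \<gamma> I g j = {c. (\<forall>T. \<forall>k\<ge>1. c T k = 0) \<and> (\<forall>T. c T 0 \<in> I) \<and>
     (\<forall>T. \<forall>a\<in>keys (c T 0). card (- T) = j \<and> \<gamma> (a + indicator_exp (- T)) = g)}"

context vertex_order
begin

definition koszul_cycles where
  "koszul_cycles \<gamma> I g j = {z \<in> ideal_chains \<gamma> I g j. koszul z = 0}"

definition koszul_boundaries where
  "koszul_boundaries \<gamma> I g j = koszul ` ideal_chains \<gamma> I g (Suc j)"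

text \<open>The Koszul homology of the ideal does not refer to the resolution, so the numbers of generators are
  the same for all minimal resolutions.\<close>

lemma resolution_koszul:
  fixes F :: "(('v, 'k::field) mpoly, 'g::comm_monoid_add) free_complex"
  assumes \<gamma>: "grading \<gamma>" and F: "minimal_graded_free_resolution \<gamma> I F"
  shows "lin_subspace poly_scale (koszul_boundaries \<gamma> I g i)"
    and "qdim poly_scale (koszul_cycles \<gamma> I g i) (koszul_boundaries \<gamma> I g i)
      (card {k. k < rk F i \<and> shift F i k = g})"
proof -
  interpret C: graded_exact_complex idx \<gamma> "aug_rank F" "aug_shift F" "aug_mat F"
    by (rule graded_exact_complex_resolution[OF \<gamma> vertex_order_axioms F])
  have image: "aug_map F ` free_module F 0 = I"
    using F by (simp add: minimal_graded_free_resolution_def resolves_def)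
  have chains: "C.res_map 0 ` C.chains g (Suc 0) j = ideal_chains \<gamma> I g j" for j
  proof (intro equalityI subsetI)
    fix c assume "c \<in> C.res_map 0 ` C.chains g (Suc 0) j"
    then obtain w where w: "w \<in> C.chains g (Suc 0) j" "c = C.res_map 0 w" by blast
    have "c \<in> C.chains g 0 j" using w by (simp add: C.res_map_chains)
    moreover have "c T 0 \<in> I" for T
    proof -
      have "c T 0 = aug_map F (trunc (rk F 0) (w T))"
        by (simp add: w(2) C.res_map_def aug_map_def sum_trunc aug_rank_def aug_mat_def)
      thus ?thesis using image trunc_free_module by blast
    qed
    ultimately show "c \<in> ideal_chains \<gamma> I g j"
      by (auto simp: ideal_chains_def C.chains_def aug_rank_def aug_shift_def)
  next
    fix c assume c: "c \<in> ideal_chains \<gamma> I g j"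
    have c0: "c T k = 0" if "k \<noteq> 0" for T k using c that by (simp add: ideal_chains_def)
    have "c \<in> C.chains g 0 j"
    proof (rule C.chainsI)
      fix T k a assume a: "a \<in> keys (c T k)"
      hence "k = 0" using c0[of k T] by (cases "k = 0") auto
      thus "card (- T) = j" "\<gamma> (a + indicator_exp (- T)) + aug_shift F 0 k = g"
        using c a by (auto simp: ideal_chains_def aug_shift_def)
    qed (simp add: aug_rank_def c0)
    moreover have "\<exists>y. c T 0 = (\<Sum>l<rk F 0. y l * aug F l)" for T
      using c image by (auto simp: ideal_chains_def aug_map_def image_iff)
    then obtain y where "\<And>T. c T 0 = (\<Sum>l<rk F 0. y T l * aug F l)" by metis
    hence "c T k = (\<Sum>l<aug_rank F (Suc 0). y T l * aug_mat F 0 k l)" if "k < aug_rank F 0" for T k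
      using that by (simp add: aug_rank_def aug_mat_def)
    ultimately show "c \<in> C.res_map 0 ` C.chains g (Suc 0) j"
      using C.res_map_lift[of c g 0 j y] by blast
  qed
  have eq: "C.cycles g 0 i = koszul_cycles \<gamma> I g i" "C.boundaries g 0 i = koszul_boundaries \<gamma> I g i"
    by (simp_all add: C.cycles_def C.boundaries_def koszul_cycles_def koszul_boundaries_def chains)
  show "lin_subspace poly_scale (koszul_boundaries \<gamma> I g i)"
    using C.lin_subspace_boundaries[of g 0 i] by (simp add: eq)
  show "qdim poly_scale (koszul_cycles \<gamma> I g i) (koszul_boundaries \<gamma> I g i)
      (card {k. k < rk F i \<and> shift F i k = g})"
    using C.betti_koszul[of g i] by (simp add: eq aug_rank_def aug_shift_def)
qed

lemma betti_eqI:
  assumes \<gamma>: "grading \<gamma>" and F: "minimal_graded_free_resolution \<gamma> I F"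
    and d: "qdim poly_scale (koszul_cycles \<gamma> I g i) (koszul_boundaries \<gamma> I g i) d"
  shows "betti \<gamma> I i g = d"
proof -
  define F' where "F' = (SOME F. minimal_graded_free_resolution \<gamma> I F)"
  have F': "minimal_graded_free_resolution \<gamma> I F'" unfolding F'_def using F by (rule someI)
  from qdim_unique[OF vector_space_poly_scale resolution_koszul[OF \<gamma> F'] d]
  show ?thesis by (simp add: betti_def F'_def)
qed

end

lemma betti_eq_card:
  assumes \<gamma>: "grading \<gamma>" and F: "minimal_graded_free_resolution \<gamma> I F"
  shows "betti \<gamma> I i g = card {k. k < rk F i \<and> shift F i k = g}"
proof -
  obtain idx :: "'a \<Rightarrow> nat" where "inj idx" using finite_imp_inj_to_nat_seg[of "UNIV :: 'a set"] by auto
  then interpret vertex_order idx by unfold_locales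
  show ?thesis by (rule betti_eqI[OF \<gamma> F resolution_koszul(2)[OF \<gamma> F]])
qed

lemma total_degree_add: "total_degree (a + b) = total_degree a + total_degree b"
  by (simp add: total_degree_def lookup_add sum.distrib)

lemma grading_total_degree: "grading total_degree"
  by unfold_locales (simp_all add: total_degree_add, simp add: total_degree_def)

lemma grading_id: "grading (\<lambda>m. m)"
  by unfold_locales simp_all

text \<open>The multigraded resolution is minimal for the total degree as well.\<close>

lemma graded_betti_eq_card:
  assumes F: "minimal_graded_free_resolution (\<lambda>m. m) I F"
  shows "graded_betti I i j = card {k. k < rk F i \<and> total_degree (shift F i k) = j}"
proof -
  define F' where "F' = \<lparr>rk = rk F, shift = (\<lambda>i k. total_degree (shift F i k)), aug = aug F, mat = mat F\<rparr>"
  have "free_module F' = free_module F" "aug_map F' = aug_map F" "diff_map F' = diff_map F"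
    by (simp_all add: F'_def fun_eq_iff free_module_def aug_map_def diff_map_def)
  hence "resolves F' I" using F by (simp add: minimal_graded_free_resolution_def resolves_def)
  moreover have "graded_complex total_degree F'"
    using F by (auto simp: minimal_graded_free_resolution_def graded_complex_def F'_def
        simp flip: total_degree_add)
  moreover have "minimal_complex F'"
    using F by (simp add: minimal_graded_free_resolution_def minimal_complex_def F'_def)
  ultimately have "minimal_graded_free_resolution total_degree I F'"
    by (simp add: minimal_graded_free_resolution_def)
  from betti_eq_card[OF grading_total_degree this] show ?thesis
    by (simp add: graded_betti_def F'_def)
qed

section \<open>Koszul homology of a squarefree monomial ideal\<close>

definition independent_sets :: "'v::finite set set \<Rightarrow> 'v set \<Rightarrow> 'v set set" where
  "independent_sets E W = {T. T \<subseteq> W \<and> (\<forall>e\<in>E. \<not> e \<subseteq> T)}"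

lemma covers_edge_indicator: "covers_edge E (indicator_exp T) \<longleftrightarrow> (\<exists>e\<in>E. e \<subseteq> T)"
  by (auto simp: covers_edge_def subset_iff)

context vertex_order
begin

text \<open>Dividing a monomial by \<open>v\<close> preserves membership in a squarefree ideal if \<open>v\<close> still divides the
  quotient. In a multidegree with \<open>v\<close>-exponent at least 2 the homotopy along \<open>v\<close> therefore stays in
  the ideal.\<close>

lemma koszul_nonsquarefree:
  fixes E :: "'v set set"
  assumes E: "simple_graph UNIV E" and v: "2 \<le> coeff m v"
  shows "qdim poly_scale (koszul_cycles (\<lambda>m. m) (edge_ideal E :: ('v, 'k::field) mpoly set) m i)
    (koszul_boundaries (\<lambda>m. m) (edge_ideal E) m i) 0"
proof (rule qdim_0, rule subsetI)
  let ?I = "edge_ideal E :: ('v, 'k) mpoly set"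
  fix z assume "z \<in> koszul_cycles (\<lambda>m. m) ?I m i"
  hence z: "z \<in> ideal_chains (\<lambda>m. m) ?I m i" and cyc: "koszul z = 0" by (auto simp: koszul_cycles_def)
  note iff = edge_ideal_iff[OF E, where 'k='k]
  have zk: "a + indicator_exp (- T) = m" "card (- T) = i" "covers_edge E a"
    if "a \<in> keys (z T 0)" for a T
    using z that by (auto simp: ideal_chains_def iff)
  have "\<exists>u. coeff n u \<noteq> 0" if "n \<noteq> 0" for n :: "'v \<Rightarrow>\<^sub>0 nat"
    using that by (metis poly_mapping_eqI lookup_zero)
  then obtain ch0 where ch0: "\<And>n :: 'v \<Rightarrow>\<^sub>0 nat. n \<noteq> 0 \<Longrightarrow> coeff n (ch0 n) \<noteq> 0" by metis
  \<comment> \<open>The homotopy is only used in multidegree \<open>m\<close>, where it divides by \<open>v\<close>.\<close>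
  define ch where "ch n = (if coeff n v \<noteq> 0 then v else ch0 n)" for n
  have "\<exists>d. (\<forall>T. kdiff variable d T = z T 0) \<and>
     (\<forall>T a. a \<in> keys (d T) \<longrightarrow> (let u = ch (a + indicator_exp (- T)) in
        u \<notin> T \<and> a + var_exp u \<in> keys (z (insert u T) 0)))"
  proof (rule koszul_homotopy)
    show "coeff n (ch n) \<noteq> 0" if "n \<noteq> 0" for n using ch0[OF that] by (simp add: ch_def)
    show "kdiff variable (\<lambda>T. z T 0) T = 0" for T
      using fun_cong[OF fun_cong[OF cyc, of T], of 0] by (simp add: koszul_def)
    have "0 \<notin> keys (z UNIV 0)" using zk(1)[of 0 UNIV] v by (auto simp: indicator_exp_def)
    thus "coeff (z UNIV 0) 0 = 0" by (simp add: in_keys_iff)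
  qed
  then obtain d where d: "\<And>T. kdiff variable d T = z T 0"
    and key: "\<And>T a. a \<in> keys (d T) \<Longrightarrow> (let u = ch (a + indicator_exp (- T)) in
        u \<notin> T \<and> a + var_exp u \<in> keys (z (insert u T) 0))" by blast
  define c where "c T k = (if k = 0 then d T else 0)" for T and k :: nat
  have dk: "card (- T) = Suc i \<and> a + indicator_exp (- T) = m \<and> covers_edge E a"
    if a: "a \<in> keys (d T)" for T a
  proof -
    define u where "u = ch (a + indicator_exp (- T))"
    have u: "u \<notin> T" "a + var_exp u \<in> keys (z (insert u T) 0)" using key[OF a] by (auto simp: u_def Let_def)
    note zk = zk[OF u(2)]
    have m: "a + indicator_exp (- T) = m"
      using zk(1) indicator_exp_Compl_insert[OF u(1)] by (simp add: add_ac)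
    have "u = v" using v by (simp add: u_def m ch_def)
    have "coeff a v \<noteq> 0" using v u(1) unfolding m[symmetric] \<open>u = v\<close> by (auto simp: lookup_add)
    hence "coeff a w \<noteq> 0" if "coeff (a + var_exp u) w \<noteq> 0" for w
      using that \<open>u = v\<close> by (auto simp: lookup_add lookup_single when_def split: if_splits)
    hence "covers_edge E a" using zk(3) unfolding covers_edge_def by blast
    moreover have "- T = insert u (- insert u T)" using u by auto
    hence "card (- T) = Suc i" using zk(2) by (metis card_insert_disjoint finite ComplD insertI1)
    ultimately show ?thesis using m by blast
  qed
  hence "c \<in> ideal_chains (\<lambda>m. m) ?I m (Suc i)" by (auto simp: ideal_chains_def iff c_def)
  moreover have "koszul c = z"
  proof (intro ext)
    fix T and k :: nat show "koszul c T k = z T k"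
    proof (cases "k = 0")
      case True thus ?thesis using d[of T] by (simp add: koszul_def c_def)
    next
      case False thus ?thesis using z by (simp add: koszul_def c_def ideal_chains_def kdiff_def)
    qed
  qed
  ultimately show "z \<in> koszul_boundaries (\<lambda>m. m) ?I m i" by (auto simp: koszul_boundaries_def)
qed

text \<open>In multidegree \<open>indicator_exp W\<close> the coefficient at the basis element with complement \<open>T\<close> is a multiple
  of the monomial supported on \<open>T \<inter> W\<close>, so that Koszul chains become functions on subsets of \<open>W\<close>.\<close>

definition squarefree_chain :: "'v set \<Rightarrow> nat \<Rightarrow> ('v set \<Rightarrow> 'k::field) \<Rightarrow> 'v set \<Rightarrow> nat \<Rightarrow> ('v, 'k) mpoly" where
  "squarefree_chain W j f T k = (if k = 0 \<and> - T \<subseteq> W \<and> card (- T) = j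
     then single (indicator_exp (T \<inter> W)) (f (T \<inter> W)) else 0)"

lemma squarefree_chain_cong:
  assumes "\<And>T. T \<subseteq> W \<Longrightarrow> card (W - T) = j \<Longrightarrow> f T = g T"
  shows "squarefree_chain W j f = squarefree_chain W j g"
proof (intro ext)
  fix T k
  have "f (T \<inter> W) = g (T \<inter> W)" if "- T \<subseteq> W" "card (- T) = j"
  proof (rule assms)
    have "W - T \<inter> W = - T" using that by blast
    thus "card (W - T \<inter> W) = j" using that by simp
  qed simp
  thus "squarefree_chain W j f T k = squarefree_chain W j g T k" by (simp add: squarefree_chain_def)
qed

lemma squarefree_chain_inject:
  assumes "squarefree_chain W j f = squarefree_chain W j g" "T \<subseteq> W" "card (W - T) = j"
  shows "f T = g T"
proof -
  have T: "- (T \<union> - W) = W - T" "(T \<union> - W) \<inter> W = T" using assms(2) by auto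
  have "squarefree_chain W j f (T \<union> - W) 0 = squarefree_chain W j g (T \<union> - W) 0"
    by (simp add: assms(1))
  hence "single (indicator_exp T) (f T) = single (indicator_exp T) (g T)"
    using assms(3) by (simp only: squarefree_chain_def T) auto
  thus ?thesis by (metis lookup_single_eq)
qed

lemma indicator_exp_split: "- T \<subseteq> W \<Longrightarrow> indicator_exp (T \<inter> W) + indicator_exp (- T) = indicator_exp W"
  by (rule poly_mapping_eqI) (auto simp: lookup_add)

lemma ideal_chain_squarefree:
  fixes E :: "'v set set" and c :: "'v set \<Rightarrow> nat \<Rightarrow> ('v, 'k::field) mpoly"
  assumes E: "simple_graph UNIV E"
    and c: "c \<in> ideal_chains (\<lambda>m. m) (edge_ideal E) (indicator_exp W) j"
  shows "\<exists>f. c = squarefree_chain W j f \<and> (\<forall>T\<in>independent_sets E W. f T = 0)"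
proof -
  define f where "f T = coeff (c (T \<union> - W) 0) (indicator_exp T)" for T
  have key: "- T \<subseteq> W \<and> card (- T) = j \<and> a = indicator_exp (T \<inter> W)" if a: "a \<in> keys (c T 0)" for T a
  proof -
    have m: "a + indicator_exp (- T) = indicator_exp W" and j: "card (- T) = j"
      using c a by (auto simp: ideal_chains_def)
    have TW: "- T \<subseteq> W"
    proof
      fix v assume "v \<in> - T"
      hence "coeff (indicator_exp W) v \<noteq> 0" unfolding m[symmetric] by (simp add: lookup_add)
      thus "v \<in> W" by (simp split: if_splits)
    qed
    have "a = indicator_exp (T \<inter> W)"
      using m indicator_exp_split[OF TW] by (metis add_right_cancel)
    with TW j show ?thesis by blast
  qed
  have "c = squarefree_chain W j f"
  proof (intro ext poly_mapping_eqI)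
    fix T k a
    show "coeff (c T k) a = coeff (squarefree_chain W j f T k) a"
    proof (cases "k = 0 \<and> - T \<subseteq> W \<and> card (- T) = j")
      case True
      hence "T \<inter> W \<union> - W = T" by auto
      thus ?thesis using True key[of a T]
        by (auto simp: squarefree_chain_def f_def lookup_single when_def in_keys_iff)
    next
      case False
      have "coeff (c T k) a = 0"
      proof (cases "k = 0")
        case True thus ?thesis using False key[of a T] by (auto simp: in_keys_iff)
      next
        case False thus ?thesis using c by (simp add: ideal_chains_def)
      qed
      moreover have "squarefree_chain W j f T k = 0" using False by (auto simp: squarefree_chain_def)
      ultimately show ?thesis by simp
    qed
  qed
  moreover have "f T = 0" if T: "T \<in> independent_sets E W" for T
  proof (rule ccontr)
    assume "f T \<noteq> 0"
    hence "indicator_exp T \<in> keys (c (T \<union> - W) 0)" by (simp add: f_def in_keys_iff)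
    moreover have "c (T \<union> - W) 0 \<in> edge_ideal E" using c by (simp add: ideal_chains_def)
    ultimately have "covers_edge E (indicator_exp T)" by (simp add: edge_ideal_iff[OF E])
    thus False using T by (auto simp: covers_edge_indicator independent_sets_def)
  qed
  ultimately show ?thesis by blast
qed

lemma squarefree_chain_ideal:
  fixes E :: "'v set set" and f :: "'v set \<Rightarrow> 'k::field"
  assumes E: "simple_graph UNIV E"
    and f: "\<And>T. T \<in> independent_sets E W \<Longrightarrow> card (W - T) = j \<Longrightarrow> f T = 0"
  shows "squarefree_chain W j f \<in> ideal_chains (\<lambda>m. m) (edge_ideal E) (indicator_exp W) j"
proof -
  have key: "covers_edge E a \<and> card (- T) = j \<and> a + indicator_exp (- T) = indicator_exp W"
    if "a \<in> keys (squarefree_chain W j f T 0)" for T a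
  proof -
    have T: "- T \<subseteq> W" "card (- T) = j" and a: "a = indicator_exp (T \<inter> W)" and nz: "f (T \<inter> W) \<noteq> 0"
      using that by (auto simp: squarefree_chain_def split: if_splits)
    have "W - T \<inter> W = - T" using T by blast
    hence "T \<inter> W \<notin> independent_sets E W" using f[of "T \<inter> W"] nz T by auto
    hence "covers_edge E a" by (auto simp: a covers_edge_indicator independent_sets_def)
    thus ?thesis using T a indicator_exp_split by blast
  qed
  show ?thesis
    unfolding ideal_chains_def edge_ideal_iff[OF E]
  proof (intro CollectI conjI allI impI ballI)
    fix T and k :: nat assume "1 \<le> k"
    thus "squarefree_chain W j f T k = 0" by (simp add: squarefree_chain_def)
  qed (use key in blast)+
qed

text \<open>Listing the vertices of \<open>W\<close> first makes the signs in \<open>T\<close> and in \<open>T \<inter> W\<close> agree.\<close>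

lemma koszul_squarefree_chain:
  fixes f :: "'v set \<Rightarrow> 'k::field"
  assumes first: "\<And>u v. u \<in> W \<Longrightarrow> v \<notin> W \<Longrightarrow> idx u < idx v"
  shows "koszul (squarefree_chain W (Suc j) f) = squarefree_chain W j (codiff f)"
    and "koszul (squarefree_chain W 0 f) = 0"
proof -
  define g where "g j T v = psgn v T * variable v * squarefree_chain W j f (T - {v}) 0" for j T v
  have sum: "koszul (squarefree_chain W j f) T k = (if k = 0 then \<Sum>v\<in>T. g j T v else 0)" for j T k
    by (simp add: koszul_def kdiff_def g_def squarefree_chain_def)
  have card: "card (- (T - {v})) = Suc (card (- T))" if "v \<in> T" for T :: "'v set" and v
  proof -
    have "- (T - {v}) = insert v (- T)" using that by auto
    thus ?thesis using that by simp
  qed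
  have "g 0 T v = 0" if "v \<in> T" for T v
    using card[OF that] by (simp add: g_def squarefree_chain_def del: Compl_Diff_eq)
  thus "koszul (squarefree_chain W 0 f) = 0" by (auto simp: fun_eq_iff sum)
  show "koszul (squarefree_chain W (Suc j) f) = squarefree_chain W j (codiff f)"
  proof (intro ext)
    fix T k
    show "koszul (squarefree_chain W (Suc j) f) T k = squarefree_chain W j (codiff f) T k"
    proof (cases "k = 0 \<and> - T \<subseteq> W \<and> card (- T) = j")
      case False
      have "g (Suc j) T v = 0" if "v \<in> T" "k = 0" for v
        using card[OF that(1)] False that by (auto simp: g_def squarefree_chain_def simp del: Compl_Diff_eq)
      thus ?thesis using False by (auto simp: sum squarefree_chain_def)
    next
      case True
      define m where "m = indicator_exp (T \<inter> W)"
      have term_eq: "g (Suc j) T v = single m (psgn v (T \<inter> W) * f (T \<inter> W - {v}))"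
        if v: "v \<in> T \<inter> W" for v
      proof -
        have 1: "- (T - {v}) \<subseteq> W" "(T - {v}) \<inter> W = T \<inter> W - {v}" using v True by auto
        have "var_exp v + indicator_exp (T \<inter> W - {v}) = m"
          using indicator_exp_insert[of v "T \<inter> W - {v}"] v by (simp add: m_def insert_absorb add.commute)
        hence "variable v * squarefree_chain W (Suc j) f (T - {v}) 0 = single m (f (T \<inter> W - {v}))"
          using True card[of v T] v 1
          by (simp add: squarefree_chain_def variable_def mult_single del: Compl_Diff_eq)
        moreover have "(psgn v T :: ('v, 'k) mpoly) = psgn v (T \<inter> W)"
        proof -
          have "{u \<in> T. idx u < idx v} = {u \<in> T \<inter> W. idx u < idx v}"
            using first[of v] v by (metis (no_types, lifting) Int_iff not_less_iff_gr_or_eq)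
          thus ?thesis by (simp add: psgn_def)
        qed
        ultimately have "g (Suc j) T v = psgn v (T \<inter> W) * single m (f (T \<inter> W - {v}))"
          by (simp add: g_def mult.assoc)
        also have "\<dots> = single m (psgn v (T \<inter> W) * f (T \<inter> W - {v}))"
          by (rule poly_mapping_eqI) (simp add: coeff_psgn_mult lookup_single when_def)
        finally show ?thesis .
      qed
      have "g (Suc j) T v = 0" if v: "v \<in> T" "v \<notin> W" for v
      proof -
        have "\<not> - (T - {v}) \<subseteq> W" using v by auto
        hence "squarefree_chain W (Suc j) f (T - {v}) 0 = 0"
          unfolding squarefree_chain_def by (intro if_not_P) blast
        thus ?thesis by (simp add: g_def)
      qed
      hence "(\<Sum>v\<in>T. g (Suc j) T v) = (\<Sum>v\<in>T \<inter> W. g (Suc j) T v)"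
        by (intro sum.mono_neutral_right) auto
      also have "\<dots> = (\<Sum>v\<in>T \<inter> W. single m (psgn v (T \<inter> W) * f (T \<inter> W - {v})))"
        by (intro sum.cong refl term_eq)
      also have "\<dots> = single m (codiff f (T \<inter> W))"
        by (rule poly_mapping_eqI) (auto simp: lookup_sum lookup_single when_def kdiff_def)
      finally show ?thesis using True by (simp add: sum squarefree_chain_def m_def)
    qed
  qed
qed

lemma squarefree_chain_diff: "squarefree_chain W j (f - g) = squarefree_chain W j f - squarefree_chain W j g"
  and squarefree_chain_scale: "squarefree_chain W j (cochain_scale a f) = poly_scale a (squarefree_chain W j f)"
  by (simp_all add: fun_eq_iff squarefree_chain_def single_diff cochain_scale_def poly_scale_def mult_single)

text \<open>In this multidegree the chains with coefficients in the ideal are the cochains on the simplex with vertex set \<open>W\<close> that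
  vanish on the independent sets. As the simplex is acyclic, every cocycle among them is the
  coboundary of some \<open>\<omega>\<close>, and the restriction of \<open>\<omega>\<close> to independent sets is the corresponding cocycle
  of the complex, with one element less.\<close>

theorem koszul_squarefree:
  fixes E :: "'v set set"
  assumes E: "simple_graph UNIV E"
    and first: "\<And>u v. u \<in> W \<Longrightarrow> v \<notin> W \<Longrightarrow> idx u < idx v"
    and W: "W \<noteq> {}" "n + i + 1 = card W"
    and d: "qdim cochain_scale (cocycles (independent_sets E W) n :: ('v set \<Rightarrow> 'k::field) set)
      (coboundaries (independent_sets E W) n) d"
  shows "qdim poly_scale (koszul_cycles (\<lambda>m. m) (edge_ideal E :: ('v, 'k) mpoly set) (indicator_exp W) i)
    (koszul_boundaries (\<lambda>m. m) (edge_ideal E) (indicator_exp W) i) d"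
proof -
  let ?I = "edge_ideal E :: ('v, 'k) mpoly set" and ?m = "indicator_exp W" and ?\<Delta> = "independent_sets E W"
  let ?C = "squarefree_chain W"
  have kz: "koszul (?C (Suc j) f) = ?C j (codiff f)" "koszul (?C 0 f) = 0" for j and f :: "'v set \<Rightarrow> 'k"
    by (rule koszul_squarefree_chain, rule first, assumption+)+
  have card: "card (W - T) = j \<longleftrightarrow> card T + j = card W" if "T \<subseteq> W" for T j
    using that card_mono[OF _ that] by (auto simp: card_Diff_subset finite_subset)
  have sub: "T \<subseteq> W" if "T \<in> ?\<Delta>" for T using that by (simp add: independent_sets_def)
  obtain x where x: "x \<in> W" using W by blast
  have simplex: "\<exists>\<psi>. \<forall>T\<subseteq>W. card T = k \<longrightarrow> \<phi> T = codiff \<psi> T"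
    if "\<And>T. T \<subseteq> W \<Longrightarrow> card T = Suc k \<Longrightarrow> codiff \<phi> T = 0" for \<phi> :: "'v set \<Rightarrow> 'k" and k
  proof -
    have "\<phi> \<in> cocycles (Pow W) k" using that by (simp add: cocycles_def)
    moreover have "cocycles (Pow W) k \<subseteq> (coboundaries (Pow W) k :: ('v set \<Rightarrow> 'k) set)"
      by (rule cone_acyclic[of _ x]) (use x in auto)
    ultimately have "\<phi> \<in> coboundaries (Pow W) k" by blast
    thus ?thesis by (simp add: coboundaries_def Ball_def)
  qed
  show ?thesis
  proof (rule qdim_transfer[where \<rho> = "\<lambda>\<phi> c. \<exists>\<omega>. c = ?C i (codiff \<omega>) \<and> (\<forall>T\<in>?\<Delta>. card T = n \<longrightarrow> \<phi> T = \<omega> T)"])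
    show "qdim cochain_scale (cocycles ?\<Delta> n :: ('v set \<Rightarrow> 'k) set) (coboundaries ?\<Delta> n) d" by (fact d)
    have "0 = ?C i (codiff 0 :: 'v set \<Rightarrow> 'k)" by (simp add: fun_eq_iff squarefree_chain_def kdiff_def)
    thus "\<exists>\<omega>. 0 = ?C i (codiff \<omega>) \<and> (\<forall>T\<in>?\<Delta>. card T = n \<longrightarrow> (0 :: 'v set \<Rightarrow> 'k) T = \<omega> T)"
      by (intro exI[of _ 0]) simp
  next
    fix \<phi> \<phi>' :: "'v set \<Rightarrow> 'k" and c c'
    assume "\<exists>\<omega>. c = ?C i (codiff \<omega>) \<and> (\<forall>T\<in>?\<Delta>. card T = n \<longrightarrow> \<phi> T = \<omega> T)"
      and "\<exists>\<omega>. c' = ?C i (codiff \<omega>) \<and> (\<forall>T\<in>?\<Delta>. card T = n \<longrightarrow> \<phi>' T = \<omega> T)"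
    then obtain \<omega> \<omega>' where "c = ?C i (codiff \<omega>)" "\<forall>T\<in>?\<Delta>. card T = n \<longrightarrow> \<phi> T = \<omega> T"
      "c' = ?C i (codiff \<omega>')" "\<forall>T\<in>?\<Delta>. card T = n \<longrightarrow> \<phi>' T = \<omega>' T" by blast
    thus "\<exists>\<omega>. c - c' = ?C i (codiff \<omega>) \<and> (\<forall>T\<in>?\<Delta>. card T = n \<longrightarrow> (\<phi> - \<phi>') T = \<omega> T)"
      by (intro exI[of _ "\<omega> - \<omega>'"]) (simp add: codiff_minus squarefree_chain_diff)
  next
    fix a and \<phi> :: "'v set \<Rightarrow> 'k" and c
    assume "\<exists>\<omega>. c = ?C i (codiff \<omega>) \<and> (\<forall>T\<in>?\<Delta>. card T = n \<longrightarrow> \<phi> T = \<omega> T)"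
    then obtain \<omega> where "c = ?C i (codiff \<omega>)" "\<forall>T\<in>?\<Delta>. card T = n \<longrightarrow> \<phi> T = \<omega> T" by blast
    thus "\<exists>\<omega>. poly_scale a c = ?C i (codiff \<omega>) \<and>
        (\<forall>T\<in>?\<Delta>. card T = n \<longrightarrow> cochain_scale a \<phi> T = \<omega> T)"
      by (intro exI[of _ "cochain_scale a \<omega>"])
         (simp add: codiff_cochain_scale squarefree_chain_scale, simp add: cochain_scale_def)
  next
    fix \<phi> :: "'v set \<Rightarrow> 'k" assume \<phi>: "\<phi> \<in> cocycles ?\<Delta> n"
    have "?C i (codiff \<phi>) \<in> ideal_chains (\<lambda>m. m) ?I ?m i"
      using W card[OF sub] by (intro squarefree_chain_ideal[OF E] cocyclesD[OF \<phi>]) auto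
    moreover have "koszul (?C i (codiff \<phi>)) = 0"
    proof (cases i)
      case (Suc j)
      have "?C j 0 = (0 :: 'v set \<Rightarrow> nat \<Rightarrow> ('v, 'k) mpoly)"
        by (simp add: fun_eq_iff squarefree_chain_def)
      thus ?thesis by (simp add: Suc kz)
    qed (simp add: kz)
    ultimately have "?C i (codiff \<phi>) \<in> koszul_cycles (\<lambda>m. m) ?I ?m i" by (simp add: koszul_cycles_def)
    thus "\<exists>c\<in>koszul_cycles (\<lambda>m. m) ?I ?m i. \<exists>\<omega>. c = ?C i (codiff \<omega>) \<and>
        (\<forall>T\<in>?\<Delta>. card T = n \<longrightarrow> \<phi> T = \<omega> T)" by blast
  next
    fix c assume "c \<in> koszul_cycles (\<lambda>m. m) ?I ?m i"
    hence c: "c \<in> ideal_chains (\<lambda>m. m) ?I ?m i" and cyc: "koszul c = 0" by (auto simp: koszul_cycles_def)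
    from ideal_chain_squarefree[OF E c] obtain f where
      f: "c = ?C i f" "\<And>T. T \<in> ?\<Delta> \<Longrightarrow> f T = 0" by blast
    have "codiff f T = 0" if T: "T \<subseteq> W" "card T = Suc (Suc n)" for T
    proof (cases i)
      case 0
      thus ?thesis using W card_mono[OF _ T(1)] T(2) by simp
    next
      case (Suc j)
      have "?C j (codiff f) = ?C j 0"
        using cyc f(1) kz(1)[of j f] Suc by (simp add: fun_eq_iff squarefree_chain_def)
      from squarefree_chain_inject[OF this T(1)] show ?thesis using card[OF T(1)] T(2) W Suc by simp
    qed
    from simplex[OF this] obtain \<omega> where
      \<omega>: "\<And>T. T \<subseteq> W \<Longrightarrow> card T = Suc n \<Longrightarrow> f T = codiff \<omega> T" by blast
    have "codiff \<omega> T = 0" if "T \<in> ?\<Delta>" "card T = Suc n" for T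
      using \<omega>[OF sub[OF that(1)] that(2)] f(2)[OF that(1)] by simp
    hence "\<omega> \<in> cocycles ?\<Delta> n" by (simp add: cocycles_def)
    moreover have "c = ?C i (codiff \<omega>)"
      unfolding f(1) using \<omega> card W by (intro squarefree_chain_cong) auto
    ultimately show "\<exists>\<phi>\<in>cocycles ?\<Delta> n. \<exists>\<omega>. c = ?C i (codiff \<omega>) \<and>
        (\<forall>T\<in>?\<Delta>. card T = n \<longrightarrow> \<phi> T = \<omega> T)" by blast
  next
    fix \<phi> :: "'v set \<Rightarrow> 'k" and c
    assume "\<exists>\<omega>. c = ?C i (codiff \<omega>) \<and> (\<forall>T\<in>?\<Delta>. card T = n \<longrightarrow> \<phi> T = \<omega> T)"
    then obtain \<omega> where \<omega>: "c = ?C i (codiff \<omega>)" "\<And>T. T \<in> ?\<Delta> \<Longrightarrow> card T = n \<Longrightarrow> \<phi> T = \<omega> T" by blast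
    show "\<phi> \<in> coboundaries ?\<Delta> n \<longleftrightarrow> c \<in> koszul_boundaries (\<lambda>m. m) ?I ?m i"
    proof
      assume "\<phi> \<in> coboundaries ?\<Delta> n"
      then obtain \<rho> where \<rho>: "\<And>T. T \<in> ?\<Delta> \<Longrightarrow> card T = n \<Longrightarrow> \<phi> T = codiff \<rho> T"
        by (auto simp: coboundaries_def)
      define u where "u = \<omega> - codiff \<rho>"
      have "u T = 0" if "T \<in> ?\<Delta>" "card (W - T) = Suc i" for T
      proof -
        have "card T + Suc i = card W" using card[OF sub[OF that(1)], of "Suc i"] that(2) by blast
        hence "card T = n" using W by simp
        thus ?thesis using \<rho>[OF that(1)] \<omega>(2)[OF that(1)] by (simp add: u_def)
      qed
      hence "?C (Suc i) u \<in> ideal_chains (\<lambda>m. m) ?I ?m (Suc i)" by (rule squarefree_chain_ideal[OF E])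
      moreover have "codiff u = codiff \<omega>" by (simp add: u_def codiff_minus)
      hence "koszul (?C (Suc i) u) = c" unfolding \<omega>(1) kz(1) by simp
      ultimately show "c \<in> koszul_boundaries (\<lambda>m. m) ?I ?m i" by (auto simp: koszul_boundaries_def)
    next
      assume "c \<in> koszul_boundaries (\<lambda>m. m) ?I ?m i"
      then obtain u where u: "u \<in> ideal_chains (\<lambda>m. m) ?I ?m (Suc i)" "c = koszul u"
        by (auto simp: koszul_boundaries_def)
      from ideal_chain_squarefree[OF E u(1)] obtain f where
        f: "u = ?C (Suc i) f" "\<And>T. T \<in> ?\<Delta> \<Longrightarrow> f T = 0" by blast
      have eq: "?C i (codiff \<omega>) = ?C i (codiff f)" using \<omega>(1) u(2) f(1) kz(1) by simp
      have "codiff (\<omega> - f) T = 0" if "T \<subseteq> W" "card T = Suc n" for T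
        using squarefree_chain_inject[OF eq that(1)] card[OF that(1)] that(2) W by (simp add: codiff_minus)
      from simplex[OF this] obtain \<rho> where
        \<rho>: "\<And>T. T \<subseteq> W \<Longrightarrow> card T = n \<Longrightarrow> (\<omega> - f) T = codiff \<rho> T" by blast
      show "\<phi> \<in> coboundaries ?\<Delta> n"
      proof (rule coboundariesI)
        fix T assume T: "T \<in> ?\<Delta>" "card T = n"
        thus "\<phi> T = codiff \<rho> T" using \<omega>(2)[OF T] f(2)[OF T(1)] \<rho>[OF sub[OF T(1)] T(2)] by simp
      qed
    qed
  qed
qed

end

section \<open>Betti numbers of bipartite edge ideals\<close>

lemma bip_complement_bipartite: 
  assumes "bipartition UNIV E X Y"
  shows "bip_complement E X Y \<subseteq> {{x, y} | x y. x \<in> X \<and> y \<notin> X}"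
  using assms by (auto simp: bip_complement_def bipartition_def)

lemma independent_sets_bicliques:
  fixes E :: "'v::finite set set" and idx :: "'v \<Rightarrow> nat"
  assumes bip: "bipartition UNIV E X Y" and idx: "vertex_order idx"
  shows "independent_sets E W = bipartite_graph.bicliques X (bip_complement E X Y) W"
proof -
  interpret vertex_order idx by (fact idx)
  interpret bipartite_graph idx X "bip_complement E X Y"
    by unfold_locales (rule bip_complement_bipartite[OF bip])
  have Y: "y \<in> Y \<longleftrightarrow> y \<notin> X" for y using bip by (auto simp: bipartition_def)
  have adj: "adj x y \<longleftrightarrow> {x, y} \<notin> E" if "x \<in> X" "y \<notin> X" for x y
    unfolding adj_def using that by (auto simp: bip_complement_def doubleton_eq_iff Y)
  have "(\<forall>e\<in>E. \<not> e \<subseteq> T) \<longleftrightarrow> (\<forall>x\<in>T \<inter> X. \<forall>y\<in>T - X. adj x y)" for T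
  proof
    assume ind: "\<forall>e\<in>E. \<not> e \<subseteq> T"
    show "\<forall>x\<in>T \<inter> X. \<forall>y\<in>T - X. adj x y"
    proof (intro ballI)
      fix x y assume xy: "x \<in> T \<inter> X" "y \<in> T - X"
      hence "{x, y} \<subseteq> T" by simp
      with ind have "{x, y} \<notin> E" by metis
      thus "adj x y" using xy adj[of x y] by simp
    qed
  next
    assume *: "\<forall>x\<in>T \<inter> X. \<forall>y\<in>T - X. adj x y"
    show "\<forall>e\<in>E. \<not> e \<subseteq> T"
    proof (intro ballI notI)
      fix e assume e: "e \<in> E" "e \<subseteq> T"
      have "\<exists>x\<in>X. \<exists>y\<in>Y. e = {x, y}" using bip e(1) by (simp add: bipartition_def)
      then obtain x y where xy: "x \<in> X" "y \<in> Y" "e = {x, y}" by blast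
      with e(2) Y have "x \<in> T \<inter> X" "y \<in> T - X" by simp_all
      hence "adj x y" using * by blast
      thus False using adj[of x y] xy e Y by auto
    qed
  qed
  thus ?thesis by (simp add: independent_sets_def bicliques_def)
qed

lemma vertex_order_starting_with: "\<exists>idx :: 'v::finite \<Rightarrow> nat. inj idx \<and> (\<forall>u\<in>W. \<forall>v. v \<notin> W \<longrightarrow> idx u < idx v)"
proof -
  obtain f :: "'v \<Rightarrow> nat" and n where f: "f ` UNIV = {i. i < n}" "inj f"
    using finite_imp_inj_to_nat_seg[of "UNIV :: 'v set"] by auto
  have fn: "f v < n" for v using f(1) by auto
  define idx where "idx v = (if v \<in> W then f v else n + f v)" for v
  have "inj idx"
  proof (rule injI)
    fix u v assume "idx u = idx v"
    hence "f u = f v" using fn[of u] fn[of v] by (auto simp: idx_def split: if_splits)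
    thus "u = v" using f(2) by (simp add: inj_eq)
  qed
  moreover have "idx u < idx v" if "u \<in> W" "v \<notin> W" for u v
    using that fn[of u] by (simp add: idx_def)
  ultimately show ?thesis by blast
qed

lemma total_degree_indicator_exp: "total_degree (indicator_exp W) = card W"
  by (simp add: total_degree_def sum.If_cases)

text \<open>For \<open>m = indicator_exp W\<close> the cohomology in question is at \<open>n = card W - i - 1\<close>, and the inequality
  \<open>i \<le> t - 4\<close> becomes the bound \<open>card W + 3 \<le> t + n\<close> of the vanishing theorem.\<close>

theorem multigraded_betti_bipartite:
  fixes E :: "'v::finite set set" and m :: "'v \<Rightarrow>\<^sub>0 nat"
  assumes E: "simple_graph UNIV E" and bip: "bipartition UNIV E X Y"
    and t: "6 \<le> t" and least: "\<And>l. 6 \<le> l \<Longrightarrow> induced_cycles (bip_complement E X Y) l \<noteq> {} \<Longrightarrow> t \<le> l"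
    and i: "i \<le> t - 4" "i + 4 \<le> total_degree m"
  shows "multigraded_betti (edge_ideal E :: ('v, 'k::field) mpoly set) i m =
    (if \<exists>W\<in>induced_cycles (bip_complement E X Y) t. i = t - 4 \<and> m = indicator_exp W then 1 else 0)"
proof -
  define I where "I = (edge_ideal E :: ('v, 'k) mpoly set)"
  define W where "W = {v. coeff m v \<noteq> 0}"
  obtain F where F: "minimal_graded_free_resolution (\<lambda>m. m) I F"
    unfolding I_def using minimal_multigraded_resolution_exists[OF E] by blast
  obtain idx :: "'v \<Rightarrow> nat" where "inj idx" and first: "\<And>u v. u \<in> W \<Longrightarrow> v \<notin> W \<Longrightarrow> idx u < idx v"
    using vertex_order_starting_with by metis
  from \<open>inj idx\<close> interpret vertex_order idx by unfold_locales
  interpret bipartite_graph idx X "bip_complement E X Y"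
    by unfold_locales (rule bip_complement_bipartite[OF bip])
  show ?thesis
  proof (cases "squarefree_exp m")
    case False
    then obtain v where "\<not> coeff m v \<le> 1" unfolding squarefree_exp_def by blast
    hence "2 \<le> coeff m v" by simp
    hence "qdim poly_scale (koszul_cycles (\<lambda>m. m) I m i) (koszul_boundaries (\<lambda>m. m) I m i) 0"
      unfolding I_def by (rule koszul_nonsquarefree[OF E])
    from betti_eqI[OF grading_id F this]
    have "multigraded_betti I i m = 0" by (simp add: multigraded_betti_def)
    moreover have "m \<noteq> indicator_exp W" for W using False by auto
    ultimately show ?thesis by (simp add: I_def)
  next
    case True
    hence m: "m = indicator_exp W" unfolding W_def by (rule squarefree_exp_indicator)
    have W: "i + 4 \<le> card W" using i(2) by (simp add: m total_degree_indicator_exp)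
    define n where "n = card W - i - 1"
    have n: "3 \<le> n" "n + i + 1 = card W" using W by (auto simp: n_def)
    have "W \<noteq> {}" using W by auto
    have betti: "multigraded_betti I i m = d"
      if "qdim cochain_scale (cocycles (bicliques W) n :: ('v set \<Rightarrow> 'k) set) (coboundaries (bicliques W) n) d" for d
    proof -
      have eq: "independent_sets E W = bicliques W"
        by (rule independent_sets_bicliques[OF bip vertex_order_axioms])
      have "qdim poly_scale (koszul_cycles (\<lambda>m. m) I m i) (koszul_boundaries (\<lambda>m. m) I m i) d"
        unfolding I_def m using that
        by (intro koszul_squarefree[OF E first \<open>W \<noteq> {}\<close> n(2)]) (simp_all add: eq)
      from betti_eqI[OF grading_id F this] show ?thesis by (simp add: multigraded_betti_def)
    qed
    have inj: "W = W'" if "m = indicator_exp W'" for W'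
      using that unfolding W_def by auto
    show ?thesis
    proof (cases "n = 3 \<and> W \<in> induced_cycles (bip_complement E X Y) t")
      case True
      have "card W = t" using True by (simp add: induced_cycle_card)
      hence "i = t - 4" using True n by simp
      moreover have "multigraded_betti I i m = 1"
        using qdim_cycle[OF _ t least, where 'k='k] True by (intro betti) auto
      ultimately show ?thesis using True m by (auto simp: I_def)
    next
      case False
      have "card W + 3 \<le> t + n" using n i t by simp
      hence "multigraded_betti I i m = 0"
        using False by (intro betti qdim_0 acyclic_small[OF least n(1)]) auto
      moreover have "\<not> (\<exists>W\<in>induced_cycles (bip_complement E X Y) t. i = t - 4 \<and> m = indicator_exp W)"
      proof
        assume "\<exists>W\<in>induced_cycles (bip_complement E X Y) t. i = t - 4 \<and> m = indicator_exp W"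
        then obtain W' where W': "W' \<in> induced_cycles (bip_complement E X Y) t" "i = t - 4"
          "m = indicator_exp W'" by blast
        have "W' = W" using inj[OF W'(3)] by simp
        moreover have "card W' = t" using W'(1) by (rule induced_cycle_card)
        ultimately show False using False W' n t by simp
      qed
      ultimately show ?thesis by (simp add: I_def)
    qed
  qed
qed

lemma inj_indicator_exp: "inj (indicator_exp :: 'v::finite set \<Rightarrow> _)"
proof (rule injI)
  fix V W :: "'v set" assume eq: "indicator_exp V = indicator_exp W"
  have "v \<in> V \<longleftrightarrow> v \<in> W" for v
    using arg_cong[OF eq, of "\<lambda>m. coeff m v"] by (simp split: if_splits)
  thus "V = W" by blast
qed

lemma indicator_exp_eq_iff:
  "m = indicator_exp W \<longleftrightarrow> (\<forall>v. coeff m v \<in> {0, 1}) \<and> W = {v. coeff m v = 1}"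
proof
  assume "(\<forall>v. coeff m v \<in> {0, 1}) \<and> W = {v. coeff m v = 1}"
  thus "m = indicator_exp W" by (intro poly_mapping_eqI) auto
qed auto

text \<open>A generator counted by a graded Betti number contributes to the multigraded Betti number of its own
  degree, which is 0 or 1 in the range considered. The generators of \<open>F\<^sub>t\<^sub>-\<^sub>4\<close> of total degree \<open>t\<close> thus
  have pairwise different degrees, and these are the indicators of the induced \<open>t\<close>-cycles.\<close>

theorem theorem3p2:
  fixes E :: "'v::finite set set"
    and X Y :: "'v set"
    and I :: "('v, 'k::field) mpoly set"
    and s t :: nat
  assumes "simple_graph UNIV E"
    and "connected_graph UNIV E"
    and "bipartition UNIV E X Y"
    and "I = edge_ideal E"
    and "regularity I > 3"
    and "t = 2 * s" and "t \<ge> 6"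
    and "induced_cycles (bip_complement E X Y) t \<noteq> {}"
    and "\<forall>l\<ge>6. induced_cycles (bip_complement E X Y) l \<noteq> {} \<longrightarrow> t \<le> l"
  shows "(\<forall>i j. i < t - 4 \<and> j > i + 3 \<longrightarrow> graded_betti I i j = 0) \<and>
    graded_betti I (t - 4) t = card (induced_cycles (bip_complement E X Y) t) \<and>
    (\<forall>j>t. graded_betti I (t - 4) j = 0) \<and>
    (\<forall>m :: 'v \<Rightarrow>\<^sub>0 nat. total_degree m = t \<longrightarrow>
       multigraded_betti I (t - 4) m =
         (if (\<forall>v. Poly_Mapping.lookup m v \<in> {0, 1}) \<and>
             (let W = {v. Poly_Mapping.lookup m v = 1}
              in is_cycle t W (induced_edges (bip_complement E X Y) W))
          then 1 else 0))"
proof -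
  define C where "C = induced_cycles (bip_complement E X Y) t"
  have betti: "multigraded_betti I i m = (if \<exists>W\<in>C. i = t - 4 \<and> m = indicator_exp W then 1 else 0)"
    if "i \<le> t - 4" "i + 4 \<le> total_degree m" for i and m :: "'v \<Rightarrow>\<^sub>0 nat"
    unfolding assms(4) C_def
    using assms by (intro multigraded_betti_bipartite that) auto
  have degC: "total_degree (indicator_exp W) = t" if "W \<in> C" for W
    using that by (simp add: C_def induced_cycles_def is_cycle_def total_degree_indicator_exp)
  obtain F where F: "minimal_graded_free_resolution (\<lambda>m. m) I F"
    unfolding assms(4) using minimal_multigraded_resolution_exists[OF assms(1)] by blast
  note graded = graded_betti_eq_card[OF F]
  have multi: "multigraded_betti I i m = card {k. k < rk F i \<and> shift F i k = m}" for i m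
    unfolding multigraded_betti_def by (rule betti_eq_card[OF grading_id F])
  have cycle: "i = t - 4 \<and> j = t" if "i \<le> t - 4" "i + 4 \<le> j" "graded_betti I i j \<noteq> 0" for i j
  proof -
    from that(3) obtain k where k: "k < rk F i" "total_degree (shift F i k) = j"
      unfolding graded by (metis (mono_tags, lifting) Collect_empty_eq card.empty)
    hence "{l. l < rk F i \<and> shift F i l = shift F i k} \<noteq> {}" by blast
    hence "multigraded_betti I i (shift F i k) \<noteq> 0" by (simp add: multi)
    with betti[of i "shift F i k"] k that obtain W where "W \<in> C" "i = t - 4" "shift F i k = indicator_exp W"
      by (auto split: if_splits)
    thus ?thesis using degC k(2) by auto
  qed
  have "graded_betti I (t - 4) t = card C"
  proof -
    define S where "S = {k. k < rk F (t - 4) \<and> total_degree (shift F (t - 4) k) = t}"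
    have in_C: "shift F (t - 4) k \<in> indicator_exp ` C" and
      only: "{l. l < rk F (t - 4) \<and> shift F (t - 4) l = shift F (t - 4) k} = {k}" if k: "k \<in> S" for k
    proof -
      let ?K = "{l. l < rk F (t - 4) \<and> shift F (t - 4) l = shift F (t - 4) k}"
      have "k \<in> ?K" using k by (simp add: S_def)
      hence "card ?K \<noteq> 0" by auto
      moreover have eq: "card ?K = (if \<exists>W\<in>C. t - 4 = t - 4 \<and> shift F (t - 4) k = indicator_exp W then 1 else 0)"
        unfolding multi[symmetric] using k assms(7) by (intro betti) (auto simp: S_def)
      ultimately show "shift F (t - 4) k \<in> indicator_exp ` C" by (auto split: if_splits)
      have "card ?K = 1" using \<open>card ?K \<noteq> 0\<close> eq by (auto split: if_splits)
      then obtain l where "?K = {l}" by (auto simp: card_1_singleton_iff)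
      thus "?K = {k}" using \<open>k \<in> ?K\<close> by auto
    qed
    have "inj_on (shift F (t - 4)) S" 
    proof (rule inj_onI)
      fix k l assume kl: "k \<in> S" "l \<in> S" "shift F (t - 4) k = shift F (t - 4) l"
      hence "l \<in> {l. l < rk F (t - 4) \<and> shift F (t - 4) l = shift F (t - 4) k}" by (simp add: S_def)
      thus "k = l" unfolding only[OF kl(1)] by simp
    qed
    moreover have "shift F (t - 4) ` S = indicator_exp ` C"
    proof (intro equalityI subsetI)
      fix m assume "m \<in> indicator_exp ` C"
      then obtain W where W: "W \<in> C" "m = indicator_exp W" by blast
      have "multigraded_betti I (t - 4) m = 1"
        using betti[of "t - 4" m] W degC assms(7) by auto
      hence "card {k. k < rk F (t - 4) \<and> shift F (t - 4) k = m} \<noteq> 0" by (simp add: multi)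
      then obtain k where "k < rk F (t - 4)" "shift F (t - 4) k = m"
        by (metis (mono_tags, lifting) Collect_empty_eq card.empty)
      thus "m \<in> shift F (t - 4) ` S"
        using W degC by (intro image_eqI[of _ _ k]) (simp_all add: S_def)
    next
      fix m assume "m \<in> shift F (t - 4) ` S"
      thus "m \<in> indicator_exp ` C" using in_C by auto
    qed
    ultimately have "card S = card (indicator_exp ` C)" by (metis card_image)
    also have "\<dots> = card C" by (intro card_image inj_on_subset[OF inj_indicator_exp]) simp
    finally show ?thesis by (simp add: graded S_def)
  qed
  moreover have "\<forall>i j. i < t - 4 \<and> j > i + 3 \<longrightarrow> graded_betti I i j = 0"
  proof (intro allI impI)
    fix i j assume "i < t - 4 \<and> j > i + 3"
    thus "graded_betti I i j = 0" using cycle[of i j] by (cases "graded_betti I i j = 0") auto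
  qed
  moreover have "\<forall>j>t. graded_betti I (t - 4) j = 0"
  proof (intro allI impI)
    fix j assume "t < j"
    thus "graded_betti I (t - 4) j = 0"
      using cycle[of "t - 4" j] assms(7) by (cases "graded_betti I (t - 4) j = 0") auto
  qed
  moreover have "multigraded_betti I (t - 4) m =
         (if (\<forall>v. coeff m v \<in> {0, 1}) \<and>
             (let W = {v. coeff m v = 1}
              in is_cycle t W (induced_edges (bip_complement E X Y) W))
          then 1 else 0)" if "total_degree m = t" for m
  proof -
    have "(\<exists>W\<in>C. t - 4 = t - 4 \<and> m = indicator_exp W) \<longleftrightarrow> (\<forall>v. coeff m v \<in> {0, 1}) \<and>
        is_cycle t {v. coeff m v = 1} (induced_edges (bip_complement E X Y) {v. coeff m v = 1})"
      unfolding indicator_exp_eq_iff by (auto simp: C_def induced_cycles_def)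
    thus ?thesis using betti[of "t - 4" m] that assms(7) by (simp add: Let_def)
  qed
  ultimately show ?thesis unfolding C_def by blast
qed

end
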